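(* Let $\alpha,\beta>0$ and $b>0$ with $b\alpha\beta < 1$, and let $\mathcal{E}_{\alpha,\beta} := \{(x,y)\in\mathbb{R}^2 : x^2/\alpha^2 + y^2/\beta^2 < 1\}$. Then $$\mu_1^b(\mathcal{E}_{\alpha,\beta}) \leq \mu_1^b(\mathcal{B}_{R_{\alpha,\beta}}),\qquad R_{\alpha,\beta} = \frac{\sqrt{2}\,\alpha\beta}{\sqrt{\alpha^2+\beta^2}}.$$ Moreover, if $\alpha\neq\beta$, then $\mu_1^b(\mathcal{E}_{\alpha,\beta}) < \mu_1^b(\mathcal{B}_{\sqrt{\alpha\beta}})$.
   Context: $\mathcal{B}_\rho$ denotes the open disk of radius $\rho$ centered at the origin. For a bounded, simply-connected, smooth domain $U\subset\mathbb{R}^2$ and $b>0$, $\mu_1^b(U)$ denotes the lowest eigenvalue of the magnetic Neumann Laplacian on $U$ with homogeneous magnetic field of intensity $b$: $$\mu_1^b(U) = \inf_{u \in H^1(U)\setminus\{0\}} \frac{\int_U |(-i\nabla - \mathbf{A})u|^2\,dx}{\int_U |u|^2\,dx},\qquad \mathbf{A}(x) = \tfrac{b}{2}(-x_2,x_1)^\top.$$ *)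

theory Defs
  imports "HOL-Analysis.Analysis"
begin

text \<open>Compactly supported C^1 test functions in U, with derivative dphi.
  (Weak derivatives defined with C^1_c test functions coincide with those
  defined with C^\<infinity>_c test functions.)\<close>
definition test_fun :: "(real \<times> real) set \<Rightarrow> (real \<times> real \<Rightarrow> real)
    \<Rightarrow> (real \<times> real \<Rightarrow> real \<times> real \<Rightarrow> real) \<Rightarrow> bool" where
  "test_fun U phi dphi \<longleftrightarrow>
     (\<forall>x. (phi has_derivative dphi x) (at x)) \<and>
     continuous_on UNIV (\<lambda>x. dphi x (1, 0)) \<and>
     continuous_on UNIV (\<lambda>x. dphi x (0, 1)) \<and>
     (\<exists>K. compact K \<and> K \<subseteq> U \<and> (\<forall>x. x \<notin> K \<longrightarrow> phi x = 0))"

definition L2_on :: "(real \<times> real) set \<Rightarrow> (real \<times> real \<Rightarrow> complex) \<Rightarrow> bool" where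
  "L2_on U f \<longleftrightarrow> set_borel_measurable lborel U f \<and>
     set_integrable lborel U (\<lambda>x. (cmod (f x))\<^sup>2)"

definition H1_grad :: "(real \<times> real) set \<Rightarrow> (real \<times> real \<Rightarrow> complex)
    \<Rightarrow> (real \<times> real \<Rightarrow> complex) \<Rightarrow> (real \<times> real \<Rightarrow> complex) \<Rightarrow> bool" where
  "H1_grad U u g1 g2 \<longleftrightarrow> L2_on U u \<and> L2_on U g1 \<and> L2_on U g2 \<and>
     (\<forall>phi dphi. test_fun U phi dphi \<longrightarrow>
        (LINT x:U|lborel. u x * complex_of_real (dphi x (1, 0)))
          = - (LINT x:U|lborel. g1 x * complex_of_real (phi x)) \<and>
        (LINT x:U|lborel. u x * complex_of_real (dphi x (0, 1)))
          = - (LINT x:U|lborel. g2 x * complex_of_real (phi x)))"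

text \<open>Pointwise |(-i\<nabla> - A) u|^2 with A(x) = b/2 (-x2, x1).\<close>
definition mag_density :: "real \<Rightarrow> (real \<times> real \<Rightarrow> complex)
    \<Rightarrow> (real \<times> real \<Rightarrow> complex) \<Rightarrow> (real \<times> real \<Rightarrow> complex) \<Rightarrow> real \<times> real \<Rightarrow> real" where
  "mag_density b u g1 g2 x =
     (cmod (- \<i> * g1 x - complex_of_real (b / 2 * (- snd x)) * u x))\<^sup>2 +
     (cmod (- \<i> * g2 x - complex_of_real (b / 2 * fst x) * u x))\<^sup>2"

text \<open>Lowest eigenvalue of the magnetic Neumann Laplacian (Rayleigh quotient infimum).\<close>
definition mu1 :: "real \<Rightarrow> (real \<times> real) set \<Rightarrow> real" where
  "mu1 b U = Inf {(LINT x:U|lborel. mag_density b u g1 g2 x) /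
                   (LINT x:U|lborel. (cmod (u x))\<^sup>2) | u g1 g2.
                  H1_grad U u g1 g2 \<and> (LINT x:U|lborel. (cmod (u x))\<^sup>2) \<noteq> 0}"

definition ellipse :: "real \<Rightarrow> real \<Rightarrow> (real \<times> real) set" where
  "ellipse \<alpha> \<beta> = {(x, y). x\<^sup>2 / \<alpha>\<^sup>2 + y\<^sup>2 / \<beta>\<^sup>2 < 1}"

end

theory Submission
  imports Defs
begin

text \<open>
  For \<open>b S < 1\<close> the lowest eigenvalue \<open>\<mu>\<close> on the disk of radius \<open>sqrt S\<close> is attained by a positive
  radially decreasing function \<open>x \<mapsto> W |x|\<^sup>2\<close>. That no function does better
  follows from the Riccati field \<open>\<nabla> log (W |x|\<^sup>2)\<close>, completing the square in the radial derivative,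
  while on every circle the non-radial angular modes \<open>m \<noteq> 0\<close> cost \<open>m\<^sup>2 / |x|\<^sup>2 - b m \<ge> 0\<close> because
  \<open>b |x|\<^sup>2 \<le> 1\<close>. On the ellipse one tests with \<open>W\<close>, transplanted along the level ellipses and
  multiplied by a phase. Its Rayleigh quotient is that of \<open>W\<close> restricted to the disk of radius
  \<open>sqrt R\<close>, \<open>R = 2 \<alpha>\<^sup>2 \<beta>\<^sup>2 / (\<alpha>\<^sup>2 + \<beta>\<^sup>2)\<close>, namely \<open>\<mu>\<close> plus a boundary term with the sign of
  \<open>W' R\<close>. This term vanishes for \<open>S = R\<close> and is negative for \<open>S = \<alpha> \<beta> > R\<close>.
\<close>

section \<open>The radial ground state\<close>

text \<open>Competing functions are only weakly differentiable and carry no boundary information, so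
  the lower bound on the disk is proved with a radial weight \<open>k\<close> that vanishes near the
  circle; inside its support, mollification reduces the claim to C^1 functions. Differentiating the
  weight adds \<open>2 * t * k' * q\<close> to the divergence, where \<open>q\<close> is the
  coefficient of the Riccati field. As \<open>k' \<le> 0\<close>, this has the right sign only where
  \<open>q \<ge> 0\<close>, whereas the exact choice \<open>2 * W1 / W\<close> is negative inside.
  Adding a constant \<delta> > 0 makes \<open>q\<close> positive near the circle, because
  \<open>W1\<close> vanishes on it, and lowers the bound by at most
  \<open>2 * \<delta> + S * \<delta>\<^sup>2\<close>, which tends to 0.

  The angular modes are treated without Fourier series: multiplication by exp(-i theta / 2) turns
  m^2 - m \<ge> 0 for integers m into the Wirtinger inequality with constant 1/4 for antiperiodic
  functions. Averaging over rotations replaces polar coordinates.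

  The two claims use the disk bound for S = R and S = \<alpha> \<beta>; as R \<le> \<alpha> \<beta>,
  the one hypothesis on b serves both.\<close>

fun radial_coeff :: "real \<Rightarrow> real \<Rightarrow> nat \<Rightarrow> real" where
  "radial_coeff \<kappa> \<nu> 0 = 1"
| "radial_coeff \<kappa> \<nu> (Suc 0) = - \<nu>"
| "radial_coeff \<kappa> \<nu> (Suc (Suc n)) =
     (\<kappa> * radial_coeff \<kappa> \<nu> n - \<nu> * radial_coeff \<kappa> \<nu> (Suc n)) / (real n + 2)\<^sup>2"

text \<open>The divisor is at least 4 and 1/16 + 1/64 is below 4/16, so the rate 1/4 survives the
  recursion. The bound gives convergence for |s| < 4, well past the point 1 of the Neumann
  condition, and keeps the tail small enough for positivity on |s| \<le> 1.\<close>

lemma radial_coeff_bound: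
  assumes "0 \<le> \<nu>" "\<nu> \<le> \<kappa>" "\<kappa> \<le> 1 / 16"
  shows "\<bar>radial_coeff \<kappa> \<nu> n\<bar> \<le> (1 / 4) ^ n"
  using assms
proof (induction \<kappa> \<nu> n rule: radial_coeff.induct)
  case (3 \<kappa> \<nu> n)
  have a: "\<bar>radial_coeff \<kappa> \<nu> n\<bar> \<le> (1 / 4) ^ n" "\<bar>radial_coeff \<kappa> \<nu> (Suc n)\<bar> \<le> (1 / 4) ^ Suc n"
    using 3 by auto
  have "\<bar>\<kappa> * radial_coeff \<kappa> \<nu> n - \<nu> * radial_coeff \<kappa> \<nu> (Suc n)\<bar>
     \<le> \<bar>\<kappa> * radial_coeff \<kappa> \<nu> n\<bar> + \<bar>\<nu> * radial_coeff \<kappa> \<nu> (Suc n)\<bar>"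
    by linarith
  also have "\<dots> \<le> (1/16) * (1 / 4) ^ n + (1/16) * (1 / 4) ^ Suc n"
    unfolding abs_mult using 3 a by (intro add_mono mult_mono) auto
  also have "\<dots> \<le> (1 / 4) ^ Suc (Suc n) * 2\<^sup>2" by simp
  also have "\<dots> \<le> (1 / 4) ^ Suc (Suc n) * (real n + 2)\<^sup>2"
    by (intro mult_left_mono power_mono) auto
  finally show ?case by (simp add: abs_divide field_simps)
qed auto

text \<open>Both sides are the coefficient of s^n in s w'' + w' = (\<kappa> s - \<nu>) w, for the
  solution regular at 0 with w(0) = 1. The coefficient of s^0 receives nothing from \<kappa> s,
  hence the separate case of the recursion.\<close>

lemma radial_coeff_rec:
  "(real n + 1)\<^sup>2 * radial_coeff \<kappa> \<nu> (Suc n) =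
     (if n = 0 then 0 else \<kappa> * radial_coeff \<kappa> \<nu> (n - 1)) - \<nu> * radial_coeff \<kappa> \<nu> n"
proof (cases n)
  case (Suc m)
  have "real n + 1 = real m + 2" using Suc by simp
  then show ?thesis using Suc by (simp only: radial_coeff.simps) simp
qed auto

lemma continuous_on_radial_coeff: "continuous_on A (\<lambda>\<nu>. radial_coeff \<kappa> \<nu> n)"
  by (induction \<kappa> "0::real" n rule: radial_coeff.induct) (auto intro!: continuous_intros)

definition radial_fun :: "real \<Rightarrow> real \<Rightarrow> real \<Rightarrow> real" where
  "radial_fun \<kappa> \<nu> s = (\<Sum>n. radial_coeff \<kappa> \<nu> n * s ^ n)"
definition radial_fun1 :: "real \<Rightarrow> real \<Rightarrow> real \<Rightarrow> real" where
  "radial_fun1 \<kappa> \<nu> s = (\<Sum>n. diffs (radial_coeff \<kappa> \<nu>) n * s ^ n)"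
definition radial_fun2 :: "real \<Rightarrow> real \<Rightarrow> real \<Rightarrow> real" where
  "radial_fun2 \<kappa> \<nu> s = (\<Sum>n. diffs (diffs (radial_coeff \<kappa> \<nu>)) n * s ^ n)"

context
  fixes \<kappa> \<nu> :: real
  assumes nonneg: "0 \<le> \<nu>" and le: "\<nu> \<le> \<kappa>" and small: "\<kappa> \<le> 1 / 16"
begin

lemma summable_radial_coeff:
  assumes "\<bar>s\<bar> < 4" shows "summable (\<lambda>n. radial_coeff \<kappa> \<nu> n * s ^ n)"
proof (rule summable_comparison_test[OF _ summable_geometric[of "\<bar>s\<bar> / 4"]])
  show "\<exists>N. \<forall>n\<ge>N. norm (radial_coeff \<kappa> \<nu> n * s ^ n) \<le> (\<bar>s\<bar> / 4) ^ n"
  proof (intro exI[of _ 0] allI impI)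
    fix n
    have "norm (radial_coeff \<kappa> \<nu> n * s ^ n) \<le> (1 / 4) ^ n * \<bar>s\<bar> ^ n"
      unfolding real_norm_def abs_mult power_abs
      by (intro mult_right_mono radial_coeff_bound nonneg le small) auto
    then show "norm (radial_coeff \<kappa> \<nu> n * s ^ n) \<le> (\<bar>s\<bar> / 4) ^ n"
      by (simp add: power_divide)
  qed
qed (use assms in auto)

lemma summable_radial_coeff1:
  assumes "\<bar>s\<bar> < 4" shows "summable (\<lambda>n. diffs (radial_coeff \<kappa> \<nu>) n * s ^ n)"
  by (rule termdiff_converges[of s 4]) (use assms summable_radial_coeff in auto)

lemma summable_radial_coeff2:
  assumes "\<bar>s\<bar> < 4" shows "summable (\<lambda>n. diffs (diffs (radial_coeff \<kappa> \<nu>)) n * s ^ n)"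
  by (rule termdiff_converges[of s 4]) (use assms summable_radial_coeff1 in auto)

lemma DERIV_radial_fun:
  assumes "\<bar>s\<bar> < 4" shows "(radial_fun \<kappa> \<nu> has_real_derivative radial_fun1 \<kappa> \<nu> s) (at s)"
  unfolding radial_fun_def radial_fun1_def
  by (rule termdiffs_strong'[of 4]) (use assms summable_radial_coeff in auto)

lemma DERIV_radial_fun1:
  assumes "\<bar>s\<bar> < 4" shows "(radial_fun1 \<kappa> \<nu> has_real_derivative radial_fun2 \<kappa> \<nu> s) (at s)"
  unfolding radial_fun1_def radial_fun2_def
  by (rule termdiffs_strong'[of 4]) (use assms summable_radial_coeff1 in auto)

lemma isCont_radial_fun2:
  assumes "\<bar>s\<bar> < 4" shows "isCont (radial_fun2 \<kappa> \<nu>) s"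
  unfolding radial_fun2_def
  by (rule DERIV_isCont, rule termdiffs_strong'[of 4])
    (use assms summable_radial_coeff2 in auto)

lemma radial_fun_ode:
  assumes s: "\<bar>s\<bar> < 4"
  shows "s * radial_fun2 \<kappa> \<nu> s + radial_fun1 \<kappa> \<nu> s = (\<kappa> * s - \<nu>) * radial_fun \<kappa> \<nu> s"
proof -
  let ?c = "radial_coeff \<kappa> \<nu>"
  have s0: "(\<lambda>n. ?c n * s ^ n) sums radial_fun \<kappa> \<nu> s"
    unfolding radial_fun_def by (rule summable_sums, rule summable_radial_coeff, rule s)
  have s1: "(\<lambda>n. diffs ?c n * s ^ n) sums radial_fun1 \<kappa> \<nu> s"
    unfolding radial_fun1_def by (rule summable_sums, rule summable_radial_coeff1, rule s)
  have s2: "(\<lambda>n. diffs (diffs ?c) n * s ^ n) sums radial_fun2 \<kappa> \<nu> s"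
    unfolding radial_fun2_def by (rule summable_sums, rule summable_radial_coeff2, rule s)
  \<comment> \<open>Multiplication by s shifts the series by one index; the term at index 0
    vanishes, so the sum is unchanged.\<close>
  have "(\<lambda>n. (\<lambda>n. real n * diffs ?c n * s ^ n) (Suc n)) sums (s * radial_fun2 \<kappa> \<nu> s)"
    using sums_mult[OF s2, of s] by (simp add: diffs_def algebra_simps)
  then have "(\<lambda>n. real n * diffs ?c n * s ^ n) sums (s * radial_fun2 \<kappa> \<nu> s)"
    by (subst (asm) sums_Suc_iff) simp
  from sums_add[OF this s1]
  have L: "(\<lambda>n. ((real n + 1)\<^sup>2 * ?c (Suc n)) * s ^ n)
      sums (s * radial_fun2 \<kappa> \<nu> s + radial_fun1 \<kappa> \<nu> s)"
    by (simp add: diffs_def algebra_simps power2_eq_square)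
  have "(\<lambda>n. (\<lambda>n. (if n = 0 then 0 else \<kappa> * ?c (n - 1)) * s ^ n) (Suc n)) sums (\<kappa> * s * radial_fun \<kappa> \<nu> s)"
    using sums_mult[OF s0, of "\<kappa> * s"] by (simp add: algebra_simps)
  then have "(\<lambda>n. (if n = 0 then 0 else \<kappa> * ?c (n - 1)) * s ^ n) sums (\<kappa> * s * radial_fun \<kappa> \<nu> s)"
    by (subst (asm) sums_Suc_iff) simp
  from sums_diff[OF this sums_mult[OF s0, of \<nu>]]
  have R: "(\<lambda>n. ((real n + 1)\<^sup>2 * ?c (Suc n)) * s ^ n) sums ((\<kappa> * s - \<nu>) * radial_fun \<kappa> \<nu> s)"
    unfolding radial_coeff_rec by (simp add: algebra_simps)
  show ?thesis by (rule sums_unique2[OF L R])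
qed

text \<open>The constant term is 1 and the rest is at most 1/4 + 1/16 + ... = 1/3 in absolute
  value.\<close>

lemma radial_fun_pos:
  assumes "\<bar>s\<bar> \<le> 1" shows "radial_fun \<kappa> \<nu> s > 0"
proof -
  have sm: "summable (\<lambda>n. radial_coeff \<kappa> \<nu> n * s ^ n)"
    using assms by (intro summable_radial_coeff) auto
  have le': "norm (radial_coeff \<kappa> \<nu> (Suc n) * s ^ Suc n) \<le> (1 / 4) ^ Suc n" for n
  proof -
    have "norm (radial_coeff \<kappa> \<nu> (Suc n) * s ^ Suc n) \<le> (1 / 4) ^ Suc n * 1"
      unfolding real_norm_def abs_mult power_abs
      using assms by (intro mult_mono radial_coeff_bound nonneg le small power_le_one) auto
    then show ?thesis by simp
  qed
  have g: "(\<lambda>n. (1/4::real) ^ Suc n) sums (1/3)"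
    using sums_mult[OF geometric_sums[of "1/4::real"], of "1/4"] by simp
  have "norm (\<Sum>n. radial_coeff \<kappa> \<nu> (Suc n) * s ^ Suc n) \<le> (\<Sum>n. (1/4::real) ^ Suc n)"
    by (rule norm_suminf_le[OF le']) (use g sums_summable in blast)
  also have "\<dots> = 1/3" using g sums_unique by metis
  finally have "\<bar>(\<Sum>n. radial_coeff \<kappa> \<nu> (Suc n) * s ^ Suc n)\<bar> \<le> 1/3" by simp
  moreover have "radial_fun \<kappa> \<nu> s = 1 + (\<Sum>n. radial_coeff \<kappa> \<nu> (Suc n) * s ^ Suc n)"
    unfolding radial_fun_def using suminf_split_head[OF sm] by simp
  ultimately show ?thesis by linarith
qed

text \<open>The equation in divergence form. The flux s w' vanishes at 0 and, where w is positive,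
  its slope has the sign of \<kappa> s - \<nu>; this controls the sign of w'.\<close>

lemma DERIV_radial_flux:
  assumes "\<bar>s\<bar> < 4"
  shows "((\<lambda>s. s * radial_fun1 \<kappa> \<nu> s) has_real_derivative (\<kappa> * s - \<nu>) * radial_fun \<kappa> \<nu> s) (at s)"
  using DERIV_mult[OF DERIV_ident DERIV_radial_fun1[OF assms]] radial_fun_ode[OF assms]
  by (simp add: add.commute mult.commute)

end

text \<open>Prepares the intermediate value argument in \<nu>. Each coefficient is continuous in
  \<nu>, and the differentiated geometric series is a majorant uniform in \<nu>.\<close>

lemma continuous_on_radial_fun1_param:
  assumes "0 \<le> \<kappa>" "\<kappa> \<le> 1 / 16"
  shows "continuous_on {0..\<kappa>} (\<lambda>\<nu>. radial_fun1 \<kappa> \<nu> 1)"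
proof -
  have sm: "summable (\<lambda>n. diffs (\<lambda>n. (1/4::real) ^ n) n * 1 ^ n)"
    by (rule termdiff_converges[of _ 4])
      (auto simp flip: power_mult_distrib power_divide intro!: summable_geometric)
  have "uniform_limit {0..\<kappa>} (\<lambda>n \<nu>. \<Sum>i<n. diffs (radial_coeff \<kappa> \<nu>) i)
      (\<lambda>\<nu>. suminf (\<lambda>i. diffs (radial_coeff \<kappa> \<nu>) i)) sequentially"
  proof (rule Weierstrass_m_test)
    show "summable (\<lambda>n. diffs (\<lambda>n. (1/4::real) ^ n) n)" using sm by simp
    fix n \<nu> assume "\<nu> \<in> {0..\<kappa>}"
    then show "norm (diffs (radial_coeff \<kappa> \<nu>) n) \<le> diffs (\<lambda>n. (1/4::real) ^ n) n"
      using radial_coeff_bound[of \<nu> \<kappa> "Suc n"] assms unfolding diffs_def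
      by (simp add: abs_mult)
  qed
  then show ?thesis unfolding radial_fun1_def
    by (intro uniform_limit_theorem[where F=sequentially])
      (auto intro!: always_eventually continuous_intros continuous_on_radial_coeff simp: diffs_def)
qed

text \<open>Shooting in the spectral parameter. On [0, 1] the flux s w' has nonpositive slope for
  \<nu> = \<kappa> and nonnegative slope for \<nu> = 0, so w'(1) vanishes for some \<nu> in between.
  For this \<nu> the flux is 0 at both ends, and its slope changes sign at most once, from minus to
  plus; hence it is negative inside.\<close>

lemma radial_eigenfunction_unit:
  assumes \<kappa>: "0 < \<kappa>" "\<kappa> \<le> 1 / 16"
  obtains \<nu> where "0 \<le> \<nu>" "\<nu> \<le> \<kappa>" "radial_fun1 \<kappa> \<nu> 1 = 0"
    "\<And>s. 0 < s \<Longrightarrow> s < 1 \<Longrightarrow> radial_fun1 \<kappa> \<nu> s < 0"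
proof -
  have mvt: "\<exists>z. a < z \<and> z < c \<and> c * radial_fun1 \<kappa> \<nu> c - a * radial_fun1 \<kappa> \<nu> a
        = (c - a) * ((\<kappa> * z - \<nu>) * radial_fun \<kappa> \<nu> z)"
    if "0 \<le> \<nu>" "\<nu> \<le> \<kappa>" "0 \<le> a" "a < c" "c \<le> 1" for a c \<nu>
    by (rule MVT2[OF \<open>a < c\<close>])
       (use that \<kappa> in \<open>auto intro!: DERIV_radial_flux\<close>)
  have "radial_fun1 \<kappa> \<kappa> 1 \<le> 0"
  proof -
    obtain z where z: "0 < z" "z < 1" "radial_fun1 \<kappa> \<kappa> 1 = (\<kappa> * z - \<kappa>) * radial_fun \<kappa> \<kappa> z"
      using mvt[of \<kappa> 0 1] \<kappa> by auto
    have "radial_fun \<kappa> \<kappa> z > 0" using z \<kappa> by (intro radial_fun_pos) auto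
    moreover have "\<kappa> * z - \<kappa> \<le> 0" using z \<kappa> by (simp add: mult_le_cancel_left1)
    ultimately show ?thesis using z(3) by (simp add: mult_nonpos_nonneg)
  qed
  moreover have "0 \<le> radial_fun1 \<kappa> 0 1"
  proof -
    obtain z where z: "0 < z" "z < 1" "radial_fun1 \<kappa> 0 1 = (\<kappa> * z - 0) * radial_fun \<kappa> 0 z"
      using mvt[of 0 0 1] \<kappa> by auto
    have "radial_fun \<kappa> 0 z > 0" using z \<kappa> by (intro radial_fun_pos) auto
    then show ?thesis using z \<kappa> by simp
  qed
  ultimately obtain \<nu> where \<nu>: "0 \<le> \<nu>" "\<nu> \<le> \<kappa>" "radial_fun1 \<kappa> \<nu> 1 = 0"
    using IVT2'[of "\<lambda>\<nu>. radial_fun1 \<kappa> \<nu> 1" \<kappa> 0 0] continuous_on_radial_fun1_param[of \<kappa>] \<kappa> by auto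
  have "radial_fun1 \<kappa> \<nu> s < 0" if s: "0 < s" "s < 1" for s
  proof (rule ccontr)
    assume "\<not> radial_fun1 \<kappa> \<nu> s < 0"
    then have nn: "0 \<le> s * radial_fun1 \<kappa> \<nu> s" using s by simp
    \<comment> \<open>A nonnegative flux at s forces a point z < s with \<kappa> z \<ge> \<nu>.
      Beyond s the slope is then positive, so the flux cannot come back to 0 at 1.\<close>
    obtain z where z: "0 < z" "z < s" "s * radial_fun1 \<kappa> \<nu> s = s * ((\<kappa> * z - \<nu>) * radial_fun \<kappa> \<nu> z)"
      using mvt[of \<nu> 0 s] \<nu> s by auto
    obtain y where y: "s < y" "y < 1" "- (s * radial_fun1 \<kappa> \<nu> s) = (1 - s) * ((\<kappa> * y - \<nu>) * radial_fun \<kappa> \<nu> y)"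
      using mvt[of \<nu> s 1] \<nu> s by auto
    have pz: "radial_fun \<kappa> \<nu> z > 0" and py: "radial_fun \<kappa> \<nu> y > 0"
      using z y s \<kappa> \<nu> by (auto intro!: radial_fun_pos)
    have "0 \<le> \<kappa> * z - \<nu>" using nn z(3) pz s
      by (simp add: zero_le_mult_iff)
    moreover have "\<kappa> * z < \<kappa> * y" using z y \<kappa> by simp
    ultimately have "0 < \<kappa> * y - \<nu>" by linarith
    then have "0 < (1 - s) * ((\<kappa> * y - \<nu>) * radial_fun \<kappa> \<nu> y)" using py s by simp
    then show False using y(3) nn by linarith
  qed
  with \<nu> show thesis using that by blast
qed

text \<open>In the variable \<open>t = |x|\<^sup>2\<close> the radial part of the operator is \<open>-4 (t W')' + b\<^sup>2 t / 4 W\<close>,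
  and \<open>W' S = 0\<close> is the Neumann condition on the circle of radius \<open>sqrt S\<close>.\<close>

lemma radial_eigenfunction:
  fixes b S :: real
  assumes "0 < b" "0 < S" "b * S < 1"
  obtains \<mu> W W1 W2 where
    "\<And>t. \<bar>t\<bar> < 2 * S \<Longrightarrow> (W has_real_derivative W1 t) (at t)"
    "\<And>t. \<bar>t\<bar> < 2 * S \<Longrightarrow> (W1 has_real_derivative W2 t) (at t)"
    "\<And>t. \<bar>t\<bar> < 2 * S \<Longrightarrow> isCont W2 t"
    "\<And>t. \<bar>t\<bar> < 2 * S \<Longrightarrow> 4 * (t * W2 t + W1 t) = (b\<^sup>2 * t / 4 - \<mu>) * W t"
    "\<And>t. \<bar>t\<bar> \<le> S \<Longrightarrow> W t > 0"
    "W1 S = 0" "\<And>t. 0 < t \<Longrightarrow> t < S \<Longrightarrow> W1 t < 0"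
proof -
  \<comment> \<open>The substitution t = S s turns the equation into the one on the unit interval
    with \<kappa> = (b S)^2 / 16 and \<nu> = \<mu> S / 4. The hypothesis \<open>b * S < 1\<close> is
    what brings \<kappa> below 1/16.\<close>
  define \<kappa> where "\<kappa> = (b * S)\<^sup>2 / 16"
  have "0 < b * S" using assms by simp
  then have "(b * S)\<^sup>2 \<le> 1" using assms by (intro power_le_one) auto
  then have \<kappa>: "0 < \<kappa>" "\<kappa> \<le> 1 / 16" using \<open>0 < b * S\<close> by (auto simp: \<kappa>_def)
  obtain \<nu> where \<nu>: "0 \<le> \<nu>" "\<nu> \<le> \<kappa>" "radial_fun1 \<kappa> \<nu> 1 = 0"
    "\<And>s. 0 < s \<Longrightarrow> s < 1 \<Longrightarrow> radial_fun1 \<kappa> \<nu> s < 0"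
    using radial_eigenfunction_unit[OF \<kappa>] by blast
  \<comment> \<open>The series converges for |t| < 4 S; the smaller range 2 S still leaves a collar
    outside the circle, in which the trial function will be cut off.\<close>
  have lt: "\<bar>t / S\<bar> < 4" if "\<bar>t\<bar> < 2 * S" for t
    using that assms by (simp add: abs_divide field_simps)
  show thesis
  proof (rule that[of "\<lambda>t. radial_fun \<kappa> \<nu> (t / S)" "\<lambda>t. radial_fun1 \<kappa> \<nu> (t / S) / S"
        "\<lambda>t. radial_fun2 \<kappa> \<nu> (t / S) / S\<^sup>2" "4 * \<nu> / S"])
    fix t assume t: "\<bar>t\<bar> < 2 * S"
    show "((\<lambda>t. radial_fun \<kappa> \<nu> (t / S)) has_real_derivative radial_fun1 \<kappa> \<nu> (t / S) / S) (at t)"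
      using assms lt[OF t] \<nu> \<kappa>
      by (auto intro!: derivative_eq_intros DERIV_chain2[where f="radial_fun \<kappa> \<nu>" and g="\<lambda>t. t / S" and Da="radial_fun1 \<kappa> \<nu> (t / S)" and Db="1 / S", THEN DERIV_cong] DERIV_radial_fun)
    show "((\<lambda>t. radial_fun1 \<kappa> \<nu> (t / S) / S) has_real_derivative radial_fun2 \<kappa> \<nu> (t / S) / S\<^sup>2) (at t)"
      using assms lt[OF t] \<nu> \<kappa>
      by (auto intro!: derivative_eq_intros DERIV_chain2[where f="radial_fun1 \<kappa> \<nu>" and g="\<lambda>t. t / S" and Da="radial_fun2 \<kappa> \<nu> (t / S)" and Db="1 / S"] DERIV_radial_fun1
          simp: power2_eq_square)
    show "isCont (\<lambda>t. radial_fun2 \<kappa> \<nu> (t / S) / S\<^sup>2) t"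
      using isCont_radial_fun2[OF \<nu>(1,2) \<kappa>(2) lt[OF t]] assms
      by (intro continuous_intros isCont_o2[where g="radial_fun2 \<kappa> \<nu>" and f="\<lambda>t. t / S"]) auto
    have "4 * (t * (radial_fun2 \<kappa> \<nu> (t / S) / S\<^sup>2) + radial_fun1 \<kappa> \<nu> (t / S) / S) =
        4 / S * (t / S * radial_fun2 \<kappa> \<nu> (t / S) + radial_fun1 \<kappa> \<nu> (t / S))"
      using assms by (simp add: field_simps power2_eq_square)
    also have "\<dots> = 4 / S * ((\<kappa> * (t / S) - \<nu>) * radial_fun \<kappa> \<nu> (t / S))"
      by (simp only: radial_fun_ode[OF \<nu>(1,2) \<kappa>(2) lt[OF t]])
    also have "\<dots> = (b\<^sup>2 * t / 4 - 4 * \<nu> / S) * radial_fun \<kappa> \<nu> (t / S)"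
      using assms by (simp add: \<kappa>_def field_simps power2_eq_square)
    finally show "4 * (t * (radial_fun2 \<kappa> \<nu> (t / S) / S\<^sup>2) + radial_fun1 \<kappa> \<nu> (t / S) / S) =
        (b\<^sup>2 * t / 4 - 4 * \<nu> / S) * radial_fun \<kappa> \<nu> (t / S)" .
  next
    fix t assume "\<bar>t\<bar> \<le> S"
    then show "radial_fun \<kappa> \<nu> (t / S) > 0"
      using assms \<kappa> \<nu> by (intro radial_fun_pos) (auto simp: abs_divide)
  qed (use \<nu> assms in \<open>auto intro!: divide_neg_pos\<close>)
qed

section \<open>Mollification\<close>

text \<open>A squared positive part in place of a smooth bump: it is C^1 with Lipschitz gradient,
  which matches the regularity in \<open>test_fun\<close>, and its estimates have explicit
  constants.\<close>

definition bump :: "real \<Rightarrow> 'a::euclidean_space \<Rightarrow> real" where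
  "bump \<epsilon> x = (max 0 (\<epsilon>\<^sup>2 - (norm x)\<^sup>2))\<^sup>2"

definition bump_grad :: "real \<Rightarrow> 'a::euclidean_space \<Rightarrow> 'a" where
  "bump_grad \<epsilon> x = (- 4 * max 0 (\<epsilon>\<^sup>2 - (norm x)\<^sup>2)) *\<^sub>R x"

definition convolve :: "('a::euclidean_space \<Rightarrow> real) \<Rightarrow> ('a \<Rightarrow> complex) \<Rightarrow> 'a \<Rightarrow> complex" where
  "convolve k f x = (\<integral>y. k (x - y) *\<^sub>R f y \<partial>lborel)"

text \<open>The first-order remainder is at most k^2 for every combination of signs of z and z + k,
  so the kink of the positive part does no harm.\<close>

lemma DERIV_pos_part_square:
  "((\<lambda>z::real. (max 0 z)\<^sup>2) has_real_derivative 2 * max 0 z) (at z)"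
proof -
  have *: "\<bar>(max 0 (z + k))\<^sup>2 - (max 0 z)\<^sup>2 - 2 * max 0 z * k\<bar> \<le> k\<^sup>2" for k :: real
  proof -
    consider "z \<ge> 0" "z + k \<ge> 0" | "z \<ge> 0" "z + k < 0" | "z < 0" "z + k \<ge> 0" | "z < 0" "z + k < 0"
      by linarith
    then show ?thesis
    proof cases
      case 1 then show ?thesis by (simp add: max_def power2_eq_square algebra_simps)
    next
      case 2
      have e: "- z\<^sup>2 - 2 * z * k = k\<^sup>2 - (z + k)\<^sup>2" by (simp add: power2_eq_square algebra_simps)
      have "(z + k)\<^sup>2 \<le> k\<^sup>2" using 2 by (intro abs_le_square_iff[THEN iffD1]) auto
      with 2 show ?thesis using e by (auto simp: max_def)
    next
      case 3
      have "(z + k)\<^sup>2 \<le> k\<^sup>2" using 3 by (intro power_mono) auto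
      with 3 show ?thesis by (auto simp: max_def)
    qed (auto simp: max_def)
  qed
  have "((\<lambda>k. ((max 0 (z + k))\<^sup>2 - (max 0 z)\<^sup>2) / k) \<longlongrightarrow> 2 * max 0 z) (at 0)"
  proof (rule LIM_zero_cancel, rule tendsto_rabs_zero_cancel,
      rule tendsto_sandwich[where f="\<lambda>_. 0" and h="\<lambda>k. \<bar>k\<bar>"])
    show "\<forall>\<^sub>F k in at 0. \<bar>((max 0 (z + k))\<^sup>2 - (max 0 z)\<^sup>2) / k - 2 * max 0 z\<bar> \<le> \<bar>k\<bar>"
      unfolding eventually_at
    proof (intro exI[of _ 1] conjI ballI impI)
      fix k :: real assume "k \<noteq> 0 \<and> dist k 0 < 1"
      then have k: "k \<noteq> 0" by simp
      have "\<bar>((max 0 (z + k))\<^sup>2 - (max 0 z)\<^sup>2) / k - 2 * max 0 z\<bar>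
          = \<bar>(max 0 (z + k))\<^sup>2 - (max 0 z)\<^sup>2 - 2 * max 0 z * k\<bar> / \<bar>k\<bar>"
        using k unfolding abs_divide[symmetric] by (simp add: field_simps)
      also have "\<dots> \<le> k\<^sup>2 / \<bar>k\<bar>" by (intro divide_right_mono *) auto
      also have "\<dots> = \<bar>k\<bar>" using k by (simp add: power2_eq_square field_simps abs_if)
      finally show "\<bar>((max 0 (z + k))\<^sup>2 - (max 0 z)\<^sup>2) / k - 2 * max 0 z\<bar> \<le> \<bar>k\<bar>" .
    qed auto
    show "((\<lambda>k. \<bar>k\<bar>) \<longlongrightarrow> 0) (at (0::real))"
      using tendsto_rabs[OF tendsto_ident_at[of "0::real" UNIV]] by simp
  qed (auto intro!: always_eventually)
  then show ?thesis by (simp add: DERIV_def)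
qed

lemma bump_nonneg [simp]: "0 \<le> bump \<epsilon> x" by (simp add: bump_def)

lemma bump_eq_0: "0 \<le> \<epsilon> \<Longrightarrow> \<epsilon> \<le> norm x \<Longrightarrow> bump \<epsilon> x = 0"
  unfolding bump_def by (simp add: max_def power_mono)

lemma bump_grad_eq_0: "0 \<le> \<epsilon> \<Longrightarrow> \<epsilon> \<le> norm x \<Longrightarrow> bump_grad \<epsilon> x = 0"
  unfolding bump_grad_def by (simp add: max_def power_mono)

lemma bump_pos: "norm x < \<epsilon> \<Longrightarrow> 0 < bump \<epsilon> x"
  using power_strict_mono[of "norm x" \<epsilon> 2] unfolding bump_def by simp

lemma continuous_on_bump [continuous_intros]:
  "continuous_on A f \<Longrightarrow> continuous_on A (\<lambda>x. bump \<epsilon> (f x))"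
  unfolding bump_def by (intro continuous_intros)

lemma continuous_on_bump_grad [continuous_intros]:
  "continuous_on A f \<Longrightarrow> continuous_on A (\<lambda>x. bump_grad \<epsilon> (f x))"
  unfolding bump_grad_def by (intro continuous_intros)

lemma borel_measurable_bump [measurable]: "bump \<epsilon> \<in> borel_measurable borel"
  by (intro borel_measurable_continuous_onI continuous_intros)

lemma borel_measurable_bump_grad [measurable]: "bump_grad \<epsilon> \<in> borel_measurable borel"
  by (intro borel_measurable_continuous_onI continuous_intros)

lemma has_derivative_bump: "(bump \<epsilon> has_derivative (\<lambda>h. bump_grad \<epsilon> x \<bullet> h)) (at x)"
proof -
  have 1: "((\<lambda>x. \<epsilon>\<^sup>2 - x \<bullet> x) has_derivative (\<lambda>h. - 2 * (x \<bullet> h))) (at x)"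
    by (auto intro!: derivative_eq_intros simp: inner_commute)
  have "((\<lambda>z::real. (max 0 z)\<^sup>2) has_derivative (*) (2 * max 0 (\<epsilon>\<^sup>2 - x \<bullet> x))) (at (\<epsilon>\<^sup>2 - x \<bullet> x))"
    using DERIV_pos_part_square by (rule has_field_derivative_imp_has_derivative)
  from has_derivative_compose[OF 1 this]
  show ?thesis
    unfolding bump_def bump_grad_def power2_norm_eq_inner by (simp add: algebra_simps)
qed

lemma bump_le: "0 \<le> \<epsilon> \<Longrightarrow> bump \<epsilon> x \<le> \<epsilon> ^ 4"
proof -
  have "bump \<epsilon> x \<le> (\<epsilon>\<^sup>2)\<^sup>2" unfolding bump_def by (intro power_mono) auto
  then show ?thesis by simp
qed

lemma norm_bump_grad_le: "0 \<le> \<epsilon> \<Longrightarrow> norm (bump_grad \<epsilon> x) \<le> 4 * \<epsilon> ^ 3"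
proof (cases "norm x < \<epsilon>")
  case True
  have "norm (bump_grad \<epsilon> x) \<le> (4 * \<epsilon>\<^sup>2) * \<epsilon>"
    unfolding bump_grad_def norm_scaleR using True
    by (intro mult_mono) (auto simp: abs_mult)
  then show ?thesis by (simp add: power2_eq_square power3_eq_cube)
qed (auto simp: bump_grad_eq_0)

text \<open>With p the positive part, p(x) x - p(z) z = (p(x) - p(z)) x + p(z) (x - z). The first
  summand contributes 2 and the second 1 to the factor of \<open>\<epsilon>\<^sup>2\<close>; the
  prefactor 4 of the gradient makes it 12.\<close>

lemma bump_grad_lipschitz:
  assumes "0 \<le> \<epsilon>"
  shows "norm (bump_grad \<epsilon> x - bump_grad \<epsilon> z) \<le> 12 * \<epsilon>\<^sup>2 * norm (x - z)"
proof -
  define p where "p = (\<lambda>x::'a. max 0 (\<epsilon>\<^sup>2 - (norm x)\<^sup>2))"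
  have p: "0 \<le> p x" "p x \<le> \<epsilon>\<^sup>2" for x by (auto simp: p_def)
  \<comment> \<open>Both sides are symmetric in x and z. Ordering them by norm leaves a single mixed
    case, x inside the support and z outside.\<close>
  have main: "norm (p x *\<^sub>R x - p z *\<^sub>R z) \<le> 3 * \<epsilon>\<^sup>2 * norm (x - z)" if "norm x \<le> norm z" for x z :: 'a
  proof (cases "norm x < \<epsilon>")
    case False
    then have "p x = 0" "p z = 0" using that assms by (auto simp: p_def max_def power_mono)
    then show ?thesis by simp
  next
    case True
    have "norm (p x *\<^sub>R x - p z *\<^sub>R z) = norm ((p x - p z) *\<^sub>R x + p z *\<^sub>R (x - z))"
      by (simp add: algebra_simps)
    also have "\<dots> \<le> \<bar>p x - p z\<bar> * norm x + p z * norm (x - z)"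
      using p by (intro norm_triangle_le) simp
    also have "\<bar>p x - p z\<bar> * norm x \<le> 2 * \<epsilon>\<^sup>2 * norm (x - z)"
    proof -
      have d: "norm z - norm x \<le> norm (x - z)" by (metis norm_minus_commute norm_triangle_ineq2)
      have "\<bar>p x - p z\<bar> \<le> 2 * \<epsilon> * (norm z - norm x)"
      proof (cases "norm z \<le> \<epsilon>")
        case zl: True
        then have "p x - p z = (norm z + norm x) * (norm z - norm x)"
          using power_mono[of "norm x" \<epsilon> 2] power_mono[of "norm z" \<epsilon> 2] True
          by (simp add: p_def power2_eq_square algebra_simps)
        moreover have "(norm z + norm x) * (norm z - norm x) \<le> (2 * \<epsilon>) * (norm z - norm x)"
          using that True zl by (intro mult_right_mono) auto
        moreover have "0 \<le> (norm z + norm x) * (norm z - norm x)" using that by simp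
        ultimately show ?thesis by simp
      next
        case zg: False
        then have "p z = 0" using assms by (simp add: p_def max_def power_mono)
        moreover have "p x = (\<epsilon> + norm x) * (\<epsilon> - norm x)"
          using power_mono[of "norm x" \<epsilon> 2] True by (simp add: p_def power2_eq_square algebra_simps)
        moreover have "(\<epsilon> + norm x) * (\<epsilon> - norm x) \<le> (2 * \<epsilon>) * (norm z - norm x)"
          using True zg assms by (intro mult_mono) auto
        ultimately show ?thesis using p[of x] by simp
      qed
      also have "\<dots> \<le> 2 * \<epsilon> * norm (x - z)" using d assms by (intro mult_left_mono) auto
      finally have "\<bar>p x - p z\<bar> * norm x \<le> (2 * \<epsilon> * norm (x - z)) * \<epsilon>"
        using True assms by (intro mult_mono) auto
      then show ?thesis by (simp add: power2_eq_square algebra_simps)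
    qed
    also have "p z * norm (x - z) \<le> \<epsilon>\<^sup>2 * norm (x - z)" using p by (intro mult_right_mono) auto
    finally show ?thesis by (simp add: algebra_simps)
  qed
  have *: "norm (p x *\<^sub>R x - p z *\<^sub>R z) \<le> 3 * \<epsilon>\<^sup>2 * norm (x - z)"
    using main[of x z] main[of z x] by (cases "norm x \<le> norm z") (auto simp: norm_minus_commute)
  have "bump_grad \<epsilon> x - bump_grad \<epsilon> z = (-4) *\<^sub>R (p x *\<^sub>R x - p z *\<^sub>R z)"
    unfolding bump_grad_def p_def by (simp add: algebra_simps)
  then show ?thesis using * by (simp add: mult_ac)
qed

text \<open>The mean value theorem along the segment, with the Lipschitz bound for the gradient.
  Since the remainder is uniform in x, it can be integrated against any integrable function, which
  is how convolutions get differentiated.\<close>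

lemma bump_remainder:
  assumes "0 \<le> \<epsilon>"
  shows "\<bar>bump \<epsilon> (x + h) - bump \<epsilon> x - bump_grad \<epsilon> x \<bullet> h\<bar> \<le> 12 * \<epsilon>\<^sup>2 * (norm h)\<^sup>2"
proof -
  have d: "((\<lambda>s. bump \<epsilon> (x + s *\<^sub>R h)) has_real_derivative bump_grad \<epsilon> (x + s *\<^sub>R h) \<bullet> h) (at s)" for s
  proof -
    have "((\<lambda>s. x + s *\<^sub>R h) has_derivative (\<lambda>s. s *\<^sub>R h)) (at s)"
      by (auto intro!: derivative_eq_intros)
    from has_derivative_compose[OF this has_derivative_bump]
    show ?thesis by (simp add: has_field_derivative_def mult_commute_abs)
  qed
  obtain s where s: "0 < s" "s < 1" "bump \<epsilon> (x + h) - bump \<epsilon> x = bump_grad \<epsilon> (x + s *\<^sub>R h) \<bullet> h"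
    using MVT2[of 0 1 "\<lambda>s. bump \<epsilon> (x + s *\<^sub>R h)" "\<lambda>s. bump_grad \<epsilon> (x + s *\<^sub>R h) \<bullet> h"] d by auto
  have "\<bar>bump \<epsilon> (x + h) - bump \<epsilon> x - bump_grad \<epsilon> x \<bullet> h\<bar> = \<bar>(bump_grad \<epsilon> (x + s *\<^sub>R h) - bump_grad \<epsilon> x) \<bullet> h\<bar>"
    using s by (simp add: inner_diff_left)
  also have "\<dots> \<le> norm (bump_grad \<epsilon> (x + s *\<^sub>R h) - bump_grad \<epsilon> x) * norm h"
    by (rule Cauchy_Schwarz_ineq2)
  also have "\<dots> \<le> (12 * \<epsilon>\<^sup>2 * norm ((x + s *\<^sub>R h) - x)) * norm h"
    by (intro mult_right_mono bump_grad_lipschitz assms) auto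
  also have "\<dots> = s * (12 * \<epsilon>\<^sup>2 * (norm h)\<^sup>2)" using s by (simp add: power2_eq_square)
  also have "\<dots> \<le> 1 * (12 * \<epsilon>\<^sup>2 * (norm h)\<^sup>2)" using s by (intro mult_right_mono) auto
  finally show ?thesis by simp
qed

section \<open>Differentiation of convolutions\<close>

lemma integrable_bounded_scaleR:
  fixes k :: "'a::euclidean_space \<Rightarrow> real" and f :: "'a \<Rightarrow> complex"
  assumes f: "integrable lborel f" and k: "k \<in> borel_measurable borel" "\<And>y. \<bar>k y\<bar> \<le> B"
  shows "integrable lborel (\<lambda>y. k y *\<^sub>R f y)"
proof (rule Bochner_Integration.integrable_bound[OF integrable_mult_right[OF integrable_norm[OF f], of B]])
  have [measurable]: "f \<in> borel_measurable borel" using f by simp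
  note [measurable] = k(1)
  show "(\<lambda>y. k y *\<^sub>R f y) \<in> borel_measurable lborel" by measurable
  show "AE y in lborel. norm (k y *\<^sub>R f y) \<le> norm (B * norm (f y))"
    using k(2) by (auto intro!: always_eventually mult_right_mono simp: abs_mult)
      (metis abs_ge_self order_trans)
qed

lemma
  fixes f :: "'a::euclidean_space \<Rightarrow> complex"
  assumes f: "integrable lborel f" and \<epsilon>: "0 \<le> \<epsilon>"
  shows has_derivative_convolve_bump:
      "(convolve (bump \<epsilon>) f has_derivative (\<lambda>h. convolve (\<lambda>z. bump_grad \<epsilon> z \<bullet> h) f x)) (at x)"
    and continuous_on_convolve_bump_grad:
      "continuous_on UNIV (\<lambda>x. convolve (\<lambda>z. bump_grad \<epsilon> z \<bullet> h) f x)"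
proof -
  have [measurable]: "f \<in> borel_measurable borel" using f by simp
  have ib: "integrable lborel (\<lambda>y. bump \<epsilon> (x - y) *\<^sub>R f y)" for x
    using bump_le[OF \<epsilon>] by (intro integrable_bounded_scaleR[OF f, where B="\<epsilon>^4"]) auto
  have gle: "\<bar>bump_grad \<epsilon> z \<bullet> h\<bar> \<le> (4 * \<epsilon>^3) * norm h" for z h :: 'a
    by (rule order_trans[OF Cauchy_Schwarz_ineq2 mult_right_mono[OF norm_bump_grad_le[OF \<epsilon>]]]) simp
  have ig: "integrable lborel (\<lambda>y. (bump_grad \<epsilon> (x - y) \<bullet> h) *\<^sub>R f y)" for x h
    by (intro integrable_bounded_scaleR[OF f, where B="4 * \<epsilon>^3 * norm h"] gle) auto
  define I where "I = (\<integral>y. norm (f y) \<partial>lborel)"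
  have I: "0 \<le> I" by (auto simp: I_def intro!: integral_nonneg_AE)
  have nf: "integrable lborel (\<lambda>y. norm (f y))" using f by simp
  have bl: "bounded_linear (\<lambda>h. convolve (\<lambda>z. bump_grad \<epsilon> z \<bullet> h) f x)"
  proof (rule bounded_linear_intro[where K="4 * \<epsilon>^3 * I"])
    fix h k show "convolve (\<lambda>z. bump_grad \<epsilon> z \<bullet> (h + k)) f x =
        convolve (\<lambda>z. bump_grad \<epsilon> z \<bullet> h) f x + convolve (\<lambda>z. bump_grad \<epsilon> z \<bullet> k) f x"
      unfolding convolve_def inner_add_right scaleR_left_distrib
      by (intro Bochner_Integration.integral_add ig)
  next
    fix r h show "convolve (\<lambda>z. bump_grad \<epsilon> z \<bullet> (r *\<^sub>R h)) f x = r *\<^sub>R convolve (\<lambda>z. bump_grad \<epsilon> z \<bullet> h) f x"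
      unfolding convolve_def inner_scaleR_right scaleR_scaleR[symmetric]
      by (rule integral_scaleR_right)
  next
    fix h
    have "norm (convolve (\<lambda>z. bump_grad \<epsilon> z \<bullet> h) f x) \<le> (\<integral>y. (4 * \<epsilon>^3 * norm h) * norm (f y) \<partial>lborel)"
      unfolding convolve_def
      by (rule Bochner_Integration.integral_norm_bound_integral[OF ig]) (auto intro!: mult_right_mono gle integrable_mult_right nf)
    also have "\<dots> = norm h * (4 * \<epsilon>^3 * I)" by (simp add: I_def)
    finally show "norm (convolve (\<lambda>z. bump_grad \<epsilon> z \<bullet> h) f x) \<le> norm h * (4 * \<epsilon>^3 * I)" .
  qed
  have rem: "norm (convolve (bump \<epsilon>) f (x + h) - convolve (bump \<epsilon>) f x - convolve (\<lambda>z. bump_grad \<epsilon> z \<bullet> h) f x)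
      \<le> (12 * \<epsilon>\<^sup>2 * I) * (norm h)\<^sup>2" for h
  proof -
    have "convolve (bump \<epsilon>) f (x + h) - convolve (bump \<epsilon>) f x - convolve (\<lambda>z. bump_grad \<epsilon> z \<bullet> h) f x
      = (\<integral>y. bump \<epsilon> (x + h - y) *\<^sub>R f y - bump \<epsilon> (x - y) *\<^sub>R f y - (bump_grad \<epsilon> (x - y) \<bullet> h) *\<^sub>R f y \<partial>lborel)"
      unfolding convolve_def using ib ig by (simp add: Bochner_Integration.integral_diff)
    also have "norm \<dots> \<le> (\<integral>y. (12 * \<epsilon>\<^sup>2 * (norm h)\<^sup>2) * norm (f y) \<partial>lborel)"
    proof (rule Bochner_Integration.integral_norm_bound_integral)
      fix y
      have e: "bump \<epsilon> (x + h - y) *\<^sub>R f y - bump \<epsilon> (x - y) *\<^sub>R f y - (bump_grad \<epsilon> (x - y) \<bullet> h) *\<^sub>R f y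
         = (bump \<epsilon> ((x - y) + h) - bump \<epsilon> (x - y) - bump_grad \<epsilon> (x - y) \<bullet> h) *\<^sub>R f y"
        by (simp add: algebra_simps)
      show "norm (bump \<epsilon> (x + h - y) *\<^sub>R f y - bump \<epsilon> (x - y) *\<^sub>R f y - (bump_grad \<epsilon> (x - y) \<bullet> h) *\<^sub>R f y)
          \<le> (12 * \<epsilon>\<^sup>2 * (norm h)\<^sup>2) * norm (f y)"
        unfolding e norm_scaleR by (intro mult_right_mono bump_remainder \<epsilon>) auto
    qed (use ib ig nf in \<open>auto intro!: Bochner_Integration.integrable_diff integrable_mult_right\<close>)
    also have "\<dots> = (12 * \<epsilon>\<^sup>2 * I) * (norm h)\<^sup>2" by (simp add: I_def)
    finally show ?thesis .
  qed
  show "(convolve (bump \<epsilon>) f has_derivative (\<lambda>h. convolve (\<lambda>z. bump_grad \<epsilon> z \<bullet> h) f x)) (at x)"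
    unfolding has_derivative_at
  proof (intro conjI bl)
    show "(\<lambda>h. norm (convolve (bump \<epsilon>) f (x + h) - convolve (bump \<epsilon>) f x - convolve (\<lambda>z. bump_grad \<epsilon> z \<bullet> h) f x) / norm h) \<midarrow>0\<rightarrow> 0"
    proof (rule tendsto_sandwich[where f="\<lambda>_. 0" and h="\<lambda>h. (12 * \<epsilon>\<^sup>2 * I) * norm h"])
      show "\<forall>\<^sub>F h in at 0. norm (convolve (bump \<epsilon>) f (x + h) - convolve (bump \<epsilon>) f x - convolve (\<lambda>z. bump_grad \<epsilon> z \<bullet> h) f x) / norm h
          \<le> 12 * \<epsilon>\<^sup>2 * I * norm h"
      proof (rule always_eventually, rule allI)
        fix h :: 'a
        show "norm (convolve (bump \<epsilon>) f (x + h) - convolve (bump \<epsilon>) f x - convolve (\<lambda>z. bump_grad \<epsilon> z \<bullet> h) f x) / norm h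
          \<le> 12 * \<epsilon>\<^sup>2 * I * norm h"
        proof (cases "h = 0")
          case False
          then show ?thesis using rem[of h] by (simp add: divide_le_eq power2_eq_square mult_ac)
        qed auto
      qed
      show "((\<lambda>h. (12 * \<epsilon>\<^sup>2 * I) * norm h) \<longlongrightarrow> 0) (at (0::'a))"
        by (auto intro!: tendsto_eq_intros)
    qed (auto intro!: always_eventually)
  qed
  show "continuous_on UNIV (\<lambda>x. convolve (\<lambda>z. bump_grad \<epsilon> z \<bullet> h) f x)"
    unfolding continuous_on_sequentially
  proof (intro allI impI ballI)
    fix X :: "nat \<Rightarrow> 'a" and a assume "(\<forall>n. X n \<in> UNIV) \<and> X \<longlonglongrightarrow> a"
    then have X: "X \<longlonglongrightarrow> a" by simp
    show "((\<lambda>x. convolve (\<lambda>z. bump_grad \<epsilon> z \<bullet> h) f x) \<circ> X) \<longlonglongrightarrow> convolve (\<lambda>z. bump_grad \<epsilon> z \<bullet> h) f a"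
      unfolding comp_def convolve_def
    proof (rule integral_dominated_convergence[where w="\<lambda>y. (4 * \<epsilon>^3 * norm h) * norm (f y)"])
      show "AE y in lborel. (\<lambda>i. (bump_grad \<epsilon> (X i - y) \<bullet> h) *\<^sub>R f y) \<longlonglongrightarrow> (bump_grad \<epsilon> (a - y) \<bullet> h) *\<^sub>R f y"
      proof (rule always_eventually, rule allI)
        fix y
        have "isCont (\<lambda>x. (bump_grad \<epsilon> (x - y) \<bullet> h) *\<^sub>R f y) a"
          by (rule continuous_on_interior[of UNIV]) (auto intro!: continuous_on_scaleR continuous_on_inner
              continuous_on_bump_grad continuous_on_diff)
        from isCont_tendsto_compose[OF this X]
        show "(\<lambda>i. (bump_grad \<epsilon> (X i - y) \<bullet> h) *\<^sub>R f y) \<longlonglongrightarrow> (bump_grad \<epsilon> (a - y) \<bullet> h) *\<^sub>R f y" .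
      qed
      show "AE y in lborel. norm ((bump_grad \<epsilon> (X i - y) \<bullet> h) *\<^sub>R f y) \<le> (4 * \<epsilon>^3 * norm h) * norm (f y)" for i
        by (auto intro!: always_eventually mult_right_mono gle)
    qed (auto intro!: integrable_mult_right nf)
  qed
qed

section \<open>Normalized mollifiers and their convergence in L^2\<close>

definition moll :: "real \<Rightarrow> 'a::euclidean_space \<Rightarrow> real" where
  "moll \<epsilon> x = bump \<epsilon> x / (\<integral>x. bump \<epsilon> (x::'a) \<partial>lborel)"

lemma integrable_bump: 
  assumes "0 \<le> \<epsilon>" shows "integrable lborel (bump \<epsilon> :: 'a::euclidean_space \<Rightarrow> real)"
proof (rule Bochner_Integration.integrable_bound)
  show "integrable lborel (\<lambda>x::'a. \<epsilon>^4 * indicator (cball 0 \<epsilon>) x)"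
    by (intro integrable_mult_right integrable_real_indicator) (auto intro!: emeasure_bounded_finite simp flip: infinity_ennreal_def)
  show "AE x in lborel. norm (bump \<epsilon> x) \<le> norm (\<epsilon>^4 * indicator (cball (0::'a) \<epsilon>) x)"
    using bump_le[where 'a='a, OF assms] bump_eq_0[where 'a='a, OF assms]
    by (intro always_eventually allI) (auto simp: indicator_def not_le)
qed simp

lemma integral_bump_pos:
  assumes "0 < \<epsilon>" shows "0 < (\<integral>x. bump \<epsilon> (x::'a::euclidean_space) \<partial>lborel)"
proof -
  have "(\<integral>x. bump \<epsilon> (x::'a) \<partial>lborel) \<noteq> 0"
  proof
    assume "(\<integral>x. bump \<epsilon> (x::'a) \<partial>lborel) = 0"
    then have "AE x in lborel. bump \<epsilon> (x::'a) = 0"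
      by (subst (asm) integral_nonneg_eq_0_iff_AE) (use assms in \<open>auto intro!: integrable_bump\<close>)
    then have "AE x in lborel. x \<notin> ball (0::'a) \<epsilon>"
    proof eventually_elim
      case (elim x) then show ?case using bump_pos[of x \<epsilon>] by auto
    qed
    then have "emeasure lborel (ball (0::'a) \<epsilon>) = 0"
      by (subst (asm) AE_iff_measurable[OF _ refl]) (auto simp: ball_def dist_norm)
    moreover have "ball (0::'a) \<epsilon> \<notin> null_sets lborel"
      using open_not_negligible[of "ball (0::'a) \<epsilon>"] assms
      by (auto simp: negligible_iff_null_sets dest: null_sets_completionI)
    ultimately show False by (auto simp: null_sets_def)
  qed
  moreover have "0 \<le> (\<integral>x. bump \<epsilon> (x::'a) \<partial>lborel)" by (intro integral_nonneg_AE) auto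
  ultimately show ?thesis by (rule order_le_neq_trans[OF _ not_sym, rotated])
qed

lemma moll_nonneg [simp]: "0 \<le> moll \<epsilon> x"
  unfolding moll_def by (intro divide_nonneg_nonneg integral_nonneg_AE) auto

lemma borel_measurable_moll [measurable]: "moll \<epsilon> \<in> borel_measurable borel"
  unfolding moll_def by measurable

lemma moll_eq_0: "0 \<le> \<epsilon> \<Longrightarrow> \<epsilon> \<le> norm x \<Longrightarrow> moll \<epsilon> x = 0"
  unfolding moll_def by (simp add: bump_eq_0)

lemma integrable_moll: "0 \<le> \<epsilon> \<Longrightarrow> integrable lborel (moll \<epsilon>)"
  unfolding moll_def[abs_def] by (intro integrable_divide_zero integrable_bump)

lemma integral_moll: "0 < \<epsilon> \<Longrightarrow> (\<integral>x. moll \<epsilon> (x::'a::euclidean_space) \<partial>lborel) = 1"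
  unfolding moll_def using integral_bump_pos[where 'a='a, of \<epsilon>] by simp

lemma nn_integral_moll: "0 < \<epsilon> \<Longrightarrow> (\<integral>\<^sup>+x. moll \<epsilon> (x::'a::euclidean_space) \<partial>lborel) = 1"
  using integral_moll[where 'a='a, of \<epsilon>] integrable_moll[where 'a='a, of \<epsilon>]
  by (subst nn_integral_eq_integral) auto

lemma nn_integral_lborel_reflect:
  fixes f :: "'a::euclidean_space \<Rightarrow> ennreal"
  assumes [measurable]: "f \<in> borel_measurable borel"
  shows "(\<integral>\<^sup>+y. f (x - y) \<partial>lborel) = (\<integral>\<^sup>+y. f y \<partial>lborel)"
proof -
  have "lborel = distr lborel borel (\<lambda>y::'a. x - y)"
    using lborel_affine[of "-1" x] by (simp add: density_1)
  then have "(\<integral>\<^sup>+y. f y \<partial>lborel) = (\<integral>\<^sup>+y. f y \<partial>distr lborel borel (\<lambda>y. x - y))"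
    by simp
  also have "\<dots> = (\<integral>\<^sup>+y. f (x - y) \<partial>lborel)"
    by (subst nn_integral_distr) auto
  finally show ?thesis by simp
qed

lemma nn_integral_lborel_translate:
  fixes f :: "'a::euclidean_space \<Rightarrow> ennreal"
  assumes [measurable]: "f \<in> borel_measurable borel"
  shows "(\<integral>\<^sup>+y. f (y - x) \<partial>lborel) = (\<integral>\<^sup>+y. f y \<partial>lborel)"
proof -
  have "lborel = distr lborel borel (\<lambda>y::'a. (-x) + y)"
    using lborel_affine[of 1 "-x"] by (simp add: density_1)
  then have "(\<integral>\<^sup>+y. f y \<partial>lborel) = (\<integral>\<^sup>+y. f y \<partial>distr lborel borel (\<lambda>y. -x + y))"
    by simp
  also have "\<dots> = (\<integral>\<^sup>+y. f (y - x) \<partial>lborel)"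
    by (subst nn_integral_distr) auto
  finally show ?thesis by simp
qed

lemma integrable_moll_scaleR:
  fixes f :: "'a::euclidean_space \<Rightarrow> complex"
  assumes f: "integrable lborel f" and \<epsilon>: "0 \<le> \<epsilon>"
  shows "integrable lborel (\<lambda>y. moll \<epsilon> (x - y) *\<^sub>R f y)"
proof (rule integrable_bounded_scaleR[OF f, where B="\<epsilon>^4 / (\<integral>x. bump \<epsilon> (x::'a) \<partial>lborel)"])
  fix y show "\<bar>moll \<epsilon> (x - y)\<bar> \<le> \<epsilon>^4 / (\<integral>x. bump \<epsilon> (x::'a) \<partial>lborel)"
    unfolding abs_of_nonneg[OF moll_nonneg] unfolding moll_def
    by (intro divide_right_mono bump_le \<epsilon> integral_nonneg_AE) auto
qed simp

lemma convolve_moll_borel_measurable [measurable]: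
  fixes f :: "'a::euclidean_space \<Rightarrow> complex"
  assumes [measurable]: "f \<in> borel_measurable borel"
  shows "convolve (moll \<epsilon>) f \<in> borel_measurable borel"
proof -
  have "(\<lambda>x. \<integral>y. moll \<epsilon> (x - y) *\<^sub>R f y \<partial>lborel) \<in> borel_measurable borel"
    by measurable
  then show ?thesis unfolding convolve_def[abs_def] .
qed

text \<open>Convolution with a probability density contracts L^2. Cauchy-Schwarz with the kernel
  split into two square roots gives the pointwise (Jensen) bound; Tonelli then integrates the kernel
  to 1 in the other variable.\<close>

lemma convolve_moll_L2_le:
  fixes f :: "'a::euclidean_space \<Rightarrow> complex"
  assumes f: "integrable lborel f" and \<epsilon>: "0 < \<epsilon>"
  shows "(\<integral>\<^sup>+x. ennreal ((norm (convolve (moll \<epsilon>) f x))\<^sup>2) \<partial>lborel) \<le> (\<integral>\<^sup>+x. ennreal ((norm (f x))\<^sup>2) \<partial>lborel)"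
proof -
  have [measurable]: "f \<in> borel_measurable borel" using f by simp
  have pt: "ennreal ((norm (convolve (moll \<epsilon>) f x))\<^sup>2) \<le> (\<integral>\<^sup>+y. ennreal (moll \<epsilon> (x - y) * (norm (f y))\<^sup>2) \<partial>lborel)" for x
  proof -
    have "ennreal (norm (convolve (moll \<epsilon>) f x)) \<le> (\<integral>\<^sup>+y. ennreal (norm (moll \<epsilon> (x - y) *\<^sub>R f y)) \<partial>lborel)"
      unfolding convolve_def using integrable_moll_scaleR[OF f] \<epsilon>
      by (intro integral_norm_bound_ennreal) auto
    also have "\<dots> = (\<integral>\<^sup>+y. ennreal (sqrt (moll \<epsilon> (x - y))) * ennreal (sqrt (moll \<epsilon> (x - y)) * norm (f y)) \<partial>lborel)"
      by (intro nn_integral_cong) (simp add: ennreal_mult[symmetric] mult.assoc[symmetric])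
    finally have "(ennreal (norm (convolve (moll \<epsilon>) f x)))\<^sup>2 \<le>
       (\<integral>\<^sup>+y. ennreal (sqrt (moll \<epsilon> (x - y))) * ennreal (sqrt (moll \<epsilon> (x - y)) * norm (f y)) \<partial>lborel)\<^sup>2"
      by (intro power_mono) auto
    also have "\<dots> \<le> (\<integral>\<^sup>+y. (ennreal (sqrt (moll \<epsilon> (x - y))))\<^sup>2 \<partial>lborel) *
        (\<integral>\<^sup>+y. (ennreal (sqrt (moll \<epsilon> (x - y)) * norm (f y)))\<^sup>2 \<partial>lborel)"
      by (rule Cauchy_Schwarz_nn_integral) auto
    also have "(\<integral>\<^sup>+y. (ennreal (sqrt (moll \<epsilon> (x - y))))\<^sup>2 \<partial>lborel) = (\<integral>\<^sup>+y. ennreal (moll \<epsilon> (x - y)) \<partial>lborel)"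
      by (intro nn_integral_cong) (simp add: ennreal_power)
    also have "\<dots> = 1"
      using nn_integral_lborel_reflect[of "\<lambda>y. ennreal (moll \<epsilon> y)" x] nn_integral_moll[OF \<epsilon>] by simp
    also have "(\<integral>\<^sup>+y. (ennreal (sqrt (moll \<epsilon> (x - y)) * norm (f y)))\<^sup>2 \<partial>lborel)
        = (\<integral>\<^sup>+y. ennreal (moll \<epsilon> (x - y) * (norm (f y))\<^sup>2) \<partial>lborel)"
      by (intro nn_integral_cong) (simp add: ennreal_power power_mult_distrib)
    finally show ?thesis by (simp add: ennreal_power)
  qed
  have "(\<integral>\<^sup>+x. ennreal ((norm (convolve (moll \<epsilon>) f x))\<^sup>2) \<partial>lborel)
      \<le> (\<integral>\<^sup>+x. (\<integral>\<^sup>+y. ennreal (moll \<epsilon> (x - y) * (norm (f y))\<^sup>2) \<partial>lborel) \<partial>lborel)"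
    by (intro nn_integral_mono pt)
  also have "\<dots> = (\<integral>\<^sup>+y. (\<integral>\<^sup>+x. ennreal (moll \<epsilon> (x - y) * (norm (f y))\<^sup>2) \<partial>lborel) \<partial>lborel)"
    by (rule lborel_pair.Fubini') measurable
  also have "\<dots> = (\<integral>\<^sup>+y. ennreal ((norm (f y))\<^sup>2) \<partial>lborel)"
  proof (intro nn_integral_cong)
    fix y
    have "(\<integral>\<^sup>+x. ennreal (moll \<epsilon> (x - y) * (norm (f y))\<^sup>2) \<partial>lborel)
       = (\<integral>\<^sup>+x. ennreal (moll \<epsilon> (x - y)) \<partial>lborel) * ennreal ((norm (f y))\<^sup>2)"
      by (subst nn_integral_multc[symmetric]) (auto simp: ennreal_mult)
    also have "(\<integral>\<^sup>+x. ennreal (moll \<epsilon> (x - y)) \<partial>lborel) = 1"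
      using nn_integral_lborel_translate[of "\<lambda>y. ennreal (moll \<epsilon> y)" y] nn_integral_moll[OF \<epsilon>] by simp
    finally show "(\<integral>\<^sup>+x. ennreal (moll \<epsilon> (x - y) * (norm (f y))\<^sup>2) \<partial>lborel) = ennreal ((norm (f y))\<^sup>2)" by simp
  qed
  finally show ?thesis .
qed

lemma integrable_of_L2_bounded_support:
  fixes f :: "'a::euclidean_space \<Rightarrow> complex"
  assumes f [measurable]: "f \<in> borel_measurable borel" and sq: "integrable lborel (\<lambda>x. (norm (f x))\<^sup>2)"
    and supp: "\<And>x. M \<le> norm x \<Longrightarrow> f x = 0"
  shows "integrable lborel f"
proof (rule Bochner_Integration.integrable_bound)
  show "integrable lborel (\<lambda>x::'a. indicator (cball 0 M) x + (norm (f x))\<^sup>2)"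
    by (intro Bochner_Integration.integrable_add integrable_real_indicator sq) (auto intro!: emeasure_bounded_finite simp flip: infinity_ennreal_def)
  show "AE x in lborel. norm (f x) \<le> norm (indicator (cball (0::'a) M) x + (norm (f x))\<^sup>2)"
  proof (intro always_eventually allI)
    fix x :: 'a
    have "norm (f x) \<le> 1 + (norm (f x))\<^sup>2"
      using sum_squares_bound[of "norm (f x)" 1] by (simp add: power2_eq_square) (smt (verit) norm_ge_zero zero_le_square)
    then show "norm (f x) \<le> norm (indicator (cball (0::'a) M) x + (norm (f x))\<^sup>2)"
      using supp[of x] by (auto simp: indicator_def not_le)
  qed
qed simp

text \<open>A measurable function is almost everywhere a limit of continuous ones, but without any
  domination. Truncating the values at a height \<open>L\<close> and multiplying by a cutoff in x
  keeps continuity and makes dominated convergence available on a bounded ball.\<close>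

lemma continuous_L2_dense:
  fixes f :: "'a::euclidean_space \<Rightarrow> complex"
  assumes f [measurable]: "f \<in> borel_measurable borel" and sq: "integrable lborel (\<lambda>x. (norm (f x))\<^sup>2)"
    and supp: "\<And>x. M \<le> norm x \<Longrightarrow> f x = 0" and e: "0 < (e::real)"
  obtains g where "continuous_on UNIV g" "\<And>x. M + 1 \<le> norm x \<Longrightarrow> g x = 0"
    "(\<integral>\<^sup>+x. ennreal ((norm (f x - g x))\<^sup>2) \<partial>lborel) \<le> ennreal e"
proof -
  have "f measurable_on UNIV"
    using f by (subst measurable_on_iff_borel_measurable)
      (auto intro!: measurable_restrict_space1 measurable_completion)
  then obtain N g where N: "negligible N" and g: "\<And>n. continuous_on UNIV (g n)"
    and lim: "\<And>x. x \<notin> N \<Longrightarrow> (\<lambda>n. g n x) \<longlonglongrightarrow> f x"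
    unfolding measurable_on_def by auto
  have AE: "AE x in lborel. x \<notin> N"
  proof -
    obtain N' where "N \<subseteq> N'" "N' \<in> null_sets lborel"
      using N negligible_iff_null_sets null_sets_completion_iff2 by metis
    then show ?thesis using AE_not_in by (metis (mono_tags, lifting) eventually_mono subsetD)
  qed
  \<comment> \<open>Radial retraction of the complex plane onto the disk of radius K: the identity
    inside, rescaling to modulus K outside, continuous throughout.\<close>
  define T where "T = (\<lambda>K z. inverse (max 1 (norm z / K)) *\<^sub>R (z::complex))"
  have T_cont: "continuous_on UNIV (T K)" for K
  proof -
    have "max 1 (norm z / K) \<noteq> 0" for z :: complex by (metis max.cobounded1 not_one_le_zero)
    then show ?thesis unfolding T_def divide_inverse by (intro continuous_intros) (auto simp: divide_inverse)
  qed
  have [measurable]: "T K \<in> borel_measurable borel" for K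
    using T_cont by (rule borel_measurable_continuous_onI)
  have T_K: "norm (T K z) \<le> K" if "K > 0" for K z
  proof -
    have "norm (T K z) = norm z / max 1 (norm z / K)" by (simp add: T_def divide_inverse)
    also have "\<dots> \<le> K" using that by (simp add: max_def field_simps)
    finally show ?thesis .
  qed
  have T_diff: "norm (z - T K z) \<le> norm z" if "K > 0" for K z
  proof -
    have "z - T K z = (1 - inverse (max 1 (norm z / K))) *\<^sub>R z" by (simp add: T_def algebra_simps)
    then have "norm (z - T K z) = \<bar>1 - inverse (max 1 (norm z / K))\<bar> * norm z" by simp
    also have "\<dots> \<le> 1 * norm z"
    proof (intro mult_right_mono)
      have "0 \<le> inverse (max 1 (norm z / K))" "inverse (max 1 (norm z / K)) \<le> 1"
        by (auto intro: inverse_le_1_iff[THEN iffD2])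
      then show "\<bar>1 - inverse (max 1 (norm z / K))\<bar> \<le> 1" by linarith
    qed auto
    finally show ?thesis by simp
  qed
  have T_eq: "T K z = z" if "norm z \<le> K" "K > 0" for K z
    using that by (simp add: T_def max_def field_simps)
  have "(\<lambda>K. \<integral>\<^sup>+x. ennreal ((norm (f x - T (real (Suc K)) (f x)))\<^sup>2) \<partial>lborel) \<longlonglongrightarrow> (integral\<^sup>N lborel (\<lambda>x::'a. 0))"
  proof (rule nn_integral_dominated_convergence[where w="\<lambda>x. ennreal ((norm (f x))\<^sup>2)"])
    show "AE x in lborel. (\<lambda>K. ennreal ((norm (f x - T (real (Suc K)) (f x)))\<^sup>2)) \<longlonglongrightarrow> 0"
    proof (intro always_eventually allI)
      fix x
      have "\<forall>\<^sub>F K in sequentially. norm (f x) \<le> real (Suc K)"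
        using real_arch_simple[of "norm (f x)"] eventually_sequentially
        by (smt (verit) le_SucI of_nat_mono)
      then have "\<forall>\<^sub>F K in sequentially. ennreal ((norm (f x - T (real (Suc K)) (f x)))\<^sup>2) = 0"
        by eventually_elim (simp add: T_eq)
      then show "(\<lambda>K. ennreal ((norm (f x - T (real (Suc K)) (f x)))\<^sup>2)) \<longlonglongrightarrow> 0"
        by (rule tendsto_eventually)
    qed
    show "(\<integral>\<^sup>+x. ennreal ((norm (f x))\<^sup>2) \<partial>lborel) < \<infinity>"
      using sq by (simp add: integrable_iff_bounded)
    show "AE x in lborel. ennreal ((norm (f x - T (real (Suc K)) (f x)))\<^sup>2) \<le> ennreal ((norm (f x))\<^sup>2)" for K
      by (intro always_eventually allI ennreal_leI power_mono T_diff) auto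
  qed auto
  \<comment> \<open>The budget is e/4 for the truncation and e/4 for the approximation; (a + b)^2
    \<le> 2 a^2 + 2 b^2 doubles both.\<close>
  then have "\<forall>\<^sub>F K in sequentially. (\<integral>\<^sup>+x. ennreal ((norm (f x - T (real (Suc K)) (f x)))\<^sup>2) \<partial>lborel) < ennreal (e / 4)"
    using e by (intro order_tendstoD) auto
  then obtain K where K: "(\<integral>\<^sup>+x. ennreal ((norm (f x - T (real (Suc K)) (f x)))\<^sup>2) \<partial>lborel) < ennreal (e / 4)"
    by (auto simp: eventually_sequentially)
  define L where "L = real (Suc K)"
  have L: "L > 0" by (simp add: L_def)
  define \<theta> where "\<theta> = (\<lambda>x::'a. max 0 (min 1 (M + 1 - norm x)))"
  have \<theta>_cont: "continuous_on UNIV \<theta>" unfolding \<theta>_def by (intro continuous_intros)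
  have [measurable]: "\<theta> \<in> borel_measurable borel" using \<theta>_cont by (rule borel_measurable_continuous_onI)
  have [measurable]: "g n \<in> borel_measurable borel" for n using g by (rule borel_measurable_continuous_onI)
  have \<theta>_le: "0 \<le> \<theta> x" "\<theta> x \<le> 1" for x by (auto simp: \<theta>_def)
  have Tf: "\<theta> x *\<^sub>R T L (f x) = T L (f x)" for x
    using supp[of x] by (cases "M \<le> norm x") (auto simp: \<theta>_def T_def)
  have "(\<lambda>n. \<integral>\<^sup>+x. ennreal ((norm (T L (f x) - \<theta> x *\<^sub>R T L (g n x)))\<^sup>2) \<partial>lborel) \<longlonglongrightarrow> (integral\<^sup>N lborel (\<lambda>x::'a. 0))"
  proof (rule nn_integral_dominated_convergence[where w="\<lambda>x. ennreal ((2 * L)\<^sup>2) * indicator (cball 0 (M + 1)) x"])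
    show "AE x in lborel. (\<lambda>n. ennreal ((norm (T L (f x) - \<theta> x *\<^sub>R T L (g n x)))\<^sup>2)) \<longlonglongrightarrow> 0"
      using AE
    proof eventually_elim
      case (elim x)
      have "isCont (T L) (f x)" using T_cont by (simp add: continuous_on_eq_continuous_at)
      from isCont_tendsto_compose[OF this lim[OF elim]]
      have "(\<lambda>n. (norm (T L (f x) - \<theta> x *\<^sub>R T L (g n x)))\<^sup>2) \<longlonglongrightarrow> (norm (T L (f x) - \<theta> x *\<^sub>R T L (f x)))\<^sup>2"
        by (intro tendsto_intros)
      then have "(\<lambda>n. (norm (T L (f x) - \<theta> x *\<^sub>R T L (g n x)))\<^sup>2) \<longlonglongrightarrow> 0" by (simp add: Tf)
      then show ?case using tendsto_ennrealI by fastforce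
    qed
    show "AE x in lborel. ennreal ((norm (T L (f x) - \<theta> x *\<^sub>R T L (g n x)))\<^sup>2)
        \<le> ennreal ((2 * L)\<^sup>2) * indicator (cball 0 (M + 1)) x" for n
    proof (intro always_eventually allI)
      fix x :: 'a
      show "ennreal ((norm (T L (f x) - \<theta> x *\<^sub>R T L (g n x)))\<^sup>2)
        \<le> ennreal ((2 * L)\<^sup>2) * indicator (cball 0 (M + 1)) x"
      proof (cases "norm x \<le> M + 1")
        case True
        have "norm (\<theta> x *\<^sub>R T L (g n x)) \<le> 1 * L"
          unfolding norm_scaleR using \<theta>_le[of x] T_K[OF L] by (intro mult_mono) auto
        then have "norm (T L (f x) - \<theta> x *\<^sub>R T L (g n x)) \<le> 2 * L"
          using T_K[OF L, of "f x"] norm_triangle_ineq4[of "T L (f x)" "\<theta> x *\<^sub>R T L (g n x)"] by linarith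
        then have "(norm (T L (f x) - \<theta> x *\<^sub>R T L (g n x)))\<^sup>2 \<le> (2 * L)\<^sup>2" by (intro power_mono) auto
        then show ?thesis using True by (simp add: ennreal_leI)
      next
        case False
        then have "\<theta> x = 0" "f x = 0" using supp[of x] by (auto simp: \<theta>_def)
        then show ?thesis by (simp add: T_def)
      qed
    qed
    show "(\<integral>\<^sup>+x. ennreal ((2 * L)\<^sup>2) * indicator (cball (0::'a) (M + 1)) x \<partial>lborel) < \<infinity>"
      by (subst nn_integral_cmult_indicator) (auto simp: ennreal_mult_less_top intro!: emeasure_bounded_finite[unfolded infinity_ennreal_def])
    show "(\<lambda>x. ennreal ((2 * L)\<^sup>2) * indicator (cball (0::'a) (M + 1)) x) \<in> borel_measurable lborel"
      by (intro borel_measurable_times_ennreal borel_measurable_indicator) auto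
  qed auto
  then have "\<forall>\<^sub>F n in sequentially. (\<integral>\<^sup>+x. ennreal ((norm (T L (f x) - \<theta> x *\<^sub>R T L (g n x)))\<^sup>2) \<partial>lborel) < ennreal (e / 4)"
    using e by (intro order_tendstoD) auto
  then obtain n where n: "(\<integral>\<^sup>+x. ennreal ((norm (T L (f x) - \<theta> x *\<^sub>R T L (g n x)))\<^sup>2) \<partial>lborel) < ennreal (e / 4)"
    by (auto simp: eventually_sequentially)
  show thesis
  proof (rule that[of "\<lambda>x. \<theta> x *\<^sub>R T L (g n x)"])
    show "continuous_on UNIV (\<lambda>x. \<theta> x *\<^sub>R T L (g n x))"
      by (intro continuous_on_scaleR \<theta>_cont continuous_on_compose2[OF T_cont g]) auto
    show "\<theta> x *\<^sub>R T L (g n x) = 0" if "M + 1 \<le> norm x" for x using that by (simp add: \<theta>_def)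
  next
    have "(\<integral>\<^sup>+x. ennreal ((norm (f x - \<theta> x *\<^sub>R T L (g n x)))\<^sup>2) \<partial>lborel) \<le>
      (\<integral>\<^sup>+x. 2 * ennreal ((norm (f x - T L (f x)))\<^sup>2) + 2 * ennreal ((norm (T L (f x) - \<theta> x *\<^sub>R T L (g n x)))\<^sup>2) \<partial>lborel)"
    proof (intro nn_integral_mono)
      fix x
      have "(norm (f x - \<theta> x *\<^sub>R T L (g n x)))\<^sup>2 \<le> (norm (f x - T L (f x)) + norm (T L (f x) - \<theta> x *\<^sub>R T L (g n x)))\<^sup>2"
        using norm_triangle_ineq[of "f x - T L (f x)" "T L (f x) - \<theta> x *\<^sub>R T L (g n x)"]
        by (intro power_mono) auto
      also have "\<dots> \<le> 2 * (norm (f x - T L (f x)))\<^sup>2 + 2 * (norm (T L (f x) - \<theta> x *\<^sub>R T L (g n x)))\<^sup>2"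
        using sum_squares_bound[of "norm (f x - T L (f x))" "norm (T L (f x) - \<theta> x *\<^sub>R T L (g n x))"]
        by (simp add: power2_sum)
      finally show "ennreal ((norm (f x - \<theta> x *\<^sub>R T L (g n x)))\<^sup>2) \<le>
          2 * ennreal ((norm (f x - T L (f x)))\<^sup>2) + 2 * ennreal ((norm (T L (f x) - \<theta> x *\<^sub>R T L (g n x)))\<^sup>2)"
        by (simp add: ennreal_leI flip: ennreal_plus ennreal_numeral ennreal_mult)
    qed
    also have "\<dots> = 2 * (\<integral>\<^sup>+x. ennreal ((norm (f x - T L (f x)))\<^sup>2) \<partial>lborel) +
       2 * (\<integral>\<^sup>+x. ennreal ((norm (T L (f x) - \<theta> x *\<^sub>R T L (g n x)))\<^sup>2) \<partial>lborel)"
      by (subst nn_integral_add) (auto simp: nn_integral_cmult)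
    also have "\<dots> \<le> 2 * ennreal (e / 4) + 2 * ennreal (e / 4)"
      using K n by (intro add_mono mult_left_mono) (auto simp: L_def)
    also have "\<dots> = ennreal e"
      using e by (simp flip: ennreal_numeral ennreal_mult ennreal_plus)
    finally show "(\<integral>\<^sup>+x. ennreal ((norm (f x - \<theta> x *\<^sub>R T L (g n x)))\<^sup>2) \<partial>lborel) \<le> ennreal e" .
  qed
qed

text \<open>With g continuous and close to f, the error splits into the mollified difference,
  controlled by the L^2 contraction, the mollification error of g, controlled by uniform continuity,
  and f - g itself. Each part is allotted e/9, since (a + b + c)^2 \<le> 3 (a^2 + b^2 +
  c^2).\<close>

lemma convolve_moll_L2_tendsto:
  fixes f :: "'a::euclidean_space \<Rightarrow> complex"
  assumes f [measurable]: "f \<in> borel_measurable borel" and sq: "integrable lborel (\<lambda>x. (norm (f x))\<^sup>2)"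
    and supp: "\<And>x. M \<le> norm x \<Longrightarrow> f x = 0" and e: "0 < (e::real)"
  obtains d where "0 < d" "\<And>\<epsilon>. 0 < \<epsilon> \<Longrightarrow> \<epsilon> < d \<Longrightarrow>
    (\<integral>\<^sup>+x. ennreal ((norm (convolve (moll \<epsilon>) f x - f x))\<^sup>2) \<partial>lborel) \<le> ennreal e"
proof -
  obtain g where g: "continuous_on UNIV g" "\<And>x. M + 1 \<le> norm x \<Longrightarrow> g x = 0"
    "(\<integral>\<^sup>+x. ennreal ((norm (f x - g x))\<^sup>2) \<partial>lborel) \<le> ennreal (e / 9)"
    using continuous_L2_dense[OF f sq supp, where e="e / 9"] e by auto
  have [measurable]: "g \<in> borel_measurable borel" using g(1) by (rule borel_measurable_continuous_onI)
  have if': "integrable lborel f" by (rule integrable_of_L2_bounded_support[OF f sq supp])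
  have "integrable lborel (\<lambda>x. indicator (cball 0 (M + 1)) x *\<^sub>R g x)"
    using borel_integrable_compact[of "cball 0 (M + 1)" g] continuous_on_subset[OF g(1)] by auto
  moreover have "indicator (cball 0 (M + 1)) x *\<^sub>R g x = g x" for x
    using g(2)[of x] by (auto simp: indicator_def)
  ultimately have ig: "integrable lborel g" by simp
  define V where "V = measure lborel (cball (0::'a) (M + 2))"
  have V: "emeasure lborel (cball (0::'a) (M + 2)) = ennreal V"
    unfolding V_def using emeasure_bounded_finite[of "cball (0::'a) (M + 2)"]
    by (intro emeasure_eq_ennreal_measure) auto
  \<comment> \<open>As g lives in the ball of radius M + 1 and \<epsilon> < 1, the mollification
    error of g lives in radius M + 2. A uniform error \<eta> there costs
    \<open>\<eta>\<^sup>2 * V\<close>, at most e/9; the summand 1 excludes a zero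
    denominator.\<close>
  define \<eta> where "\<eta> = sqrt (e / (9 * (V + 1)))"
  have V0: "0 \<le> V" by (simp add: V_def)
  have \<eta>: "0 < \<eta>" using e V0 by (simp add: \<eta>_def)
  have \<eta>V: "\<eta>\<^sup>2 * V \<le> e / 9"
    using e V0 by (simp add: \<eta>_def field_simps)
  \<comment> \<open>Points within \<epsilon> < 1 of the ball of radius M + 2 stay in radius M +
    3.\<close>
  have "uniformly_continuous_on (cball 0 (M + 3)) g"
    by (intro compact_uniformly_continuous continuous_on_subset[OF g(1)]) auto
  then obtain d where d: "0 < d" "\<And>x y. x \<in> cball 0 (M + 3) \<Longrightarrow> y \<in> cball 0 (M + 3) \<Longrightarrow> dist y x < d \<Longrightarrow> dist (g y) (g x) < \<eta>"
    unfolding uniformly_continuous_on_def using \<eta> by metis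
  show thesis
  proof (rule that[of "min d 1"])
    show "0 < min d 1" using d by simp
    fix \<epsilon> assume \<epsilon>: "0 < \<epsilon>" "\<epsilon> < min d 1"
    have unif: "norm (convolve (moll \<epsilon>) g x - g x) \<le> \<eta>" for x
    proof -
      have i1: "integrable lborel (\<lambda>y. moll \<epsilon> (x - y))"
        using nn_integral_lborel_reflect[of "\<lambda>y. ennreal (moll \<epsilon> y)" x]
          nn_integral_moll[where 'a='a, OF \<epsilon>(1)]
        by (intro integrableI_nonneg) auto
      have one: "(\<integral>y. moll \<epsilon> (x - y) \<partial>lborel) = 1"
        using nn_integral_lborel_reflect[of "\<lambda>y. ennreal (moll \<epsilon> y)" x] nn_integral_moll[where 'a='a, OF \<epsilon>(1)]
        by (subst integral_eq_nn_integral) auto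
      have i2: "integrable lborel (\<lambda>y. moll \<epsilon> (x - y) *\<^sub>R g y)"
        using integrable_moll_scaleR[OF ig] \<epsilon> by auto
      have i3: "integrable lborel (\<lambda>y. moll \<epsilon> (x - y) *\<^sub>R g x)" using i1 by (rule integrable_scaleR_left)
      have "convolve (moll \<epsilon>) g x - g x = (\<integral>y. moll \<epsilon> (x - y) *\<^sub>R g y \<partial>lborel) - (\<integral>y. moll \<epsilon> (x - y) *\<^sub>R g x \<partial>lborel)"
        unfolding convolve_def using i1 one by (simp add: integral_scaleR_left)
      also have "\<dots> = (\<integral>y. moll \<epsilon> (x - y) *\<^sub>R g y - moll \<epsilon> (x - y) *\<^sub>R g x \<partial>lborel)"
        using i2 i3 by simp
      also have "norm \<dots> \<le> (\<integral>y. moll \<epsilon> (x - y) * \<eta> \<partial>lborel)"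
      proof (rule Bochner_Integration.integral_norm_bound_integral)
        fix y
        have "norm (g y - g x) \<le> \<eta>" if "norm (x - y) < \<epsilon>"
        proof (cases "norm x \<le> M + 2")
          case True
          then have "norm y \<le> M + 3" using that \<epsilon> norm_triangle_ineq2[of y x] by (simp add: norm_minus_commute)
          then show ?thesis using d(2)[of x y] True that \<epsilon> by (auto simp: dist_norm norm_minus_commute)
        next
          case False
          then have "norm y \<ge> M + 1" using that \<epsilon> norm_triangle_ineq2[of x y] by simp
          then show ?thesis using False g(2) \<eta> by auto
        qed
        then show "norm (moll \<epsilon> (x - y) *\<^sub>R g y - moll \<epsilon> (x - y) *\<^sub>R g x) \<le> moll \<epsilon> (x - y) * \<eta>"
          using moll_eq_0[of \<epsilon> "x - y"] \<epsilon>
          by (cases "norm (x - y) < \<epsilon>") (auto simp flip: scaleR_diff_right intro!: mult_left_mono)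
      qed (use i1 i2 i3 in auto)
      also have "\<dots> = \<eta>" using one by simp
      finally show ?thesis .
    qed
    have zero: "convolve (moll \<epsilon>) g x - g x = 0" if "\<not> norm x \<le> M + 2" for x
    proof -
      have z: "moll \<epsilon> (x - y) *\<^sub>R g y = 0" for y
      proof (cases "\<epsilon> \<le> norm (x - y)")
        case False
        then have "norm y \<ge> M + 1" using that \<epsilon> norm_triangle_ineq2[of x y] by simp
        then show ?thesis using g(2) by simp
      qed (use \<epsilon> moll_eq_0[of \<epsilon> "x - y"] in auto)
      show ?thesis using g(2)[of x] that unfolding convolve_def z by simp
    qed
    have A2: "(\<integral>\<^sup>+x. ennreal ((norm (convolve (moll \<epsilon>) g x - g x))\<^sup>2) \<partial>lborel) \<le> ennreal (e / 9)"
    proof -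
      have "(\<integral>\<^sup>+x. ennreal ((norm (convolve (moll \<epsilon>) g x - g x))\<^sup>2) \<partial>lborel) \<le>
         (\<integral>\<^sup>+x. ennreal (\<eta>\<^sup>2) * indicator (cball (0::'a) (M + 2)) x \<partial>lborel)"
      proof (intro nn_integral_mono)
        fix x :: 'a
        show "ennreal ((norm (convolve (moll \<epsilon>) g x - g x))\<^sup>2) \<le> ennreal (\<eta>\<^sup>2) * indicator (cball 0 (M + 2)) x"
          using zero[of x] power_mono[OF unif[of x] norm_ge_zero, of 2]
          by (cases "norm x \<le> M + 2") (auto intro!: ennreal_leI)
      qed
      also have "\<dots> = ennreal (\<eta>\<^sup>2 * V)"
        by (subst nn_integral_cmult_indicator) (auto simp: V V0 ennreal_mult)
      also have "\<dots> \<le> ennreal (e / 9)" using \<eta>V by (rule ennreal_leI)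
      finally show ?thesis .
    qed
    have A1: "(\<integral>\<^sup>+x. ennreal ((norm (convolve (moll \<epsilon>) (\<lambda>x. f x - g x) x))\<^sup>2) \<partial>lborel) \<le> ennreal (e / 9)"
      by (rule order_trans[OF convolve_moll_L2_le g(3)]) (use if' ig \<epsilon> in auto)
    have lin: "convolve (moll \<epsilon>) (\<lambda>x. f x - g x) x = convolve (moll \<epsilon>) f x - convolve (moll \<epsilon>) g x" for x
      unfolding convolve_def scaleR_diff_right
      using \<epsilon> by (intro Bochner_Integration.integral_diff integrable_moll_scaleR if' ig) auto
    have "(\<integral>\<^sup>+x. ennreal ((norm (convolve (moll \<epsilon>) f x - f x))\<^sup>2) \<partial>lborel) \<le>
      (\<integral>\<^sup>+x. 3 * (ennreal ((norm (convolve (moll \<epsilon>) (\<lambda>x. f x - g x) x))\<^sup>2) +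
         ennreal ((norm (convolve (moll \<epsilon>) g x - g x))\<^sup>2) + ennreal ((norm (f x - g x))\<^sup>2)) \<partial>lborel)"
    proof (intro nn_integral_mono)
      fix x
      let ?a = "norm (convolve (moll \<epsilon>) (\<lambda>x. f x - g x) x)" and ?b = "norm (convolve (moll \<epsilon>) g x - g x)"
        and ?c = "norm (f x - g x)"
      have "convolve (moll \<epsilon>) f x - f x = convolve (moll \<epsilon>) (\<lambda>x. f x - g x) x + (convolve (moll \<epsilon>) g x - g x) - (f x - g x)"
        by (simp add: lin)
      then have "norm (convolve (moll \<epsilon>) f x - f x) \<le> ?a + ?b + ?c"
        using norm_triangle_ineq4 norm_triangle_ineq by (smt (verit))
      then have "(norm (convolve (moll \<epsilon>) f x - f x))\<^sup>2 \<le> (?a + ?b + ?c)\<^sup>2"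
        by (intro power_mono) auto
      also have "\<dots> \<le> 3 * (?a\<^sup>2 + ?b\<^sup>2 + ?c\<^sup>2)"
        using sum_squares_bound[of ?a ?b] sum_squares_bound[of ?a ?c] sum_squares_bound[of ?b ?c]
        by (simp add: power2_eq_square algebra_simps)
      finally show "ennreal ((norm (convolve (moll \<epsilon>) f x - f x))\<^sup>2) \<le> 3 * (ennreal (?a\<^sup>2) + ennreal (?b\<^sup>2) + ennreal (?c\<^sup>2))"
        by (simp add: ennreal_leI flip: ennreal_plus ennreal_numeral ennreal_mult)
    qed
    also have "\<dots> = 3 * ((\<integral>\<^sup>+x. ennreal ((norm (convolve (moll \<epsilon>) (\<lambda>x. f x - g x) x))\<^sup>2) \<partial>lborel) +
        (\<integral>\<^sup>+x. ennreal ((norm (convolve (moll \<epsilon>) g x - g x))\<^sup>2) \<partial>lborel) + (\<integral>\<^sup>+x. ennreal ((norm (f x - g x))\<^sup>2) \<partial>lborel))"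
      by (simp add: nn_integral_cmult nn_integral_add)
    also have "\<dots> \<le> 3 * (ennreal (e / 9) + ennreal (e / 9) + ennreal (e / 9))"
      by (intro mult_left_mono add_mono A1 A2 g(3)) auto
    also have "\<dots> = ennreal e"
      using e by (simp flip: ennreal_plus ennreal_numeral ennreal_mult)
    finally show "(\<integral>\<^sup>+x. ennreal ((norm (convolve (moll \<epsilon>) f x - f x))\<^sup>2) \<partial>lborel) \<le> ennreal e" .
  qed
qed

section \<open>The angular inequality\<close>

text \<open>Half-period cotangent: \<open>\<phi> = cot ((\<theta> - c) / 2) / 2\<close> satisfies \<open>\<phi>' = - 1/4 - \<phi>\<^sup>2\<close>, so that
  \<open>(v' - \<phi> v)\<^sup>2 = v'\<^sup>2 - v\<^sup>2 / 4 - (\<phi> v\<^sup>2)'\<close>; its poles are cancelled by placing \<open>c\<close> at a zero of \<open>v\<close>.\<close>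

lemma antiperiodic_wirtinger:
  fixes v v' :: "real \<Rightarrow> real"
  assumes der: "\<And>\<theta>. (v has_real_derivative v' \<theta>) (at \<theta>)" and cont: "continuous_on UNIV v'"
    and anti: "\<And>\<theta>. v (\<theta> + 2 * pi) = - v \<theta>"
  shows "0 \<le> integral {0..2 * pi} (\<lambda>\<theta>. (v' \<theta>)\<^sup>2 - (v \<theta>)\<^sup>2 / 4)"
proof -
  have vc: "continuous_on A v" for A
    using der by (meson DERIV_isCont continuous_at_imp_continuous_on)
  have v'c: "continuous_on A v'" for A using cont continuous_on_subset by blast
  have v2pi: "v (2 * pi) = - v 0" using anti[of 0] by simp
  \<comment> \<open>Antiperiodicity gives v opposite values at 0 and 2 pi, hence a zero between
    them.\<close>
  obtain c where c: "0 \<le> c" "c \<le> 2 * pi" "v c = 0"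
    using IVT'[of v 0 0 "2 * pi"] IVT2'[of v "2 * pi" 0 0] vc[of "{0..2*pi}"] v2pi
    by (cases "v 0 \<le> 0") auto
  \<comment> \<open>This is \<phi> v^2 with the quotient v / sin kept together. At a pole, division
    by zero makes \<open>G\<close> vanish there, which is also its limit: v / sin stays bounded
    while the remaining factor v tends to 0.\<close>
  define G where "G = (\<lambda>\<theta>. cos ((\<theta> - c) / 2) * v \<theta> * (v \<theta> / sin ((\<theta> - c) / 2)) / 2)"
  define g where "g = (\<lambda>\<theta>. (v' \<theta>)\<^sup>2 - (v \<theta>)\<^sup>2 / 4
      - (v' \<theta> - cos ((\<theta> - c) / 2) / sin ((\<theta> - c) / 2) * v \<theta> / 2)\<^sup>2)"
  \<comment> \<open>Besides c, a pole can occur only at an end of the interval, when c is the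
    opposite end. There v vanishes by antiperiodicity, so every pole is cancelled.\<close>
  have zero: "\<theta> = c \<or> \<theta> = 0 \<or> \<theta> = 2 * pi" "v \<theta> = 0"
    if \<theta>: "\<theta> \<in> {0..2*pi}" "sin ((\<theta> - c) / 2) = 0" for \<theta>
  proof -
    have "\<bar>(\<theta> - c) / 2\<bar> \<le> pi" using \<theta> c by auto
    then have 1: "(\<theta> - c) / 2 = 0 \<or> (\<theta> - c) / 2 = pi \<or> (\<theta> - c) / 2 = - pi"
      using \<theta>(2) sin_gt_zero[of "(\<theta> - c) / 2"] sin_gt_zero[of "- ((\<theta> - c) / 2)"]
      by (smt (verit) sin_minus)
    then show "\<theta> = c \<or> \<theta> = 0 \<or> \<theta> = 2 * pi" using \<theta> c by auto
    from 1 consider "\<theta> = c" | "\<theta> = c + 2 * pi" | "c = \<theta> + 2 * pi" by auto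
    then show "v \<theta> = 0" using anti[of c] anti[of \<theta>] c(3) by cases auto
  qed
  have ds: "((\<lambda>\<theta>. sin ((\<theta> - c) / 2)) has_real_derivative cos ((\<theta> - c) / 2) / 2) (at \<theta>)" for \<theta>
    by (auto intro!: derivative_eq_intros)
  have dc: "((\<lambda>\<theta>. cos ((\<theta> - c) / 2)) has_real_derivative - sin ((\<theta> - c) / 2) / 2) (at \<theta>)" for \<theta>
    by (auto intro!: derivative_eq_intros)
  have Gc: "isCont G \<theta>" if "\<theta> \<in> {0..2*pi}" for \<theta>
  proof (cases "sin ((\<theta> - c) / 2) = 0")
    case False
    then show ?thesis unfolding G_def by (intro continuous_intros DERIV_isCont[OF der]) auto
  next
    case True
    have v0: "v \<theta> = 0" using zero that True by auto
    have cs: "cos ((\<theta> - c) / 2) \<noteq> 0" using True sin_cos_squared_add[of "(\<theta> - c) / 2"] by auto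
    have "((\<lambda>y. (v y - v \<theta>) / (y - \<theta>)) \<longlongrightarrow> v' \<theta>) (at \<theta>)"
      using der[of \<theta>] by (simp add: has_field_derivative_iff)
    moreover have "((\<lambda>y. (sin ((y - c) / 2) - sin ((\<theta> - c) / 2)) / (y - \<theta>)) \<longlongrightarrow> cos ((\<theta> - c) / 2) / 2) (at \<theta>)"
      using ds[of \<theta>] by (simp add: has_field_derivative_iff)
    ultimately have "((\<lambda>y. ((v y - v \<theta>) / (y - \<theta>)) / ((sin ((y - c) / 2) - sin ((\<theta> - c) / 2)) / (y - \<theta>)))
        \<longlongrightarrow> v' \<theta> / (cos ((\<theta> - c) / 2) / 2)) (at \<theta>)"
      by (rule tendsto_divide) (use cs in simp)
    moreover have "\<forall>\<^sub>F y in at \<theta>. ((v y - v \<theta>) / (y - \<theta>)) / ((sin ((y - c) / 2) - sin ((\<theta> - c) / 2)) / (y - \<theta>))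
       = v y / sin ((y - c) / 2)"
      unfolding eventually_at by (intro exI[of _ 1]) (auto simp: v0 True)
    ultimately have q: "((\<lambda>y. v y / sin ((y - c) / 2)) \<longlongrightarrow> v' \<theta> / (cos ((\<theta> - c) / 2) / 2)) (at \<theta>)"
      by (rule Lim_transform_eventually)
    have "(v \<longlongrightarrow> v \<theta>) (at \<theta>)" using DERIV_isCont[OF der[of \<theta>]] by (simp add: isCont_def)
    then have "(G \<longlongrightarrow> cos ((\<theta> - c) / 2) * v \<theta> * (v' \<theta> / (cos ((\<theta> - c) / 2) / 2)) / 2) (at \<theta>)"
      unfolding G_def by (intro tendsto_intros q) auto
    then show ?thesis unfolding isCont_def by (simp add: G_def v0)
  qed
  have dG: "(G has_real_derivative g \<theta>) (at \<theta>)" if "sin ((\<theta> - c) / 2) \<noteq> 0" for \<theta>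
  proof -
    let ?s = "sin ((\<theta> - c) / 2)" and ?k = "cos ((\<theta> - c) / 2)"
    have sq: "?k * ?k = 1 - ?s * ?s" using sin_cos_squared_add[of "(\<theta> - c) / 2"] by (simp add: power2_eq_square)
    have D: "(G has_real_derivative
       (((- ?s / 2) * v \<theta> + ?k * v' \<theta>) * (v \<theta> / ?s) + ?k * v \<theta> * ((v' \<theta> * ?s - v \<theta> * (?k / 2)) / (?s * ?s))) / 2) (at \<theta>)"
      unfolding G_def
      by (rule DERIV_cong[OF DERIV_cdivide[OF DERIV_mult[OF DERIV_mult[OF dc der] DERIV_divide[OF der ds that]], of 2]])
        (simp add: algebra_simps)
    have e1: "(((- ?s / 2) * v \<theta> + ?k * v' \<theta>) * (v \<theta> / ?s) + ?k * v \<theta> * ((v' \<theta> * ?s - v \<theta> * (?k / 2)) / (?s * ?s))) / 2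
       = ?k * v \<theta> * v' \<theta> / ?s - (v \<theta>)\<^sup>2 / 4 - (?k * ?k) * (v \<theta>)\<^sup>2 / (4 * (?s * ?s))"
      using that by (simp add: field_simps power2_eq_square)
    have e2: "g \<theta> = ?k * v \<theta> * v' \<theta> / ?s - (v \<theta>)\<^sup>2 / 4 - (?k * ?k) * (v \<theta>)\<^sup>2 / (4 * (?s * ?s))"
      using that unfolding g_def by (simp add: field_simps power2_eq_square)
    show ?thesis using D unfolding e1 e2[symmetric] .
  qed
  have hg: "(g has_integral (G (2 * pi) - G 0)) {0..2*pi}"
  proof (rule fundamental_theorem_of_calculus_interior_strong[where S="{c, 0, 2*pi}"])
    fix x assume x: "x \<in> {0<..<2*pi} - {c, 0, 2*pi}"
    then have "sin ((x - c) / 2) \<noteq> 0" using zero(1)[of x] by auto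
    then show "(G has_vector_derivative g x) (at x)"
      using dG by (simp add: has_real_derivative_iff_has_vector_derivative)
  next
    show "continuous_on {0..2*pi} G" using Gc by (intro continuous_at_imp_continuous_on) auto
  qed auto
  \<comment> \<open>A full turn flips sin, cos and v together; the four sign changes in
    \<open>G\<close> cancel, and the boundary terms agree.\<close>
  have "sin ((2 * pi - c) / 2) = - sin ((0 - c) / 2)" "cos ((2 * pi - c) / 2) = - cos ((0 - c) / 2)"
    by (simp_all add: diff_divide_distrib sin_diff cos_diff)
  then have "G (2 * pi) = G 0" unfolding G_def by (simp add: v2pi)
  then have "(g has_integral 0) {0..2*pi}" using hg by simp
  moreover have "((\<lambda>\<theta>. (v' \<theta>)\<^sup>2 - (v \<theta>)\<^sup>2 / 4) has_integral integral {0..2 * pi} (\<lambda>\<theta>. (v' \<theta>)\<^sup>2 - (v \<theta>)\<^sup>2 / 4)) {0..2*pi}"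
    by (intro integrable_integral integrable_continuous_interval continuous_intros vc v'c)  auto
  ultimately show ?thesis
    by (rule has_integral_le) (simp add: g_def)
qed

text \<open>On the mode exp(i m theta) the integrand is m^2 - m, which is nonnegative for integers.
  Shifting by half a mode symmetrizes this: for v = exp(-i theta / 2) u the integrand equals |v'|^2
  - |v|^2 / 4, and v is antiperiodic, so the real inequality applies to its real and imaginary
  parts.\<close>

lemma periodic_angular_inequality:
  fixes u u' :: "real \<Rightarrow> complex"
  assumes der: "\<And>\<theta>. (u has_vector_derivative u' \<theta>) (at \<theta>)" and cont: "continuous_on UNIV u'"
    and per: "\<And>\<theta>. u (\<theta> + 2 * pi) = u \<theta>"
  shows "0 \<le> integral {0..2 * pi} (\<lambda>\<theta>. (cmod (u' \<theta>))\<^sup>2 - Im (cnj (u \<theta>) * u' \<theta>))"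
proof -
  define v where "v = (\<lambda>\<theta>. cis (- \<theta> / 2) * u \<theta>)"
  define v' where "v' = (\<lambda>\<theta>. cis (- \<theta> / 2) * (u' \<theta> - \<i> * u \<theta> / 2))"
  have uc: "continuous_on A u" for A
    using der has_vector_derivative_continuous continuous_at_imp_continuous_on by blast
  have u'c: "continuous_on A u'" for A using cont continuous_on_subset by blast
  have dcis: "((\<lambda>\<theta>. cis (- \<theta> / 2)) has_vector_derivative (- \<i> / 2 * cis (- \<theta> / 2))) (at \<theta>)" for \<theta>
  proof -
    have "((\<lambda>z. exp (\<i> * (- z / 2))) has_field_derivative (- \<i> / 2 * exp (\<i> * (- of_real \<theta> / 2)))) (at (of_real \<theta>))"
      by (auto intro!: derivative_eq_intros)
    from has_vector_derivative_real_field[OF this] show ?thesis by (simp add: cis_conv_exp)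
  qed
  have dv: "(v has_vector_derivative v' \<theta>) (at \<theta>)" for \<theta>
    using has_vector_derivative_mult[OF dcis der[of \<theta>]]
    unfolding v_def v'_def by (simp add: algebra_simps)
  have dR: "((\<lambda>\<theta>. Re (v \<theta>)) has_real_derivative Re (v' \<theta>)) (at \<theta>)"
    and dI: "((\<lambda>\<theta>. Im (v \<theta>)) has_real_derivative Im (v' \<theta>)) (at \<theta>)" for \<theta>
    using bounded_linear.has_vector_derivative[OF bounded_linear_Re dv]
      bounded_linear.has_vector_derivative[OF bounded_linear_Im dv]
    by (simp_all add: has_real_derivative_iff_has_vector_derivative)
  have v'c: "continuous_on A v'" for A
    unfolding v'_def by (intro continuous_intros uc u'c) auto
  have vc: "continuous_on A v" for A
    unfolding v_def by (intro continuous_intros uc) auto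
  have anti: "v (\<theta> + 2 * pi) = - v \<theta>" for \<theta>
  proof -
    have "cis (- (\<theta> + 2 * pi) / 2) = cis (- \<theta> / 2 + (- pi))" by (rule arg_cong[of _ _ cis]) (simp add: field_simps)
    also have "\<dots> = cis (- \<theta> / 2) * cis (- pi)" by (rule cis_mult[symmetric])
    also have "cis (- pi) = -1" by (simp add: complex_eq_iff)
    finally show ?thesis unfolding v_def by (simp add: per)
  qed
  have iR: "0 \<le> integral {0..2 * pi} (\<lambda>\<theta>. (Re (v' \<theta>))\<^sup>2 - (Re (v \<theta>))\<^sup>2 / 4)"
    by (rule antiperiodic_wirtinger[OF dR]) (auto intro!: continuous_intros v'c simp: anti)
  have iI: "0 \<le> integral {0..2 * pi} (\<lambda>\<theta>. (Im (v' \<theta>))\<^sup>2 - (Im (v \<theta>))\<^sup>2 / 4)"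
    by (rule antiperiodic_wirtinger[OF dI]) (auto intro!: continuous_intros v'c simp: anti)
  have "integral {0..2 * pi} (\<lambda>\<theta>. ((Re (v' \<theta>))\<^sup>2 - (Re (v \<theta>))\<^sup>2 / 4) + ((Im (v' \<theta>))\<^sup>2 - (Im (v \<theta>))\<^sup>2 / 4))
      = integral {0..2 * pi} (\<lambda>\<theta>. (Re (v' \<theta>))\<^sup>2 - (Re (v \<theta>))\<^sup>2 / 4) + integral {0..2 * pi} (\<lambda>\<theta>. (Im (v' \<theta>))\<^sup>2 - (Im (v \<theta>))\<^sup>2 / 4)"
    by (intro Henstock_Kurzweil_Integration.integral_add integrable_continuous_interval continuous_intros v'c vc) auto
  moreover have "(\<lambda>\<theta>. ((Re (v' \<theta>))\<^sup>2 - (Re (v \<theta>))\<^sup>2 / 4) + ((Im (v' \<theta>))\<^sup>2 - (Im (v \<theta>))\<^sup>2 / 4))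
     = (\<lambda>\<theta>. (cmod (u' \<theta>))\<^sup>2 - Im (cnj (u \<theta>) * u' \<theta>))"
  proof
    fix \<theta>
    have "((Re (v' \<theta>))\<^sup>2 - (Re (v \<theta>))\<^sup>2 / 4) + ((Im (v' \<theta>))\<^sup>2 - (Im (v \<theta>))\<^sup>2 / 4) = (cmod (v' \<theta>))\<^sup>2 - (cmod (v \<theta>))\<^sup>2 / 4"
      by (simp add: cmod_power2 field_simps)
    also have "\<dots> = (cmod (u' \<theta> - \<i> * u \<theta> / 2))\<^sup>2 - (cmod (u \<theta>))\<^sup>2 / 4"
      unfolding v_def v'_def by (simp add: norm_mult)
    also have "\<dots> = (cmod (u' \<theta>))\<^sup>2 - Im (cnj (u \<theta>) * u' \<theta>)"
      unfolding cmod_power2 by (simp add: power2_eq_square field_simps)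
    finally show "((Re (v' \<theta>))\<^sup>2 - (Re (v \<theta>))\<^sup>2 / 4) + ((Im (v' \<theta>))\<^sup>2 - (Im (v \<theta>))\<^sup>2 / 4)
       = (cmod (u' \<theta>))\<^sup>2 - Im (cnj (u \<theta>) * u' \<theta>)" .
  qed
  ultimately show ?thesis using iR iI by simp
qed

section \<open>Rotation invariance of planar Lebesgue measure\<close>

lemma distr_lborel_eqI:
  fixes T :: "real \<times> real \<Rightarrow> real \<times> real"
  assumes [measurable]: "T \<in> borel_measurable borel"
    and "\<And>f. f \<in> borel_measurable borel \<Longrightarrow> (\<integral>\<^sup>+x. f (T x) \<partial>lborel) = (\<integral>\<^sup>+x. f x \<partial>lborel)"
  shows "distr lborel borel T = lborel"
proof (rule measure_eqI)
  fix A assume "A \<in> sets (distr lborel borel T)"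
  then have [measurable]: "A \<in> sets borel" by simp
  have "emeasure (distr lborel borel T) A = (\<integral>\<^sup>+x. indicator A x \<partial>distr lborel borel T)" by simp
  also have "\<dots> = (\<integral>\<^sup>+x. indicator A (T x) \<partial>lborel)" by (subst nn_integral_distr) auto
  also have "\<dots> = emeasure lborel A" by (subst assms(2)) auto
  finally show "emeasure (distr lborel borel T) A = emeasure lborel A" .
qed simp

lemma nn_integral_translate_real:
  fixes f :: "real \<Rightarrow> ennreal"
  assumes "f \<in> borel_measurable borel"
  shows "(\<integral>\<^sup>+x. f (x + t) \<partial>lborel) = (\<integral>\<^sup>+x. f x \<partial>lborel)"
  using nn_integral_real_affine[OF assms, of 1 t] by (simp add: add.commute)

lemma borel_measurable_shear [measurable]:
  "(\<lambda>z::real \<times> real. (fst z + t * snd z, snd z)) \<in> borel_measurable borel"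
  "(\<lambda>z::real \<times> real. (fst z, snd z + t * fst z)) \<in> borel_measurable borel"
  "(\<lambda>z::real \<times> real. (snd z, fst z)) \<in> borel_measurable borel"
  by (intro borel_measurable_continuous_onI continuous_intros)+

lemma distr_lborel_shear1: "distr lborel borel (\<lambda>z. (fst z + t * snd z, snd z)) = (lborel :: (real \<times> real) measure)"
proof (rule distr_lborel_eqI)
  fix f :: "real \<times> real \<Rightarrow> ennreal" assume f [measurable]: "f \<in> borel_measurable borel"
  have "(\<integral>\<^sup>+x. f ((\<lambda>z. (fst z + t * snd z, snd z)) x) \<partial>lborel) = (\<integral>\<^sup>+y. (\<integral>\<^sup>+x. f (x + t * y, y) \<partial>lborel) \<partial>lborel)"
    unfolding lborel_prod[symmetric] by (subst lborel_pair.nn_integral_snd[symmetric]) (auto simp: lborel_prod intro!: measurable_compose[OF _ f] borel_measurable_shear)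
  also have "\<dots> = (\<integral>\<^sup>+y. (\<integral>\<^sup>+x. f (x, y) \<partial>lborel) \<partial>lborel)"
    by (intro nn_integral_cong nn_integral_translate_real) measurable
  also have "\<dots> = (\<integral>\<^sup>+x. f x \<partial>lborel)"
    unfolding lborel_prod[symmetric] by (subst lborel_pair.nn_integral_snd[symmetric]) (auto simp: lborel_prod intro!: measurable_compose[OF _ f] borel_measurable_shear)
  finally show "(\<integral>\<^sup>+x. f ((\<lambda>z. (fst z + t * snd z, snd z)) x) \<partial>lborel) = (\<integral>\<^sup>+x. f x \<partial>lborel)" .
qed (rule borel_measurable_shear)

lemma distr_lborel_shear2: "distr lborel borel (\<lambda>z. (fst z, snd z + t * fst z)) = (lborel :: (real \<times> real) measure)"
proof (rule distr_lborel_eqI)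
  fix f :: "real \<times> real \<Rightarrow> ennreal" assume f [measurable]: "f \<in> borel_measurable borel"
  have "(\<integral>\<^sup>+x. f ((\<lambda>z. (fst z, snd z + t * fst z)) x) \<partial>lborel) = (\<integral>\<^sup>+x. (\<integral>\<^sup>+y. f (x, y + t * x) \<partial>lborel) \<partial>lborel)"
    unfolding lborel_prod[symmetric] by (subst lborel.nn_integral_fst[symmetric]) (auto simp: lborel_prod intro!: measurable_compose[OF _ f] borel_measurable_shear)
  also have "\<dots> = (\<integral>\<^sup>+x. (\<integral>\<^sup>+y. f (x, y) \<partial>lborel) \<partial>lborel)"
    by (intro nn_integral_cong nn_integral_translate_real) measurable
  also have "\<dots> = (\<integral>\<^sup>+x. f x \<partial>lborel)"
    unfolding lborel_prod[symmetric] by (subst lborel.nn_integral_fst[symmetric]) (auto simp: lborel_prod intro!: measurable_compose[OF _ f] borel_measurable_shear)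
  finally show "(\<integral>\<^sup>+x. f ((\<lambda>z. (fst z, snd z + t * fst z)) x) \<partial>lborel) = (\<integral>\<^sup>+x. f x \<partial>lborel)" .
qed (rule borel_measurable_shear)

lemma distr_lborel_swap: "distr lborel borel (\<lambda>z. (snd z, fst z)) = (lborel :: (real \<times> real) measure)"
proof (rule distr_lborel_eqI)
  fix f :: "real \<times> real \<Rightarrow> ennreal" assume f [measurable]: "f \<in> borel_measurable borel"
  have "(\<integral>\<^sup>+x. f ((\<lambda>z. (snd z, fst z)) x) \<partial>lborel) = (\<integral>\<^sup>+y. (\<integral>\<^sup>+x. f (y, x) \<partial>lborel) \<partial>lborel)"
    unfolding lborel_prod[symmetric] by (subst lborel_pair.nn_integral_snd[symmetric]) (auto simp: lborel_prod intro!: measurable_compose[OF _ f] borel_measurable_shear)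
  also have "\<dots> = (\<integral>\<^sup>+x. f x \<partial>lborel)"
    unfolding lborel_prod[symmetric] by (subst lborel.nn_integral_fst[symmetric]) (auto simp: lborel_prod intro!: measurable_compose[OF _ f] borel_measurable_shear)
  finally show "(\<integral>\<^sup>+x. f ((\<lambda>z. (snd z, fst z)) x) \<partial>lborel) = (\<integral>\<^sup>+x. f x \<partial>lborel)" .
qed (rule borel_measurable_shear)

definition rot :: "real \<Rightarrow> real \<times> real \<Rightarrow> real \<times> real" where
  "rot \<tau> x = (cos \<tau> * fst x - sin \<tau> * snd x, sin \<tau> * fst x + cos \<tau> * snd x)"

lemma borel_measurable_rot [measurable]: "rot \<tau> \<in> borel_measurable borel"
  unfolding rot_def[abs_def] by (intro borel_measurable_continuous_onI continuous_intros)

text \<open>A rotation is a product of three shears with slopes -tan(\<tau>/2), sin \<tau>,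
  -tan(\<tau>/2), and shears preserve the measure by Tonelli and translation. The hypothesis keeps
  away from the half turn, where the tangent has a pole.\<close>

lemma distr_lborel_rot_half:
  assumes "cos (\<tau> / 2) \<noteq> 0"
  shows "distr lborel borel (rot \<tau>) = lborel"
proof -
  define a where "a = - tan (\<tau> / 2)"
  let ?A = "\<lambda>z::real \<times> real. (fst z + a * snd z, snd z)" and ?B = "\<lambda>z::real \<times> real. (fst z, snd z + sin \<tau> * fst z)"
  have s: "sin \<tau> = 2 * sin (\<tau>/2) * cos (\<tau>/2)" using sin_double[of "\<tau>/2"] by simp
  have c: "cos \<tau> = 1 - 2 * (sin (\<tau>/2))\<^sup>2" using cos_double_sin[of "\<tau>/2"] by simp
  have 1: "1 + a * sin \<tau> = cos \<tau>"
    using assms by (simp add: a_def tan_def s c power2_eq_square)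
  have 2: "a + a * cos \<tau> = - sin \<tau>"
  proof -
    have "1 + cos \<tau> = 2 * (cos (\<tau>/2))\<^sup>2" using cos_double_cos[of "\<tau>/2"] by simp
    then have "a * (1 + cos \<tau>) = - sin \<tau>" using assms by (simp add: a_def tan_def s power2_eq_square)
    then show ?thesis by (simp add: algebra_simps)
  qed
  have "rot \<tau> = ?A \<circ> (?B \<circ> ?A)"
  proof
    fix z :: "real \<times> real"
    obtain x y where z: "z = (x, y)" by (cases z)
    have "(?A \<circ> (?B \<circ> ?A)) z = (x * (1 + a * sin \<tau>) + y * (a + a * (1 + a * sin \<tau>)), sin \<tau> * x + y * (1 + a * sin \<tau>))"
      by (simp add: z algebra_simps)
    also have "\<dots> = rot \<tau> z" by (simp only: 1 2) (simp add: rot_def z algebra_simps)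
    finally show "rot \<tau> z = (?A \<circ> (?B \<circ> ?A)) z" by simp
  qed
  moreover have "distr lborel borel (?A \<circ> (?B \<circ> ?A)) = distr (distr (distr lborel borel ?A) borel ?B) borel ?A"
    by (simp add: distr_distr borel_measurable_shear measurable_comp comp_assoc measurable_lborel2)
  ultimately show ?thesis by (simp add: distr_lborel_shear1 distr_lborel_shear2)
qed

text \<open>Half of the angle is below pi, where the three-shear factorization exists; rotating
  twice by it also reaches the half turn.\<close>

lemma distr_lborel_rot:
  assumes "0 \<le> \<tau>" "\<tau> < 2 * pi"
  shows "distr lborel borel (rot \<tau>) = lborel"
proof -
  have "cos (\<tau> / 2 / 2) > 0" using assms by (intro cos_gt_zero_pi) auto
  then have h: "distr lborel borel (rot (\<tau> / 2)) = lborel" by (intro distr_lborel_rot_half) auto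
  have "rot \<tau> = rot (\<tau> / 2) \<circ> rot (\<tau> / 2)"
  proof
    fix z
    have s: "sin \<tau> = 2 * sin (\<tau>/2) * cos (\<tau>/2)" using sin_double[of "\<tau>/2"] by simp
    have c: "cos \<tau> = cos (\<tau>/2) * cos (\<tau>/2) - sin (\<tau>/2) * sin (\<tau>/2)"
      using cos_double[of "\<tau>/2"] by (simp add: power2_eq_square)
    show "rot \<tau> z = (rot (\<tau> / 2) \<circ> rot (\<tau> / 2)) z"
      unfolding rot_def s c by (simp add: algebra_simps)
  qed
  moreover have "distr lborel borel (rot (\<tau> / 2) \<circ> rot (\<tau> / 2)) = distr (distr lborel borel (rot (\<tau>/2))) borel (rot (\<tau> / 2))"
    by (subst distr_distr) auto
  ultimately show ?thesis by (simp add: h)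
qed

section \<open>Continuously differentiable functions in the plane and circular averages\<close>

definition C1_grad :: "(real \<times> real \<Rightarrow> 'b::real_normed_vector) \<Rightarrow> (real \<times> real \<Rightarrow> 'b) \<Rightarrow> (real \<times> real \<Rightarrow> 'b) \<Rightarrow> bool" where
  "C1_grad v v1 v2 \<longleftrightarrow> (\<forall>x. (v has_derivative (\<lambda>h. fst h *\<^sub>R v1 x + snd h *\<^sub>R v2 x)) (at x)) \<and>
     continuous_on UNIV v1 \<and> continuous_on UNIV v2"

lemma C1_gradD:
  assumes "C1_grad v v1 v2"
  shows "(v has_derivative (\<lambda>h. fst h *\<^sub>R v1 x + snd h *\<^sub>R v2 x)) (at x)"
    and "continuous_on A v" "continuous_on A v1" "continuous_on A v2"
proof -
  from assms show d: "(v has_derivative (\<lambda>h. fst h *\<^sub>R v1 x + snd h *\<^sub>R v2 x)) (at x)" for x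
    unfolding C1_grad_def by blast
  show "continuous_on A v"
    using has_derivative_continuous[OF d] by (intro continuous_at_imp_continuous_on) auto
  show "continuous_on A v1" "continuous_on A v2"
    using assms unfolding C1_grad_def by (auto intro: continuous_on_subset)
qed

lemma integrable_continuous_compact_support:
  fixes f :: "'a::euclidean_space \<Rightarrow> 'b::euclidean_space"
  assumes "continuous_on UNIV f" "\<And>x. M < norm x \<Longrightarrow> f x = 0"
  shows "integrable lborel f"
proof -
  have "integrable lborel (\<lambda>x. indicator (cball 0 M) x *\<^sub>R f x)"
    using borel_integrable_compact[of "cball 0 M" f] continuous_on_subset[OF assms(1)] by auto
  moreover have "indicator (cball 0 M) x *\<^sub>R f x = f x" for x
    using assms(2)[of x] by (auto simp: indicator_def)
  ultimately show ?thesis by simp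
qed

lemma C1_grad_zero_outside:
  assumes G: "C1_grad G G1 G2" and z: "\<And>x. M < norm x \<Longrightarrow> G x = 0" and x: "M < norm x"
  shows "G1 x = 0" "G2 x = 0"
proof -
  have "open {x::real \<times> real. M < norm x}" by (intro open_Collect_less continuous_intros)
  then have "(G has_derivative (\<lambda>h. 0)) (at x)"
    using x z by (intro has_derivative_transform_within_open[OF has_derivative_const[of 0]]) auto
  from has_derivative_unique[OF this C1_gradD(1)[OF G]]
  have "(\<lambda>h. 0) = (\<lambda>h. fst h *\<^sub>R G1 x + snd h *\<^sub>R G2 x)" .
  from fun_cong[OF this, of "(1,0)"] fun_cong[OF this, of "(0,1)"]
  show "G1 x = 0" "G2 x = 0" by auto
qed

text \<open>The integration by parts behind all later divergence arguments: on each line parallel to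
  an axis the fundamental theorem leaves two endpoint values, which vanish, and Fubini integrates
  over the lines.\<close>

lemma integral_partial_derivative_eq_0:
  fixes G :: "real \<times> real \<Rightarrow> 'b::euclidean_space"
  assumes G: "C1_grad G G1 G2" and z: "\<And>x. M < norm x \<Longrightarrow> G x = 0"
  shows "integrable lborel G1" "integrable lborel G2" "integral\<^sup>L lborel G1 = 0" "integral\<^sup>L lborel G2 = 0"
proof -
  have z': "G1 x = 0" "G2 x = 0" if "M < norm x" for x
    using C1_grad_zero_outside[OF G z that] by auto
  show i1: "integrable lborel G1" and i2: "integrable lborel G2"
    using C1_gradD[OF G] z' by (auto intro!: integrable_continuous_compact_support)
  define N where "N = \<bar>M\<bar> + 1"
  have N: "0 < N" "M < N" by (auto simp: N_def)
  have far: "M < norm (s, t)" if "N \<le> \<bar>s\<bar> \<or> N \<le> \<bar>t\<bar>" for s t :: real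
    using that norm_fst_le[of s t] norm_snd_le[of t s] N by auto
  have p1: "((\<lambda>s. G (s, t)) has_vector_derivative G1 (s, t)) (at s)" for s t
  proof -
    have "((\<lambda>s. (s, t)) has_derivative (\<lambda>h. (h, 0))) (at s)" by (auto intro!: derivative_eq_intros)
    from has_derivative_compose[OF this C1_gradD(1)[OF G]]
    show ?thesis by (simp add: has_vector_derivative_def)
  qed
  have p2: "((\<lambda>t. G (s, t)) has_vector_derivative G2 (s, t)) (at t)" for s t
  proof -
    have "((\<lambda>t. (s, t)) has_derivative (\<lambda>h. (0, h))) (at t)" by (auto intro!: derivative_eq_intros)
    from has_derivative_compose[OF this C1_gradD(1)[OF G]]
    show ?thesis by (simp add: has_vector_derivative_def)
  qed
  have in1: "(\<integral>s. G1 (s, t) \<partial>lborel) = 0" for t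
  proof -
    have "(\<integral>s. G1 (s, t) \<partial>lborel) = (\<integral>s. indicator {-N..N} s *\<^sub>R G1 (s, t) \<partial>lborel)"
      by (intro Bochner_Integration.integral_cong) (auto simp: indicator_def intro!: z'(1)[OF far])
    also have "\<dots> = G (N, t) - G (-N, t)"
      using N by (intro integral_FTC_Icc has_vector_derivative_at_within[OF p1]
          continuous_on_compose2[OF C1_gradD(3)[OF G, of UNIV]]) (auto intro!: continuous_intros)
    also have "\<dots> = 0" using z far N by auto
    finally show ?thesis .
  qed
  have in2: "(\<integral>t. G2 (s, t) \<partial>lborel) = 0" for s
  proof -
    have "(\<integral>t. G2 (s, t) \<partial>lborel) = (\<integral>t. indicator {-N..N} t *\<^sub>R G2 (s, t) \<partial>lborel)"
      by (intro Bochner_Integration.integral_cong) (auto simp: indicator_def intro!: z'(2)[OF far])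
    also have "\<dots> = G (s, N) - G (s, -N)"
      using N by (intro integral_FTC_Icc has_vector_derivative_at_within[OF p2]
          continuous_on_compose2[OF C1_gradD(4)[OF G, of UNIV]]) (auto intro!: continuous_intros)
    also have "\<dots> = 0" using z far N by auto
    finally show ?thesis .
  qed
  have "integral\<^sup>L lborel G1 = (\<integral>t. (\<integral>s. G1 (s, t) \<partial>lborel) \<partial>lborel)"
    using lborel_pair.integral_snd[of "\<lambda>s t. G1 (s, t)"] i1 by (simp add: lborel_prod)
  then show "integral\<^sup>L lborel G1 = 0" by (simp add: in1)
  have "integral\<^sup>L lborel G2 = (\<integral>s. (\<integral>t. G2 (s, t) \<partial>lborel) \<partial>lborel)"
    using lborel_pair.integral_fst[of "\<lambda>s t. G2 (s, t)"] i2 by (simp add: lborel_prod)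
  then show "integral\<^sup>L lborel G2 = 0" by (simp add: in2)
qed

lemma distr_lborel_rot_closed:
  assumes "0 \<le> \<tau>" "\<tau> \<le> 2 * pi"
  shows "distr lborel borel (rot \<tau>) = lborel"
proof (cases "\<tau> = 2 * pi")
  case True
  then have "rot \<tau> = rot 0" by (auto simp: rot_def)
  then show ?thesis using distr_lborel_rot[of 0] by simp
qed (use assms distr_lborel_rot in auto)

lemma norm_rot [simp]: "norm (rot \<tau> x) = norm x"
proof -
  have "(cos \<tau> * fst x - sin \<tau> * snd x)\<^sup>2 + (sin \<tau> * fst x + cos \<tau> * snd x)\<^sup>2
      = ((sin \<tau>)\<^sup>2 + (cos \<tau>)\<^sup>2) * ((fst x)\<^sup>2 + (snd x)\<^sup>2)"
    by (simp only: power2_eq_square) (simp only: algebra_simps)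
  then show ?thesis by (simp add: norm_prod_def rot_def)
qed

text \<open>By rotation invariance the integral equals its average over rotated integrands. After
  exchanging the integrals, the inner one runs over \<tau> along the circle through x; there the
  weight is constant and \<open>D\<close> is the derivative of v along the circle, so the
  one-dimensional inequality applies.\<close>

lemma radial_weight_angular_inequality:
  fixes v :: "real \<times> real \<Rightarrow> complex" and k :: "real \<Rightarrow> real"
  assumes v: "C1_grad v v1 v2" and k: "continuous_on UNIV k" "\<And>t. 0 \<le> k t" "\<And>t. T \<le> t \<Longrightarrow> k t = 0"
  defines "D \<equiv> \<lambda>x. fst x *\<^sub>R v2 x - snd x *\<^sub>R v1 x"
  shows "0 \<le> (\<integral>x. k ((norm x)\<^sup>2) * ((cmod (D x))\<^sup>2 - Im (cnj (v x) * D x)) \<partial>lborel)"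
proof -
  define \<Phi> where "\<Phi> = (\<lambda>x. k ((norm x)\<^sup>2) * ((cmod (D x))\<^sup>2 - Im (cnj (v x) * D x)))"
  note vc = C1_gradD(2-4)[OF v]
  have Dc: "continuous_on A D" for A unfolding D_def by (intro continuous_intros vc)
  have kc: "continuous_on A (\<lambda>x::real\<times>real. k ((norm x)\<^sup>2))" for A
    by (intro continuous_on_compose2[OF k(1)] continuous_intros) auto
  have \<Phi>c: "continuous_on A \<Phi>" for A unfolding \<Phi>_def by (intro continuous_intros kc Dc vc)
  have [measurable]: "\<Phi> \<in> borel_measurable borel" using \<Phi>c by (rule borel_measurable_continuous_onI)
  define M where "M = sqrt \<bar>T\<bar>"
  have zero: "\<Phi> x = 0" if "M < norm x" for x
  proof -
    have "M\<^sup>2 < (norm x)\<^sup>2" using that by (intro power_strict_mono) (auto simp: M_def)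
    then have "T \<le> (norm x)\<^sup>2" by (simp add: M_def)
    then show ?thesis by (simp add: \<Phi>_def k(3))
  qed
  have "continuous_on UNIV (\<lambda>z::real \<times> real \<times> real. rot (fst z) (snd z))"
    unfolding rot_def by (intro continuous_intros)
  then have rc: "continuous_on UNIV (\<lambda>z. \<Phi> (rot (fst z) (snd z)))"
    by (rule continuous_on_compose2[OF \<Phi>c[of UNIV]]) auto
  define J where "J = (\<lambda>(\<tau>, x). indicator {0..2*pi} \<tau> *\<^sub>R \<Phi> (rot \<tau> x))"
  have J: "integrable (lborel \<Otimes>\<^sub>M lborel) J"
  proof -
    have "integrable lborel (\<lambda>z. indicator ({0..2*pi} \<times> cball 0 M) z *\<^sub>R \<Phi> (rot (fst z) (snd z)))"
      by (intro borel_integrable_compact continuous_on_subset[OF rc] compact_Times) auto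
    moreover have "indicator ({0..2*pi} \<times> cball 0 M) z *\<^sub>R \<Phi> (rot (fst z) (snd z)) = J z" for z
      using zero[of "rot (fst z) (snd z)"] by (cases z) (auto simp: J_def indicator_def)
    ultimately show ?thesis by (simp add: lborel_prod)
  qed
  have "(\<integral>\<tau>. (\<integral>x. J (\<tau>, x) \<partial>lborel) \<partial>lborel) = (\<integral>\<tau>. indicator {0..2*pi} \<tau> *\<^sub>R integral\<^sup>L lborel \<Phi> \<partial>lborel)"
  proof (intro Bochner_Integration.integral_cong refl)
    fix \<tau> :: real
    have "(\<integral>x. \<Phi> (rot \<tau> x) \<partial>lborel) = integral\<^sup>L lborel \<Phi>" if "\<tau> \<in> {0..2*pi}"
    proof -
      have "integral\<^sup>L (distr lborel borel (rot \<tau>)) \<Phi> = (\<integral>x. \<Phi> (rot \<tau> x) \<partial>lborel)"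
        by (rule integral_distr) auto
      then show ?thesis using distr_lborel_rot_closed[of \<tau>] that by simp
    qed
    then show "(\<integral>x. J (\<tau>, x) \<partial>lborel) = indicator {0..2*pi} \<tau> *\<^sub>R integral\<^sup>L lborel \<Phi>"
      by (auto simp: J_def indicator_def)
  qed
  also have "\<dots> = 2 * pi * integral\<^sup>L lborel \<Phi>" by simp
  finally have 1: "2 * pi * integral\<^sup>L lborel \<Phi> = (\<integral>\<tau>. (\<integral>x. J (\<tau>, x) \<partial>lborel) \<partial>lborel)" by simp
  also have "\<dots> = (\<integral>x. (\<integral>\<tau>. J (\<tau>, x) \<partial>lborel) \<partial>lborel)"
    using lborel_pair.Fubini_integral[of "\<lambda>a b. J (a, b)"] J by simp
  also have "\<dots> \<ge> 0"
  proof (rule integral_nonneg_AE, rule always_eventually, rule allI)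
    fix x :: "real \<times> real"
    have dr: "((\<lambda>\<tau>. rot \<tau> x) has_derivative (\<lambda>h. h *\<^sub>R (- snd (rot \<tau> x), fst (rot \<tau> x)))) (at \<tau>)" for \<tau>
      unfolding rot_def by (auto intro!: derivative_eq_intros simp: algebra_simps)
    have d: "((\<lambda>\<tau>. v (rot \<tau> x)) has_vector_derivative D (rot \<tau> x)) (at \<tau>)" for \<tau>
      using has_derivative_compose[OF dr C1_gradD(1)[OF v]]
      unfolding has_vector_derivative_def D_def by (simp add: scaleR_diff_right scaleR_left_distrib)
    have rcx: "continuous_on A (\<lambda>\<tau>. rot \<tau> x)" for A unfolding rot_def by (intro continuous_intros)
    have per: "v (rot (\<tau> + 2 * pi) x) = v (rot \<tau> x)" for \<tau> by (simp add: rot_def)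
    have "0 \<le> integral {0..2*pi} (\<lambda>\<tau>. (cmod (D (rot \<tau> x)))\<^sup>2 - Im (cnj (v (rot \<tau> x)) * D (rot \<tau> x)))"
      by (rule periodic_angular_inequality[OF d _ per]) (intro continuous_on_compose2[OF Dc[of UNIV] rcx], auto)
    then have "0 \<le> k ((norm x)\<^sup>2) * integral {0..2*pi} (\<lambda>\<tau>. (cmod (D (rot \<tau> x)))\<^sup>2 - Im (cnj (v (rot \<tau> x)) * D (rot \<tau> x)))"
      using k(2) by simp
    also have "\<dots> = integral {0..2*pi} (\<lambda>\<tau>. \<Phi> (rot \<tau> x))"
      unfolding \<Phi>_def by simp
    also have "\<dots> = (LINT \<tau>:{0..2*pi}|lborel. \<Phi> (rot \<tau> x))"
      by (intro set_borel_integral_eq_integral(2)[symmetric] borel_integrable_atLeastAtMost'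
          continuous_on_compose2[OF \<Phi>c[of UNIV] rcx]) auto
    also have "\<dots> = (\<integral>\<tau>. J (\<tau>, x) \<partial>lborel)" by (simp add: J_def set_lebesgue_integral_def)
    finally show "0 \<le> (\<integral>\<tau>. J (\<tau>, x) \<partial>lborel)" .
  qed
  finally show ?thesis unfolding \<Phi>_def[symmetric] using pi_gt_zero by (auto simp: zero_le_mult_iff)
qed

section \<open>The weighted lower bound\<close>

lemma C1_grad_mult:
  fixes f g :: "real \<times> real \<Rightarrow> 'b::real_normed_algebra"
  assumes f: "C1_grad f f1 f2" and g: "C1_grad g g1 g2"
  shows "C1_grad (\<lambda>x. f x * g x) (\<lambda>x. f x * g1 x + f1 x * g x) (\<lambda>x. f x * g2 x + f2 x * g x)"
  unfolding C1_grad_def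
proof (intro conjI allI)
  fix x
  show "((\<lambda>x. f x * g x) has_derivative (\<lambda>h. fst h *\<^sub>R (f x * g1 x + f1 x * g x) + snd h *\<^sub>R (f x * g2 x + f2 x * g x))) (at x)"
    by (rule has_derivative_eq_rhs[OF has_derivative_mult[OF C1_gradD(1)[OF f] C1_gradD(1)[OF g]]])
      (auto simp: algebra_simps)
qed (intro continuous_intros C1_gradD[OF f] C1_gradD[OF g])+

lemma C1_grad_fst: "C1_grad (fst :: real \<times> real \<Rightarrow> real) (\<lambda>x. 1) (\<lambda>x. 0)"
  and C1_grad_snd: "C1_grad (snd :: real \<times> real \<Rightarrow> real) (\<lambda>x. 0) (\<lambda>x. 1)"
  unfolding C1_grad_def by (auto intro!: derivative_eq_intros)

text \<open>Serves two purposes: A = B = 1 gives radial weights on the disk, and A = R /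
  \<open>\<alpha>\<^sup>2\<close>, B = R / \<open>\<beta>\<^sup>2\<close> gives functions constant
  on the level ellipses.\<close>

lemma C1_grad_quadratic:
  fixes K K1 :: "real \<Rightarrow> real" and A B :: real
  assumes K: "\<And>t. 0 \<le> t \<Longrightarrow> (K has_real_derivative K1 t) (at t)" "\<And>t. 0 \<le> t \<Longrightarrow> isCont K1 t"
    and AB: "0 \<le> A" "0 \<le> B"
  defines "Q \<equiv> \<lambda>x::real \<times> real. A * (fst x)\<^sup>2 + B * (snd x)\<^sup>2"
  shows "C1_grad (\<lambda>x. K (Q x)) (\<lambda>x. 2 * A * fst x * K1 (Q x)) (\<lambda>x. 2 * B * snd x * K1 (Q x))"
proof -
  have Q0: "0 \<le> Q x" for x using AB by (simp add: Q_def)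
  have dQ: "(Q has_derivative (\<lambda>h. fst h * (2 * A * fst x) + snd h * (2 * B * snd x))) (at x)" for x
    unfolding Q_def by (auto intro!: derivative_eq_intros simp: algebra_simps)
  have "continuous_on {0..} K1" using K(2) by (intro continuous_at_imp_continuous_on) auto
  moreover have "continuous_on UNIV Q" unfolding Q_def by (intro continuous_intros)
  ultimately have "continuous_on UNIV (\<lambda>x. K1 (Q x))"
    using Q0 by (auto intro: continuous_on_compose2)
  moreover have "((\<lambda>x. K (Q x)) has_derivative (\<lambda>h. fst h *\<^sub>R (2 * A * fst x * K1 (Q x)) + snd h *\<^sub>R (2 * B * snd x * K1 (Q x)))) (at x)" for x
    by (rule has_derivative_eq_rhs[OF has_derivative_compose[OF dQ
          has_field_derivative_imp_has_derivative[OF K(1)[OF Q0[of x]]]]]) (auto simp: algebra_simps)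
  ultimately show ?thesis unfolding C1_grad_def by (auto intro!: continuous_intros)
qed

lemma norm_power2_prod: "(norm (x :: real \<times> real))\<^sup>2 = (fst x)\<^sup>2 + (snd x)\<^sup>2"
  by (simp add: norm_prod_def)

lemma C1_grad_cmod_power2:
  assumes v: "C1_grad v v1 v2"
  shows "C1_grad (\<lambda>x. (cmod (v x))\<^sup>2) (\<lambda>x. 2 * Re (cnj (v x) * v1 x)) (\<lambda>x. 2 * Re (cnj (v x) * v2 x))"
  unfolding C1_grad_def
proof (intro conjI allI)
  fix x
  have "((\<lambda>x. (Re (v x))\<^sup>2 + (Im (v x))\<^sup>2) has_derivative
      (\<lambda>h. fst h *\<^sub>R (2 * Re (cnj (v x) * v1 x)) + snd h *\<^sub>R (2 * Re (cnj (v x) * v2 x)))) (at x)"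
    by (rule has_derivative_eq_rhs, (rule derivative_intros bounded_linear.has_derivative[OF bounded_linear_Re]
        bounded_linear.has_derivative[OF bounded_linear_Im] C1_gradD(1)[OF v])+) (auto simp: algebra_simps)
  then show "((\<lambda>x. (cmod (v x))\<^sup>2) has_derivative
      (\<lambda>h. fst h *\<^sub>R (2 * Re (cnj (v x) * v1 x)) + snd h *\<^sub>R (2 * Re (cnj (v x) * v2 x)))) (at x)"
    by (simp only: cmod_power2)
qed (intro continuous_intros C1_gradD[OF v])+

text \<open>The squared positive part, applied twice to an affine function with a reflection in
  between, is a C^1 step. Its monotonicity is recorded because the sign of \<open>k'\<close> decides
  the sign of the cutoff error.\<close>

lemma smooth_cutoff:
  fixes t1 t2 :: real
  assumes "t1 < t2"
  obtains k k' where "\<And>t. (k has_real_derivative k' t) (at t)" "continuous_on UNIV k'"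
    "\<And>t. 0 \<le> k t" "\<And>t. k t \<le> 1" "\<And>t. k' t \<le> 0" "\<And>t. t \<le> t1 \<Longrightarrow> k t = 1" "\<And>t. t \<le> t1 \<Longrightarrow> k' t = 0"
    "\<And>t. t2 \<le> t \<Longrightarrow> k t = 0" "\<And>t. t2 \<le> t \<Longrightarrow> k' t = 0"
proof -
  define m where "m = (\<lambda>z::real. (max 0 z)\<^sup>2)"
  define s where "s = (\<lambda>t. (t - t1) / (t2 - t1))"
  define k' where "k' = (\<lambda>t. 2 * max 0 (1 - m (s t)) * (- (2 * max 0 (s t) * (1 / (t2 - t1)))))"
  have dm: "(m has_real_derivative 2 * max 0 z) (at z)" for z
    unfolding m_def by (rule DERIV_pos_part_square)
  have ds: "(s has_real_derivative 1 / (t2 - t1)) (at t)" for t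
    unfolding s_def using assms by (auto intro!: derivative_eq_intros)
  have "((\<lambda>t. m (1 - m (s t))) has_real_derivative k' t) (at t)" for t
    unfolding k'_def
    by (rule DERIV_chain2[OF dm], rule DERIV_cong[OF DERIV_diff[OF DERIV_const DERIV_chain2[OF dm ds]]]) simp
  moreover have "continuous_on UNIV k'" unfolding k'_def m_def s_def
    by (intro continuous_intros) (use assms in auto)
  moreover have m0: "0 \<le> m z" for z by (simp add: m_def)
  moreover have "m (1 - m (s t)) \<le> 1" for t
    using m0[of "s t"] unfolding m_def by (intro power_le_one) auto
  moreover have "k' t \<le> 0" for t
    unfolding k'_def using assms by (intro mult_nonneg_nonpos) auto
  moreover have "m (1 - m (s t)) = 1" "k' t = 0" if "t \<le> t1" for t
    using that assms by (auto simp: m_def k'_def s_def max_def divide_nonpos_pos zero_le_divide_iff)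
  moreover have "m (1 - m (s t)) = 0" "k' t = 0" if "t2 \<le> t" for t
  proof -
    have "1 \<le> s t" using that assms by (simp add: s_def)
    then have "1 \<le> m (s t)" by (simp add: m_def)
    then show "m (1 - m (s t)) = 0" "k' t = 0" by (auto simp: k'_def m_def)
  qed
  ultimately show thesis by (intro that[of "\<lambda>t. m (1 - m (s t))" k']) auto
qed

text \<open>The function \<open>q\<close> is controlled only for |t| < S. As \<open>k\<close> is
  already 0 from T < S on, extending the product by 0 is C^1 at every t \<ge> 0, the range of
  squared norms.\<close>

lemma cutoff_extension:
  fixes q q1 k k' :: "real \<Rightarrow> real"
  assumes k: "\<And>t. (k has_real_derivative k' t) (at t)" "continuous_on UNIV k'"
      "\<And>t. T \<le> t \<Longrightarrow> k t = 0" "\<And>t. T \<le> t \<Longrightarrow> k' t = 0"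
    and T: "T < S" "0 < S"
    and q: "\<And>t. \<bar>t\<bar> < S \<Longrightarrow> (q has_real_derivative q1 t) (at t)" "\<And>t. \<bar>t\<bar> < S \<Longrightarrow> isCont q1 t"
    and t: "0 \<le> t"
  shows "((\<lambda>t. if t < S then k t * q t else 0) has_real_derivative
           (if t < S then k' t * q t + k t * q1 t else 0)) (at t)"
    and "isCont (\<lambda>t. if t < S then k' t * q t + k t * q1 t else 0) t"
proof -
  let ?K = "\<lambda>t. if t < S then k t * q t else 0"
  let ?K1 = "\<lambda>t. if t < S then k' t * q t + k t * q1 t else 0"
  have "(?K has_real_derivative ?K1 t) (at t) \<and> isCont ?K1 t"
  proof (cases "t < S")
    case True
    have t': "\<bar>t\<bar> < S" using True t by simp
    have d: "((\<lambda>t. k t * q t) has_real_derivative (k' t * q t + k t * q1 t)) (at t)"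
      using DERIV_mult[OF k(1) q(1)[OF t']] by (simp add: algebra_simps)
    have o: "open {-S<..<S}" and tin: "t \<in> {-S<..<S}" using t' by auto
    have "isCont k' t" using k(2) by (simp add: continuous_on_eq_continuous_at)
    then have c: "isCont (\<lambda>t. k' t * q t + k t * q1 t) t"
      by (intro continuous_intros q(2)[OF t'] DERIV_isCont[OF k(1)] DERIV_isCont[OF q(1)[OF t']])
    have "(?K has_real_derivative ?K1 t) (at t)"
      using True has_field_derivative_transform_within_open[OF d o tin, of ?K] by simp
    moreover have "isCont ?K1 t"
      by (subst isCont_cong[where g="\<lambda>t. k' t * q t + k t * q1 t"])
        (use c o tin in \<open>auto intro: eventually_mono[OF eventually_nhds_in_open[OF o tin]]\<close>)
    ultimately show ?thesis by simp
  next
    case False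
    have o: "open {T<..}" and tin: "t \<in> {T<..}" using False T by auto
    have "(?K has_real_derivative 0) (at t)"
      by (rule has_field_derivative_transform_within_open[OF DERIV_const o tin]) (auto simp: k)
    moreover have "isCont ?K1 t"
      by (subst isCont_cong[where g="\<lambda>t. 0"])
        (auto intro!: eventually_mono[OF eventually_nhds_in_open[OF o tin]] simp: k)
    ultimately show ?thesis using False by simp
  qed
  then show "(?K has_real_derivative ?K1 t) (at t)" "isCont ?K1 t" by auto
qed

section \<open>The weighted inequality for C^1 functions\<close>

lemma mag_density_expand:
  "mag_density b v v1 v2 x = (cmod (v1 x))\<^sup>2 + (cmod (v2 x))\<^sup>2 + b\<^sup>2 * (norm x)\<^sup>2 / 4 * (cmod (v x))\<^sup>2
     - b * Im (cnj (v x) * (fst x *\<^sub>R v2 x - snd x *\<^sub>R v1 x))"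
  unfolding mag_density_def norm_power2_prod cmod_power2
  by (simp add: power2_eq_square field_simps)

text \<open>The first two terms on the left are the divergence of the field q(|x|^2) |v|^2 x. The
  gradient splits into its radial part \<open>E\<close> and its angular part \<open>D\<close>. The
  radial part pays for the divergence through |E - t q v|^2 \<ge> 0; the angular part satisfies b
  |D|^2 \<le> |D|^2 / t because b t \<le> 1; the Riccati inequality absorbs the multiple of
  |v|^2.\<close>

lemma mag_density_pointwise_bound:
  fixes v v1 v2 :: "real \<times> real \<Rightarrow> complex" and q q1 b \<mu> :: real and x :: "real \<times> real"
  defines "t \<equiv> (norm x)\<^sup>2" and "D \<equiv> fst x *\<^sub>R v2 x - snd x *\<^sub>R v1 x" and "E \<equiv> fst x *\<^sub>R v1 x + snd x *\<^sub>R v2 x"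
  assumes bt: "b * t \<le> 1" and ric: "2 * q + 2 * t * q1 + t * q\<^sup>2 \<le> b\<^sup>2 * t / 4 - \<mu>"
  shows "(2 * q + 2 * t * q1) * (cmod (v x))\<^sup>2 + 2 * q * Re (cnj (v x) * E)
      + b * ((cmod D)\<^sup>2 - Im (cnj (v x) * D)) \<le> mag_density b v v1 v2 x - \<mu> * (cmod (v x))\<^sup>2"
proof -
  have t0: "0 \<le> t" by (simp add: t_def)
  have tt: "t = (fst x)\<^sup>2 + (snd x)\<^sup>2" by (simp add: t_def norm_power2_prod)
  have split: "t * ((cmod (v1 x))\<^sup>2 + (cmod (v2 x))\<^sup>2) = (cmod E)\<^sup>2 + (cmod D)\<^sup>2"
    unfolding tt cmod_power2 E_def D_def by (simp add: power2_eq_square algebra_simps)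
  have m: "mag_density b v v1 v2 x = (cmod (v1 x))\<^sup>2 + (cmod (v2 x))\<^sup>2 + b\<^sup>2 * t / 4 * (cmod (v x))\<^sup>2 - b * Im (cnj (v x) * D)"
    unfolding mag_density_expand t_def D_def ..
  have r: "(2 * q + 2 * t * q1) * (cmod (v x))\<^sup>2 \<le> (b\<^sup>2 * t / 4 - \<mu>) * (cmod (v x))\<^sup>2 - t * q\<^sup>2 * (cmod (v x))\<^sup>2"
    using mult_right_mono[OF ric, of "(cmod (v x))\<^sup>2"] by (simp add: algebra_simps)
  have s: "2 * q * Re (cnj (v x) * E) + b * (cmod D)\<^sup>2 \<le> (cmod (v1 x))\<^sup>2 + (cmod (v2 x))\<^sup>2 + t * q\<^sup>2 * (cmod (v x))\<^sup>2"
  proof (cases "t = 0")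
    case True
    then have "fst x = 0" "snd x = 0" by (auto simp: tt add_nonneg_eq_0_iff)
    then show ?thesis using True by (simp add: E_def D_def)
  next
    case False
    then have t: "0 < t" using t0 by simp
    have "0 \<le> (cmod (E - of_real (t * q) * v x))\<^sup>2" by simp
    also have "\<dots> = (cmod E)\<^sup>2 - 2 * (t * q) * Re (cnj (v x) * E) + (t * q)\<^sup>2 * (cmod (v x))\<^sup>2"
      unfolding cmod_power2 by (simp add: power2_eq_square algebra_simps)
    finally have "t * (2 * q * Re (cnj (v x) * E)) \<le> (cmod E)\<^sup>2 + t * (t * q\<^sup>2 * (cmod (v x))\<^sup>2)"
      by (simp add: power2_eq_square algebra_simps)
    moreover have "t * (b * (cmod D)\<^sup>2) \<le> (cmod D)\<^sup>2"
      using mult_right_mono[OF bt, of "(cmod D)\<^sup>2"] by (simp add: algebra_simps)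
    ultimately have "t * (2 * q * Re (cnj (v x) * E) + b * (cmod D)\<^sup>2) \<le> (cmod E)\<^sup>2 + (cmod D)\<^sup>2 + t * (t * q\<^sup>2 * (cmod (v x))\<^sup>2)"
      by (simp add: algebra_simps)
    also have "\<dots> = t * ((cmod (v1 x))\<^sup>2 + (cmod (v2 x))\<^sup>2 + t * q\<^sup>2 * (cmod (v x))\<^sup>2)"
      using split by (simp add: algebra_simps)
    finally show ?thesis using t by (simp only: mult_le_cancel_left_pos)
  qed
  show ?thesis using r s unfolding m by (simp add: algebra_simps)
qed

text \<open>The pointwise bound, multiplied by \<open>k\<close> and integrated. The divergence of k
  q |v|^2 x integrates to 0, and the angular term is nonnegative on average over circles.\<close>

lemma C1_weighted_lower_bound:
  fixes v v1 v2 :: "real \<times> real \<Rightarrow> complex" and k k' q q1 :: "real \<Rightarrow> real"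
  assumes v: "C1_grad v v1 v2"
    and k: "\<And>t. (k has_real_derivative k' t) (at t)" "continuous_on UNIV k'" "\<And>t. 0 \<le> k t" "\<And>t. k' t \<le> 0"
      "\<And>t. T \<le> t \<Longrightarrow> k t = 0" "\<And>t. T \<le> t \<Longrightarrow> k' t = 0"
    and T: "T < S" "0 < S" and b: "0 \<le> b" "b * S \<le> 1"
    and q: "\<And>t. \<bar>t\<bar> < S \<Longrightarrow> (q has_real_derivative q1 t) (at t)" "\<And>t. \<bar>t\<bar> < S \<Longrightarrow> isCont q1 t"
    and ric: "\<And>t. 0 \<le> t \<Longrightarrow> t < S \<Longrightarrow> 2 * q t + 2 * t * q1 t + t * (q t)\<^sup>2 \<le> b\<^sup>2 * t / 4 - \<mu>"
    and sgn: "\<And>t. 0 \<le> t \<Longrightarrow> t < S \<Longrightarrow> k' t \<noteq> 0 \<Longrightarrow> 0 \<le> q t"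
  shows "0 \<le> (\<integral>x. k ((norm x)\<^sup>2) * (mag_density b v v1 v2 x - \<mu> * (cmod (v x))\<^sup>2) \<partial>lborel)"
proof -
  define K where "K = (\<lambda>t. if t < S then k t * q t else 0)"
  define K1 where "K1 = (\<lambda>t. if t < S then k' t * q t + k t * q1 t else 0)"
  have "(K has_real_derivative K1 t) (at t) \<and> isCont K1 t" if "0 \<le> t" for t
    unfolding K_def K1_def
    using cutoff_extension[where k=k and k'=k' and T=T and S=S and q=q and ?q1.0=q1, OF _ _ _ _ T _ _ that]
      k(1,2,5,6) q by blast
  then have ext: "\<And>t. 0 \<le> t \<Longrightarrow> (K has_real_derivative K1 t) (at t)" "\<And>t. 0 \<le> t \<Longrightarrow> isCont K1 t"
    by auto
  have Kg: "C1_grad (\<lambda>x. K ((norm x)\<^sup>2)) (\<lambda>x. 2 * fst x * K1 ((norm x)\<^sup>2)) (\<lambda>x. 2 * snd x * K1 ((norm x)\<^sup>2))"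
    using C1_grad_quadratic[of K K1 1 1, OF ext] by (simp add: norm_power2_prod)
  note g = C1_grad_mult[OF C1_grad_mult[OF C1_grad_fst Kg] C1_grad_cmod_power2[OF v]]
    and h = C1_grad_mult[OF C1_grad_mult[OF C1_grad_snd Kg] C1_grad_cmod_power2[OF v]]
  define M where "M = sqrt \<bar>T\<bar>"
  have far: "T \<le> (norm x)\<^sup>2" if "M < norm x" for x :: "real \<times> real"
  proof -
    have "M\<^sup>2 < (norm x)\<^sup>2" using that by (intro power_strict_mono) (auto simp: M_def)
    then show ?thesis by (simp add: M_def)
  qed
  have K0: "K ((norm x)\<^sup>2) = 0" if "M < norm x" for x :: "real \<times> real"
    using far[OF that] k(5) by (simp add: K_def)
  define D where "D = (\<lambda>x. fst x *\<^sub>R v2 x - snd x *\<^sub>R v1 x)"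
  define E where "E = (\<lambda>x. fst x *\<^sub>R v1 x + snd x *\<^sub>R v2 x)"
  \<comment> \<open>The two summands of the divergence of K(|x|^2) |v|^2 x, each an exact partial
    derivative with compact support.\<close>
  define d1 where "d1 = (\<lambda>x. fst x * K ((norm x)\<^sup>2) * (2 * Re (cnj (v x) * v1 x)) +
     (fst x * (2 * fst x * K1 ((norm x)\<^sup>2)) + 1 * K ((norm x)\<^sup>2)) * (cmod (v x))\<^sup>2)"
  define d2 where "d2 = (\<lambda>x. snd x * K ((norm x)\<^sup>2) * (2 * Re (cnj (v x) * v2 x)) +
     (snd x * (2 * snd x * K1 ((norm x)\<^sup>2)) + 1 * K ((norm x)\<^sup>2)) * (cmod (v x))\<^sup>2)"
  have i1: "integrable lborel d1" "integral\<^sup>L lborel d1 = 0"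
    using integral_partial_derivative_eq_0(1,3)[OF g, of M] K0 unfolding d1_def by auto
  have i2: "integrable lborel d2" "integral\<^sup>L lborel d2 = 0"
    using integral_partial_derivative_eq_0(2,4)[OF h, of M] K0 unfolding d2_def by auto
  have kc: "continuous_on UNIV k" using DERIV_isCont[OF k(1)] by (intro continuous_at_imp_continuous_on) auto
  have kc': "continuous_on UNIV (\<lambda>x::real\<times>real. k ((norm x)\<^sup>2))"
    by (intro continuous_on_compose2[OF kc] continuous_intros) auto
  define A where "A = (\<lambda>x. k ((norm x)\<^sup>2) * ((cmod (D x))\<^sup>2 - Im (cnj (v x) * D x)))"
  have iA: "integrable lborel A"
    by (rule integrable_continuous_compact_support[of _ M])
      (use far k(5) in \<open>auto simp: A_def D_def intro!: continuous_intros kc' C1_gradD[OF v]\<close>)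
  have A0: "0 \<le> integral\<^sup>L lborel A"
    unfolding A_def D_def by (rule radial_weight_angular_inequality[OF v kc k(3,5)])
  have "continuous_on UNIV (mag_density b v v1 v2)"
    unfolding mag_density_def[abs_def] by (intro continuous_intros C1_gradD[OF v])
  then have iL: "integrable lborel (\<lambda>x. k ((norm x)\<^sup>2) * (mag_density b v v1 v2 x - \<mu> * (cmod (v x))\<^sup>2))"
    using far k(5) by (intro integrable_continuous_compact_support[of _ M])
      (auto intro!: continuous_intros kc' C1_gradD[OF v])
  have "0 \<le> integral\<^sup>L lborel d1 + integral\<^sup>L lborel d2 + b * integral\<^sup>L lborel A"
    using A0 b i1 i2 by simp
  also have "\<dots> = (\<integral>x. d1 x + d2 x + b * A x \<partial>lborel)"
    using i1 i2 iA by simp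
  also have "\<dots> \<le> (\<integral>x. k ((norm x)\<^sup>2) * (mag_density b v v1 v2 x - \<mu> * (cmod (v x))\<^sup>2) \<partial>lborel)"
  proof (rule integral_mono)
    fix x :: "real \<times> real"
    define t where "t = (norm x)\<^sup>2"
    have t0: "0 \<le> t" by (simp add: t_def)
    have tt: "t = (fst x)\<^sup>2 + (snd x)\<^sup>2" by (simp add: t_def norm_power2_prod)
    have sum: "d1 x + d2 x = (2 * K t + 2 * t * K1 t) * (cmod (v x))\<^sup>2 + 2 * K t * Re (cnj (v x) * E x)"
      unfolding d1_def d2_def t_def[symmetric] E_def
      unfolding tt by (simp add: power2_eq_square algebra_simps)
    show "d1 x + d2 x + b * A x \<le> k ((norm x)\<^sup>2) * (mag_density b v v1 v2 x - \<mu> * (cmod (v x))\<^sup>2)"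
    proof (cases "t < S")
      case False
      then have "k t = 0" using k(5)[of t] T by simp
      moreover have "K t = 0" "K1 t = 0" using False by (auto simp: K_def K1_def)
      ultimately show ?thesis unfolding sum A_def t_def[symmetric] by simp
    next
      case True
      have "b * t \<le> b * S" using True b by (intro mult_left_mono) auto
      then have bt: "b * t \<le> 1" using b by simp
      have "k t * ((2 * q t + 2 * t * q1 t) * (cmod (v x))\<^sup>2 + 2 * q t * Re (cnj (v x) * E x)
         + b * ((cmod (D x))\<^sup>2 - Im (cnj (v x) * D x))) \<le> k t * (mag_density b v v1 v2 x - \<mu> * (cmod (v x))\<^sup>2)"
        using mag_density_pointwise_bound[where b=b and x=x and q="q t" and ?q1.0="q1 t" and \<mu>=\<mu> and v=v and ?v1.0=v1 and ?v2.0=v2] bt ric[OF t0 True] k(3)[of t]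
        unfolding t_def[symmetric] D_def E_def by (intro mult_left_mono) auto
      moreover have "2 * t * (k' t * q t) * (cmod (v x))\<^sup>2 \<le> 0"
      proof -
        have "k' t * q t \<le> 0" using sgn[OF t0 True] k(4)[of t] by (cases "k' t = 0") (auto simp: mult_nonpos_nonneg)
        then show ?thesis using t0 by (simp add: mult_nonneg_nonpos mult_nonpos_nonneg)
      qed
      ultimately show ?thesis unfolding sum A_def t_def[symmetric] using True
        by (simp add: K_def K1_def algebra_simps)
    qed
  qed (use i1 i2 iA iL in auto)
  finally show ?thesis .
qed

text \<open>Extending u by zero may create a jump on the circle, but the mollified function sees it
  only within \<epsilon> of the circle. On the smaller disk the kernel centred at x is an admissible
  test function, so there the gradient of the mollification is the mollification of the weak
  gradient.\<close>

lemma H1_mollify: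
  assumes H: "H1_grad (ball 0 \<rho>) u g1 g2" and r: "r < \<rho>" and e: "0 < e"
  obtains v v1 v2 where "C1_grad v v1 v2"
    "(\<integral>\<^sup>+x. indicator (cball 0 r) x * ennreal ((cmod (v x - u x))\<^sup>2) \<partial>lborel) \<le> ennreal e"
    "(\<integral>\<^sup>+x. indicator (cball 0 r) x * ennreal ((cmod (v1 x - g1 x))\<^sup>2) \<partial>lborel) \<le> ennreal e"
    "(\<integral>\<^sup>+x. indicator (cball 0 r) x * ennreal ((cmod (v2 x - g2 x))\<^sup>2) \<partial>lborel) \<le> ennreal e"
proof -
  define X where "X = (\<lambda>f x. indicator (ball (0::real\<times>real) \<rho>) x *\<^sub>R (f x :: complex))"
  have L2: "X f \<in> borel_measurable borel" "integrable lborel (\<lambda>x. (norm (X f x))\<^sup>2)" "\<And>x. \<rho> \<le> norm x \<Longrightarrow> X f x = 0"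
    if "L2_on (ball 0 \<rho>) f" for f
  proof -
    show "X f \<in> borel_measurable borel"
      using that unfolding L2_on_def set_borel_measurable_def X_def by simp
    have "(\<lambda>x. (norm (X f x))\<^sup>2) = (\<lambda>x. indicator (ball 0 \<rho>) x *\<^sub>R (cmod (f x))\<^sup>2)"
      by (auto simp: X_def indicator_def)
    then show "integrable lborel (\<lambda>x. (norm (X f x))\<^sup>2)"
      using that unfolding L2_on_def set_integrable_def by simp
  qed (auto simp: X_def)
  have LX: "L2_on (ball 0 \<rho>) u" "L2_on (ball 0 \<rho>) g1" "L2_on (ball 0 \<rho>) g2"
    using H unfolding H1_grad_def by auto
  obtain d0 where d0: "0 < d0" "\<And>\<epsilon>. 0 < \<epsilon> \<Longrightarrow> \<epsilon> < d0 \<Longrightarrow>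
    (\<integral>\<^sup>+x. ennreal ((norm (convolve (moll \<epsilon>) (X u) x - X u x))\<^sup>2) \<partial>lborel) \<le> ennreal e"
    using convolve_moll_L2_tendsto[OF L2[OF LX(1)] e] by blast
  obtain d1 where d1: "0 < d1" "\<And>\<epsilon>. 0 < \<epsilon> \<Longrightarrow> \<epsilon> < d1 \<Longrightarrow>
    (\<integral>\<^sup>+x. ennreal ((norm (convolve (moll \<epsilon>) (X g1) x - X g1 x))\<^sup>2) \<partial>lborel) \<le> ennreal e"
    using convolve_moll_L2_tendsto[OF L2[OF LX(2)] e] by blast
  obtain d2 where d2: "0 < d2" "\<And>\<epsilon>. 0 < \<epsilon> \<Longrightarrow> \<epsilon> < d2 \<Longrightarrow>
    (\<integral>\<^sup>+x. ennreal ((norm (convolve (moll \<epsilon>) (X g2) x - X g2 x))\<^sup>2) \<partial>lborel) \<le> ennreal e"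
    using convolve_moll_L2_tendsto[OF L2[OF LX(3)] e] by blast
  \<comment> \<open>One \<epsilon> has to serve all three convergences and keep the supports of the
    kernels inside the disk; halving makes the inequalities strict.\<close>
  define \<epsilon> where "\<epsilon> = min (min d0 d1) (min d2 (\<rho> - r)) / 2"
  have \<epsilon>: "0 < \<epsilon>" "\<epsilon> < d0" "\<epsilon> < d1" "\<epsilon> < d2" "r + \<epsilon> < \<rho>"
    using d0(1) d1(1) d2(1) r unfolding \<epsilon>_def by (auto simp: min_def field_simps)
  have iX: "integrable lborel (X u)"
    by (rule integrable_of_L2_bounded_support[OF L2[OF LX(1)]])
  define c where "c = (\<integral>x. bump \<epsilon> (x::real\<times>real) \<partial>lborel)"
  have c: "0 < c" unfolding c_def using \<epsilon> by (intro integral_bump_pos)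
  define v where "v = (\<lambda>x. convolve (bump \<epsilon>) (X u) x /\<^sub>R c)"
  define w where "w = (\<lambda>e x. convolve (\<lambda>z. bump_grad \<epsilon> z \<bullet> e) (X u) x /\<^sub>R c)"
  have conv_moll: "convolve (moll \<epsilon>) f x = convolve (bump \<epsilon>) f x /\<^sub>R c" for f and x :: "real \<times> real"
  proof -
    have "convolve (moll \<epsilon>) f x = (\<integral>y. inverse c *\<^sub>R (bump \<epsilon> (x - y) *\<^sub>R f y) \<partial>lborel)"
      unfolding convolve_def moll_def c_def by (simp add: divide_inverse mult.commute)
    also have "\<dots> = inverse c *\<^sub>R (\<integral>y. bump \<epsilon> (x - y) *\<^sub>R f y \<partial>lborel)"
      by (rule integral_scaleR_right)
    finally show ?thesis unfolding convolve_def .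
  qed
  have Cv: "C1_grad v (w (1,0)) (w (0,1))"
    unfolding C1_grad_def
  proof (intro conjI allI)
    fix x
    have d: "(convolve (bump \<epsilon>) (X u) has_derivative (\<lambda>h. convolve (\<lambda>z. bump_grad \<epsilon> z \<bullet> h) (X u) x)) (at x)"
      using has_derivative_convolve_bump[OF iX] \<epsilon> by simp
    then have lin: "linear (\<lambda>h. convolve (\<lambda>z. bump_grad \<epsilon> z \<bullet> h) (X u) x)"
      by (rule has_derivative_linear)
    have eq: "convolve (\<lambda>z. bump_grad \<epsilon> z \<bullet> h) (X u) x /\<^sub>R c = fst h *\<^sub>R w (1,0) x + snd h *\<^sub>R w (0,1) x" for h
    proof -
      have "h = fst h *\<^sub>R (1,0) + snd h *\<^sub>R (0,1)" by (cases h) simp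
      then have "convolve (\<lambda>z. bump_grad \<epsilon> z \<bullet> h) (X u) x =
         fst h *\<^sub>R convolve (\<lambda>z. bump_grad \<epsilon> z \<bullet> (1,0)) (X u) x + snd h *\<^sub>R convolve (\<lambda>z. bump_grad \<epsilon> z \<bullet> (0,1)) (X u) x"
        using linear_add[OF lin] linear_scale[OF lin] by metis
      then show ?thesis unfolding w_def by (simp add: scaleR_right_distrib mult.commute)
    qed
    show "(v has_derivative (\<lambda>h. fst h *\<^sub>R w (1,0) x + snd h *\<^sub>R w (0,1) x)) (at x)"
      unfolding v_def eq[symmetric] using has_derivative_scaleR_right[OF d] .
  next
    show "continuous_on UNIV (w (1,0))" "continuous_on UNIV (w (0,1))"
      unfolding w_def using continuous_on_convolve_bump_grad[OF iX, of \<epsilon>] \<epsilon>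
      by (auto intro!: continuous_intros)
  qed
  have weak: "w (1,0) x = convolve (moll \<epsilon>) (X g1) x" "w (0,1) x = convolve (moll \<epsilon>) (X g2) x"
    if x: "x \<in> cball 0 r" for x
  proof -
    \<comment> \<open>The kernel as a function of the integration variable y. Its y-derivative
      carries a minus sign, which cancels the one in the definition of the weak derivative.\<close>
    define phi where "phi = (\<lambda>y. bump \<epsilon> (x - y))"
    define dphi where "dphi = (\<lambda>y h. - (bump_grad \<epsilon> (x - y) \<bullet> h))"
    have "test_fun (ball 0 \<rho>) phi dphi"
      unfolding test_fun_def
    proof (intro conjI allI exI[of _ "cball x \<epsilon>"] impI)
      fix y
      have "((\<lambda>y. x - y) has_derivative (\<lambda>h. - h)) (at y)" by (auto intro!: derivative_eq_intros)
      from has_derivative_compose[OF this has_derivative_bump]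
      show "(phi has_derivative dphi y) (at y)" unfolding phi_def dphi_def by simp
    next
      show "continuous_on UNIV (\<lambda>x. dphi x (1, 0))" "continuous_on UNIV (\<lambda>x. dphi x (0, 1))"
        unfolding dphi_def by (intro continuous_intros)+
      show "cball x \<epsilon> \<subseteq> ball 0 \<rho>"
      proof
        fix y assume "y \<in> cball x \<epsilon>"
        then have "norm y \<le> norm x + \<epsilon>" using norm_triangle_ineq2[of y x] by (simp add: dist_norm norm_minus_commute)
        then show "y \<in> ball 0 \<rho>" using x \<epsilon> by simp
      qed
      fix y assume "y \<notin> cball x \<epsilon>"
      then show "phi y = 0" unfolding phi_def using \<epsilon> by (intro bump_eq_0) (auto simp: dist_norm)
    qed simp
    then have 1: "(LINT x:ball 0 \<rho>|lborel. u x * complex_of_real (dphi x (1, 0)))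
          = - (LINT x:ball 0 \<rho>|lborel. g1 x * complex_of_real (phi x))"
      and 2: "(LINT x:ball 0 \<rho>|lborel. u x * complex_of_real (dphi x (0, 1)))
          = - (LINT x:ball 0 \<rho>|lborel. g2 x * complex_of_real (phi x))"
      using H unfolding H1_grad_def by blast+
    have a: "(LINT x:ball 0 \<rho>|lborel. f x * complex_of_real (phi x)) = convolve (bump \<epsilon>) (X f) x" for f
      unfolding set_lebesgue_integral_def convolve_def phi_def X_def
      by (intro Bochner_Integration.integral_cong) (auto simp: scaleR_conv_of_real)
    have d: "(LINT x:ball 0 \<rho>|lborel. u x * complex_of_real (dphi x e)) = - convolve (\<lambda>z. bump_grad \<epsilon> z \<bullet> e) (X u) x" for e
      unfolding set_lebesgue_integral_def convolve_def dphi_def X_def Bochner_Integration.integral_minus[symmetric]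
      by (intro Bochner_Integration.integral_cong) (auto simp: scaleR_conv_of_real)
    show "w (1,0) x = convolve (moll \<epsilon>) (X g1) x" "w (0,1) x = convolve (moll \<epsilon>) (X g2) x"
      using 1 2 unfolding a d conv_moll w_def by auto
  qed
  have Xin: "X f x = f x" if "x \<in> cball 0 r" for f x
    using that r by (auto simp: X_def indicator_def)
  have v_eq: "v x = convolve (moll \<epsilon>) (X u) x" for x by (simp add: v_def conv_moll)
  show thesis
  proof (rule that[OF Cv])
    show "(\<integral>\<^sup>+x. indicator (cball 0 r) x * ennreal ((cmod (v x - u x))\<^sup>2) \<partial>lborel) \<le> ennreal e"
      by (rule order_trans[OF nn_integral_mono d0(2)[OF \<epsilon>(1,2)]]) (auto simp: indicator_def v_eq Xin)
    show "(\<integral>\<^sup>+x. indicator (cball 0 r) x * ennreal ((cmod (w (1,0) x - g1 x))\<^sup>2) \<partial>lborel) \<le> ennreal e"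
      by (rule order_trans[OF nn_integral_mono d1(2)[OF \<epsilon>(1,3)]]) (auto simp: indicator_def weak Xin)
    show "(\<integral>\<^sup>+x. indicator (cball 0 r) x * ennreal ((cmod (w (0,1) x - g2 x))\<^sup>2) \<partial>lborel) \<le> ennreal e"
      by (rule order_trans[OF nn_integral_mono d2(2)[OF \<epsilon>(1,4)]]) (auto simp: indicator_def weak Xin)
  qed
qed

text \<open>From ||a|^2 - |f|^2| \<le> |a - f|^2 + 2 |f| |a - f|, with the product split by Young's
  inequality with parameter \<eta>. The second error is relative to the norm of f, so both vanish
  when C tends to 0 fast enough compared with \<eta>.\<close>

lemma weighted_L2_perturbation:
  fixes \<omega> :: "'a \<Rightarrow> real" and a f :: "'a \<Rightarrow> complex"
  assumes i: "integrable M (\<lambda>x. \<omega> x * (cmod (f x))\<^sup>2)" "integrable M (\<lambda>x. \<omega> x * (cmod (a x))\<^sup>2)"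
      "integrable M (\<lambda>x. \<omega> x * (cmod (a x - f x))\<^sup>2)"
    and \<omega>: "\<And>x. 0 \<le> \<omega> x" and le: "(\<integral>x. \<omega> x * (cmod (a x - f x))\<^sup>2 \<partial>M) \<le> C" and \<eta>: "0 < \<eta>"
  shows "\<bar>(\<integral>x. \<omega> x * (cmod (a x))\<^sup>2 \<partial>M) - (\<integral>x. \<omega> x * (cmod (f x))\<^sup>2 \<partial>M)\<bar>
    \<le> (1 + 1 / \<eta>) * C + \<eta> * (\<integral>x. \<omega> x * (cmod (f x))\<^sup>2 \<partial>M)"
proof -
  have pt: "\<bar>\<omega> x * (cmod (a x))\<^sup>2 - \<omega> x * (cmod (f x))\<^sup>2\<bar> \<le>
      (1 + 1 / \<eta>) * (\<omega> x * (cmod (a x - f x))\<^sup>2) + \<eta> * (\<omega> x * (cmod (f x))\<^sup>2)" for x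
  proof -
    let ?A = "cmod (a x)" and ?F = "cmod (f x)" and ?D = "cmod (a x - f x)"
    have d: "\<bar>?A - ?F\<bar> \<le> ?D" by (rule norm_triangle_ineq3)
    have "?A\<^sup>2 - ?F\<^sup>2 = (?A - ?F)\<^sup>2 + 2 * ?F * (?A - ?F)" by (simp add: power2_eq_square algebra_simps)
    then have "\<bar>?A\<^sup>2 - ?F\<^sup>2\<bar> \<le> (?A - ?F)\<^sup>2 + \<bar>2 * ?F * (?A - ?F)\<bar>"
      using abs_triangle_ineq[of "(?A - ?F)\<^sup>2" "2 * ?F * (?A - ?F)"] by simp
    also have "(?A - ?F)\<^sup>2 \<le> ?D\<^sup>2" using d by (simp add: power2_le_iff_abs_le)
    also have "\<bar>2 * ?F * (?A - ?F)\<bar> \<le> 2 * ?F * ?D"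
      using d by (simp add: abs_mult mult_left_mono)
    also have "2 * ?F * ?D \<le> ?D\<^sup>2 / \<eta> + \<eta> * ?F\<^sup>2"
    proof -
      have "0 \<le> (?D - \<eta> * ?F)\<^sup>2 / \<eta>" using \<eta> by simp
      also have "\<dots> = ?D\<^sup>2 / \<eta> + \<eta> * ?F\<^sup>2 - 2 * ?F * ?D"
        using \<eta> by (simp add: field_simps power2_eq_square)
      finally show ?thesis by simp
    qed
    finally have "\<bar>?A\<^sup>2 - ?F\<^sup>2\<bar> \<le> (1 + 1 / \<eta>) * ?D\<^sup>2 + \<eta> * ?F\<^sup>2" by (simp add: algebra_simps)
    then have "\<omega> x * \<bar>?A\<^sup>2 - ?F\<^sup>2\<bar> \<le> \<omega> x * ((1 + 1 / \<eta>) * ?D\<^sup>2 + \<eta> * ?F\<^sup>2)"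
      using \<omega> by (rule mult_left_mono)
    moreover have "\<bar>\<omega> x * ?A\<^sup>2 - \<omega> x * ?F\<^sup>2\<bar> = \<omega> x * \<bar>?A\<^sup>2 - ?F\<^sup>2\<bar>"
      unfolding right_diff_distrib[symmetric] abs_mult using \<omega>[of x] by simp
    ultimately show ?thesis by (simp only: distrib_left mult.left_commute)
  qed
  have "\<bar>(\<integral>x. \<omega> x * (cmod (a x))\<^sup>2 \<partial>M) - (\<integral>x. \<omega> x * (cmod (f x))\<^sup>2 \<partial>M)\<bar>
     = \<bar>\<integral>x. \<omega> x * (cmod (a x))\<^sup>2 - \<omega> x * (cmod (f x))\<^sup>2 \<partial>M\<bar>"
    using i by simp
  also have "\<dots> \<le> (\<integral>x. \<bar>\<omega> x * (cmod (a x))\<^sup>2 - \<omega> x * (cmod (f x))\<^sup>2\<bar> \<partial>M)" by (rule integral_abs_bound)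
  also have "\<dots> \<le> (\<integral>x. (1 + 1 / \<eta>) * (\<omega> x * (cmod (a x - f x))\<^sup>2) + \<eta> * (\<omega> x * (cmod (f x))\<^sup>2) \<partial>M)"
    using i by (intro integral_mono pt) auto
  also have "\<dots> = (1 + 1 / \<eta>) * (\<integral>x. \<omega> x * (cmod (a x - f x))\<^sup>2 \<partial>M) + \<eta> * (\<integral>x. \<omega> x * (cmod (f x))\<^sup>2 \<partial>M)"
    using i by simp
  also have "\<dots> \<le> (1 + 1 / \<eta>) * C + \<eta> * (\<integral>x. \<omega> x * (cmod (f x))\<^sup>2 \<partial>M)"
    using le \<eta> by (intro add_right_mono mult_left_mono) auto
  finally show ?thesis .
qed

lemma nn_weighted_bound:
  fixes f :: "'a::euclidean_space \<Rightarrow> complex"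
  assumes m: "(\<lambda>x. \<omega> x * (cmod (f x))\<^sup>2) \<in> borel_measurable lborel" and \<omega>: "\<And>x. 0 \<le> \<omega> x" "\<And>x. \<omega> x \<le> indicator A x"
    and le: "(\<integral>\<^sup>+x. indicator A x * ennreal ((cmod (f x))\<^sup>2) \<partial>lborel) \<le> ennreal e" and e: "0 \<le> e"
  shows "integrable lborel (\<lambda>x. \<omega> x * (cmod (f x))\<^sup>2)" "(\<integral>x. \<omega> x * (cmod (f x))\<^sup>2 \<partial>lborel) \<le> e"
proof -
  have "(\<integral>\<^sup>+x. ennreal (\<omega> x * (cmod (f x))\<^sup>2) \<partial>lborel) \<le> (\<integral>\<^sup>+x. indicator A x * ennreal ((cmod (f x))\<^sup>2) \<partial>lborel)"
  proof (intro nn_integral_mono)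
    fix x
    have "ennreal (\<omega> x * (cmod (f x))\<^sup>2) \<le> ennreal (indicator A x * (cmod (f x))\<^sup>2)"
      by (intro ennreal_leI mult_right_mono \<omega>) auto
    then show "ennreal (\<omega> x * (cmod (f x))\<^sup>2) \<le> indicator A x * ennreal ((cmod (f x))\<^sup>2)"
      by (auto simp: indicator_def ennreal_neg)
  qed
  then have b: "(\<integral>\<^sup>+x. ennreal (\<omega> x * (cmod (f x))\<^sup>2) \<partial>lborel) \<le> ennreal e" using le by (rule order_trans)
  show i: "integrable lborel (\<lambda>x. \<omega> x * (cmod (f x))\<^sup>2)"
    using m b \<omega>(1) by (intro integrableI_nonneg) (auto intro: le_less_trans)
  show "(\<integral>x. \<omega> x * (cmod (f x))\<^sup>2 \<partial>lborel) \<le> e"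
    using b \<omega>(1) e by (subst integral_eq_nn_integral) (use m in \<open>auto intro!: enn2real_leI\<close>)
qed

text \<open>Limit passage from C^1 functions. The weight is supported in a disk of radius sqrt T <
  \<rho>, where u and its weak gradient are approximated in L^2; the magnetic derivatives depend
  linearly and boundedly on these data, so the weighted energies converge.\<close>

lemma H1_weighted_lower_bound:
  fixes k k' q q1 :: "real \<Rightarrow> real"
  assumes H: "H1_grad (ball 0 \<rho>) u g1 g2"
    and k: "\<And>t. (k has_real_derivative k' t) (at t)" "continuous_on UNIV k'" "\<And>t. 0 \<le> k t" "\<And>t. k t \<le> 1" "\<And>t. k' t \<le> 0"
      "\<And>t. T \<le> t \<Longrightarrow> k t = 0" "\<And>t. T \<le> t \<Longrightarrow> k' t = 0"
    and T: "0 \<le> T" "T < \<rho>\<^sup>2" "0 < \<rho>" and b: "0 \<le> b" "b * \<rho>\<^sup>2 \<le> 1"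
    and q: "\<And>t. \<bar>t\<bar> < \<rho>\<^sup>2 \<Longrightarrow> (q has_real_derivative q1 t) (at t)" "\<And>t. \<bar>t\<bar> < \<rho>\<^sup>2 \<Longrightarrow> isCont q1 t"
    and ric: "\<And>t. 0 \<le> t \<Longrightarrow> t < \<rho>\<^sup>2 \<Longrightarrow> 2 * q t + 2 * t * q1 t + t * (q t)\<^sup>2 \<le> b\<^sup>2 * t / 4 - \<mu>"
    and sgn: "\<And>t. 0 \<le> t \<Longrightarrow> t < \<rho>\<^sup>2 \<Longrightarrow> k' t \<noteq> 0 \<Longrightarrow> 0 \<le> q t"
  shows "0 \<le> (\<integral>x. k ((norm x)\<^sup>2) * (mag_density b u g1 g2 x - \<mu> * (cmod (u x))\<^sup>2) \<partial>lborel)"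
proof -
  define r where "r = sqrt T"
  have r: "0 \<le> r" "r < \<rho>" using T by (auto simp: r_def real_less_lsqrt)
  define \<omega> where "\<omega> = (\<lambda>x::real\<times>real. k ((norm x)\<^sup>2))"
  have kc: "continuous_on UNIV k" using DERIV_isCont[OF k(1)] by (intro continuous_at_imp_continuous_on) auto
  have \<omega>c: "continuous_on UNIV \<omega>" unfolding \<omega>_def
    by (intro continuous_on_compose2[OF kc] continuous_intros) auto
  have [measurable]: "\<omega> \<in> borel_measurable borel" using \<omega>c by (rule borel_measurable_continuous_onI)
  have \<omega>0: "0 \<le> \<omega> x" for x by (simp add: \<omega>_def k)
  have \<omega>z: "\<omega> x = 0" if "x \<notin> cball 0 r" for x
  proof -
    have "r\<^sup>2 < (norm x)\<^sup>2" using that r by (intro power_strict_mono) auto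
    then show ?thesis using T by (simp add: \<omega>_def k r_def)
  qed
  have \<omega>1: "\<omega> x \<le> indicator (cball 0 r) x" for x
    using \<omega>z[of x] k(4) by (auto simp: \<omega>_def indicator_def)
  define U where "U = ball (0::real\<times>real) \<rho>"
  \<comment> \<open>Nothing is assumed about u outside the disk; replacing it by 0 there makes it
    measurable on the whole plane without changing the weighted integrals.\<close>
  define X where "X = (\<lambda>f x. indicator U x *\<^sub>R (f x :: complex))"
  have LX: "L2_on U u" "L2_on U g1" "L2_on U g2"
    using H unfolding H1_grad_def U_def by auto
  have Xm: "X f \<in> borel_measurable borel" if "L2_on U f" for f
    using that unfolding L2_on_def set_borel_measurable_def X_def by simp
  note [measurable] = Xm[OF LX(1)] Xm[OF LX(2)] Xm[OF LX(3)]
  have iX: "integrable lborel (\<lambda>x. (cmod (X f x))\<^sup>2)" if "L2_on U f" for f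
  proof -
    have "(\<lambda>x. (cmod (X f x))\<^sup>2) = (\<lambda>x. indicator U x *\<^sub>R (cmod (f x))\<^sup>2)"
      by (auto simp: X_def indicator_def)
    then show ?thesis using that unfolding L2_on_def set_integrable_def by simp
  qed
  define p1 where "p1 = (\<lambda>(x::real\<times>real) (w::complex) (g::complex). - \<i> * g - complex_of_real (b / 2 * (- snd x)) * w)"
  define p2 where "p2 = (\<lambda>(x::real\<times>real) (w::complex) (g::complex). - \<i> * g - complex_of_real (b / 2 * fst x) * w)"
  \<comment> \<open>The 2 comes from (x + y)^2 \<le> 2 x^2 + 2 y^2, and (b \<rho>)^2 / 2 is twice
    the square of the bound b \<rho> / 2 for each component of the potential.\<close>
  define B where "B = 2 + (b * \<rho>)\<^sup>2 / 2"
  have B: "2 \<le> B" by (simp add: B_def)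
  have p_le: "(cmod (p1 x w g))\<^sup>2 \<le> B * ((cmod g)\<^sup>2 + (cmod w)\<^sup>2)" "(cmod (p2 x w g))\<^sup>2 \<le> B * ((cmod g)\<^sup>2 + (cmod w)\<^sup>2)"
    if x: "x \<in> U" for x w g
  proof -
    have gen: "(cmod (- \<i> * g - complex_of_real a * w))\<^sup>2 \<le> B * ((cmod g)\<^sup>2 + (cmod w)\<^sup>2)" if a: "\<bar>a\<bar> \<le> b / 2 * \<rho>" for a
    proof -
      have "cmod (- \<i> * g - complex_of_real a * w) \<le> cmod g + \<bar>a\<bar> * cmod w"
        using norm_triangle_ineq4[of "- \<i> * g" "complex_of_real a * w"] by (simp add: norm_mult)
      then have "(cmod (- \<i> * g - complex_of_real a * w))\<^sup>2 \<le> (cmod g + \<bar>a\<bar> * cmod w)\<^sup>2"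
        by (intro power_mono) auto
      also have "\<dots> \<le> 2 * (cmod g)\<^sup>2 + 2 * a\<^sup>2 * (cmod w)\<^sup>2"
        using sum_squares_bound[of "cmod g" "\<bar>a\<bar> * cmod w"] by (simp add: power2_sum power_mult_distrib)
      also have "\<dots> \<le> B * (cmod g)\<^sup>2 + B * (cmod w)\<^sup>2"
      proof (intro add_mono mult_right_mono)
        have "a\<^sup>2 \<le> (b / 2 * \<rho>)\<^sup>2" using a b T by (simp add: power2_le_iff_abs_le)
        then show "2 * a\<^sup>2 \<le> B" by (simp add: B_def power2_eq_square)
      qed (use B in auto)
      finally show ?thesis by (simp add: algebra_simps)
    qed
    have xx: "norm x < \<rho>" using x by (simp add: U_def)
    have "\<bar>fst x\<bar> \<le> \<rho>" "\<bar>snd x\<bar> \<le> \<rho>"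
      using norm_fst_le[of "fst x" "snd x"] norm_snd_le[of "snd x" "fst x"] xx by auto
    then have ab: "\<bar>b / 2 * (- snd x)\<bar> \<le> b / 2 * \<rho>" "\<bar>b / 2 * fst x\<bar> \<le> b / 2 * \<rho>"
      using b by (auto simp: abs_mult intro!: mult_left_mono)
    show "(cmod (p1 x w g))\<^sup>2 \<le> B * ((cmod g)\<^sup>2 + (cmod w)\<^sup>2)" "(cmod (p2 x w g))\<^sup>2 \<le> B * ((cmod g)\<^sup>2 + (cmod w)\<^sup>2)"
      unfolding p1_def p2_def by (rule gen[OF ab(1)], rule gen[OF ab(2)])
  qed
  have mag: "mag_density b w h1 h2 x = (cmod (p1 x (w x) (h1 x)))\<^sup>2 + (cmod (p2 x (w x) (h2 x)))\<^sup>2" for w h1 h2 x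
    unfolding mag_density_def p1_def p2_def ..
  have coord: "fst \<in> borel_measurable (borel :: (real\<times>real) measure)" "snd \<in> borel_measurable (borel :: (real\<times>real) measure)"
    by (intro borel_measurable_continuous_onI continuous_intros)+
  note [measurable] = coord
  have w1: "integrable lborel (\<lambda>x. \<omega> x * (cmod (X f x))\<^sup>2)" if "L2_on U f" for f
  proof (rule Bochner_Integration.integrable_bound[OF iX[OF that]])
    show "(\<lambda>x. \<omega> x * (cmod (X f x))\<^sup>2) \<in> borel_measurable lborel" using Xm[OF that] by measurable
    show "AE x in lborel. norm (\<omega> x * (cmod (X f x))\<^sup>2) \<le> norm ((cmod (X f x))\<^sup>2)"
      using \<omega>0 k(4) by (intro always_eventually allI) (auto simp: abs_mult \<omega>_def intro!: mult_left_le_one_le)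
  qed
  have wp: "integrable lborel (\<lambda>x. \<omega> x * (cmod (p x (X f x) (X g x)))\<^sup>2)"
    if p: "p = p1 \<or> p = p2" and f: "L2_on U f" and g: "L2_on U g" for p f g
  proof (rule Bochner_Integration.integrable_bound)
    show "integrable lborel (\<lambda>x. B * ((cmod (X g x))\<^sup>2 + (cmod (X f x))\<^sup>2))"
      using iX[OF f] iX[OF g] by auto
    note [measurable] = Xm[OF f] Xm[OF g]
    show "(\<lambda>x. \<omega> x * (cmod (p x (X f x) (X g x)))\<^sup>2) \<in> borel_measurable lborel"
      using p unfolding p1_def p2_def by (elim disjE; hypsubst; measurable)
    have "\<omega> x * (cmod (p x (X f x) (X g x)))\<^sup>2 \<le> B * ((cmod (X g x))\<^sup>2 + (cmod (X f x))\<^sup>2)" for x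
    proof (cases "x \<in> U")
      case True
      have "\<omega> x * (cmod (p x (X f x) (X g x)))\<^sup>2 \<le> 1 * (cmod (p x (X f x) (X g x)))\<^sup>2"
        using k(4) by (intro mult_right_mono) (auto simp: \<omega>_def)
      also have "\<dots> \<le> B * ((cmod (X g x))\<^sup>2 + (cmod (X f x))\<^sup>2)" using p p_le[OF True] by auto
      finally show ?thesis .
    next
      case False
      then have "\<omega> x = 0" using \<omega>z[of x] r by (auto simp: U_def)
      then show ?thesis using B by simp
    qed
    then show "AE x in lborel. norm (\<omega> x * (cmod (p x (X f x) (X g x)))\<^sup>2) \<le> norm (B * ((cmod (X g x))\<^sup>2 + (cmod (X f x))\<^sup>2))"
      using \<omega>0 B by (intro always_eventually allI) (auto simp: abs_mult)
  qed
  define N where "N = (\<integral>x. \<omega> x * (cmod (X u x))\<^sup>2 \<partial>lborel)"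
  define N1 where "N1 = (\<integral>x. \<omega> x * (cmod (p1 x (X u x) (X g1 x)))\<^sup>2 \<partial>lborel)"
  define N2 where "N2 = (\<integral>x. \<omega> x * (cmod (p2 x (X u x) (X g2 x)))\<^sup>2 \<partial>lborel)"
  have iN: "integrable lborel (\<lambda>x. \<omega> x * (cmod (X u x))\<^sup>2)" by (rule w1[OF LX(1)])
  have iN1: "integrable lborel (\<lambda>x. \<omega> x * (cmod (p1 x (X u x) (X g1 x)))\<^sup>2)" by (rule wp[OF _ LX(1,2)]) simp
  have iN2: "integrable lborel (\<lambda>x. \<omega> x * (cmod (p2 x (X u x) (X g2 x)))\<^sup>2)" by (rule wp[OF _ LX(1,3)]) simp
  have nn: "0 \<le> N" "0 \<le> N1" "0 \<le> N2"
    unfolding N_def N1_def N2_def by (auto intro!: Bochner_Integration.integral_nonneg mult_nonneg_nonneg \<omega>0)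
  \<comment> \<open>Each of the two magnetic derivatives contributes an error 2 B e and the mass
    term |\<mu>| e, all with the factor 1 + 1 / \<eta>.\<close>
  have approx: "- ((1 + 1 / \<eta>) * (4 * B + \<bar>\<mu>\<bar>) * e + \<eta> * (N1 + N2 + \<bar>\<mu>\<bar> * N)) \<le> N1 + N2 - \<mu> * N"
    if e: "0 < e" and \<eta>: "0 < \<eta>" for e \<eta>
  proof -
    obtain v v1 v2 where v: "C1_grad v v1 v2"
      and b0: "(\<integral>\<^sup>+x. indicator (cball 0 r) x * ennreal ((cmod (v x - u x))\<^sup>2) \<partial>lborel) \<le> ennreal e"
      and b1: "(\<integral>\<^sup>+x. indicator (cball 0 r) x * ennreal ((cmod (v1 x - g1 x))\<^sup>2) \<partial>lborel) \<le> ennreal e"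
      and b2: "(\<integral>\<^sup>+x. indicator (cball 0 r) x * ennreal ((cmod (v2 x - g2 x))\<^sup>2) \<partial>lborel) \<le> ennreal e"
      by (rule H1_mollify[OF H r(2) e])
    note vc = C1_gradD(2-4)[OF v]
    have vm [measurable]: "v \<in> borel_measurable borel" "v1 \<in> borel_measurable borel" "v2 \<in> borel_measurable borel"
      using vc by (auto intro: borel_measurable_continuous_onI)
    have X0: "(\<integral>\<^sup>+x. indicator (cball 0 r) x * ennreal ((cmod (w x - X f x))\<^sup>2) \<partial>lborel)
       = (\<integral>\<^sup>+x. indicator (cball 0 r) x * ennreal ((cmod (w x - f x))\<^sup>2) \<partial>lborel)" for w f
      using r by (intro nn_integral_cong) (auto simp: indicator_def X_def U_def)
    have d: "integrable lborel (\<lambda>x. \<omega> x * (cmod (w x - X f x))\<^sup>2)" "(\<integral>x. \<omega> x * (cmod (w x - X f x))\<^sup>2 \<partial>lborel) \<le> e"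
      if "w \<in> borel_measurable borel" "L2_on U f"
        "(\<integral>\<^sup>+x. indicator (cball 0 r) x * ennreal ((cmod (w x - f x))\<^sup>2) \<partial>lborel) \<le> ennreal e" for w f
    proof -
      note [measurable] = that(1) Xm[OF that(2)]
      have m: "(\<lambda>x. \<omega> x * (cmod (w x - X f x))\<^sup>2) \<in> borel_measurable lborel" by measurable
      show "integrable lborel (\<lambda>x. \<omega> x * (cmod (w x - X f x))\<^sup>2)" "(\<integral>x. \<omega> x * (cmod (w x - X f x))\<^sup>2 \<partial>lborel) \<le> e"
        using nn_weighted_bound[OF m \<omega>0 \<omega>1] that(3) e by (auto simp: X0)
    qed
    note du = d[OF vm(1) LX(1) b0] and dg1 = d[OF vm(2) LX(2) b1] and dg2 = d[OF vm(3) LX(3) b2]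
    have ic: "integrable lborel (\<lambda>x. \<omega> x * F x)" if "continuous_on UNIV F" for F :: "real \<times> real \<Rightarrow> real"
      by (rule integrable_continuous_compact_support[of _ r]) (use \<omega>z \<omega>c that in \<open>auto intro!: continuous_intros\<close>)
    have iv: "integrable lborel (\<lambda>x. \<omega> x * (cmod (v x))\<^sup>2)" by (intro ic continuous_intros vc)
    have iv1: "integrable lborel (\<lambda>x. \<omega> x * (cmod (p1 x (v x) (v1 x)))\<^sup>2)"
      unfolding p1_def by (intro ic continuous_intros vc)
    have iv2: "integrable lborel (\<lambda>x. \<omega> x * (cmod (p2 x (v x) (v2 x)))\<^sup>2)"
      unfolding p2_def by (intro ic continuous_intros vc)
    have dp: "integrable lborel (\<lambda>x. \<omega> x * (cmod (p x (v x) (w x) - p x (X u x) (X g x)))\<^sup>2)"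
      "(\<integral>x. \<omega> x * (cmod (p x (v x) (w x) - p x (X u x) (X g x)))\<^sup>2 \<partial>lborel) \<le> 2 * B * e"
      if p: "p = p1 \<or> p = p2" and w: "w \<in> borel_measurable borel" and g: "L2_on U g"
        and dg: "integrable lborel (\<lambda>x. \<omega> x * (cmod (w x - X g x))\<^sup>2)" "(\<integral>x. \<omega> x * (cmod (w x - X g x))\<^sup>2 \<partial>lborel) \<le> e"
      for p w g
    proof -
      have lin: "p x (v x) (w x) - p x (X u x) (X g x) = p x (v x - X u x) (w x - X g x)" for x
        using p unfolding p1_def p2_def by (auto simp: field_simps)
      have le: "\<omega> x * (cmod (p x (v x) (w x) - p x (X u x) (X g x)))\<^sup>2 \<le>
          B * (\<omega> x * (cmod (w x - X g x))\<^sup>2) + B * (\<omega> x * (cmod (v x - X u x))\<^sup>2)" for x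
      proof (cases "x \<in> U")
        case True
        have "(cmod (p x (v x - X u x) (w x - X g x)))\<^sup>2 \<le> B * ((cmod (w x - X g x))\<^sup>2 + (cmod (v x - X u x))\<^sup>2)"
          using p p_le[OF True] by auto
        from mult_left_mono[OF this \<omega>0[of x]] show ?thesis unfolding lin by (simp add: algebra_simps)
      next
        case False
        then have "\<omega> x = 0" using \<omega>z[of x] r by (auto simp: U_def)
        then show ?thesis by simp
      qed
      have iR: "integrable lborel (\<lambda>x. B * (\<omega> x * (cmod (w x - X g x))\<^sup>2) + B * (\<omega> x * (cmod (v x - X u x))\<^sup>2))"
        using dg du by auto
      note [measurable] = w Xm[OF g]
      show i: "integrable lborel (\<lambda>x. \<omega> x * (cmod (p x (v x) (w x) - p x (X u x) (X g x)))\<^sup>2)"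
      proof (rule Bochner_Integration.integrable_bound[OF iR])
        show "(\<lambda>x. \<omega> x * (cmod (p x (v x) (w x) - p x (X u x) (X g x)))\<^sup>2) \<in> borel_measurable lborel"
          using p unfolding p1_def p2_def by (elim disjE; hypsubst; measurable)
        show "AE x in lborel. norm (\<omega> x * (cmod (p x (v x) (w x) - p x (X u x) (X g x)))\<^sup>2) \<le>
           norm (B * (\<omega> x * (cmod (w x - X g x))\<^sup>2) + B * (\<omega> x * (cmod (v x - X u x))\<^sup>2))"
          using le \<omega>0 B by (intro always_eventually allI) (simp add: order_trans[OF _ abs_ge_self])
      qed
      have "(\<integral>x. \<omega> x * (cmod (p x (v x) (w x) - p x (X u x) (X g x)))\<^sup>2 \<partial>lborel)
         \<le> (\<integral>x. B * (\<omega> x * (cmod (w x - X g x))\<^sup>2) + B * (\<omega> x * (cmod (v x - X u x))\<^sup>2) \<partial>lborel)"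
        by (rule integral_mono[OF i iR le])
      also have "\<dots> = B * (\<integral>x. \<omega> x * (cmod (w x - X g x))\<^sup>2 \<partial>lborel) + B * (\<integral>x. \<omega> x * (cmod (v x - X u x))\<^sup>2 \<partial>lborel)"
        using dg du by simp
      also have "\<dots> \<le> B * e + B * e" using dg du B by (intro add_mono mult_left_mono) auto
      finally show "(\<integral>x. \<omega> x * (cmod (p x (v x) (w x) - p x (X u x) (X g x)))\<^sup>2 \<partial>lborel) \<le> 2 * B * e" by simp
    qed
    note dp1 = dp[OF disjI1[OF refl] vm(2) LX(2) dg1] and dp2 = dp[OF disjI2[OF refl] vm(3) LX(3) dg2]
    have c0: "\<bar>(\<integral>x. \<omega> x * (cmod (v x))\<^sup>2 \<partial>lborel) - N\<bar> \<le> (1 + 1 / \<eta>) * e + \<eta> * N"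
      unfolding N_def by (rule weighted_L2_perturbation[OF iN iv du(1) \<omega>0 du(2) \<eta>])
    have c1: "\<bar>(\<integral>x. \<omega> x * (cmod (p1 x (v x) (v1 x)))\<^sup>2 \<partial>lborel) - N1\<bar> \<le> (1 + 1 / \<eta>) * (2 * B * e) + \<eta> * N1"
      unfolding N1_def by (rule weighted_L2_perturbation[OF iN1 iv1 dp1(1) \<omega>0 dp1(2) \<eta>])
    have c2: "\<bar>(\<integral>x. \<omega> x * (cmod (p2 x (v x) (v2 x)))\<^sup>2 \<partial>lborel) - N2\<bar> \<le> (1 + 1 / \<eta>) * (2 * B * e) + \<eta> * N2"
      unfolding N2_def by (rule weighted_L2_perturbation[OF iN2 iv2 dp2(1) \<omega>0 dp2(2) \<eta>])
    have S: "0 < \<rho>\<^sup>2" using T by simp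
    have "0 \<le> (\<integral>x. k ((norm x)\<^sup>2) * (mag_density b v v1 v2 x - \<mu> * (cmod (v x))\<^sup>2) \<partial>lborel)"
      by (rule C1_weighted_lower_bound[where k'=k' and q=q and ?q1.0=q1, OF v k(1,2,3,5,6,7) T(2) S b q ric sgn]) auto
    also have "\<dots> = (\<integral>x. \<omega> x * (cmod (p1 x (v x) (v1 x)))\<^sup>2 + \<omega> x * (cmod (p2 x (v x) (v2 x)))\<^sup>2 - \<mu> * (\<omega> x * (cmod (v x))\<^sup>2) \<partial>lborel)"
      unfolding mag \<omega>_def by (simp add: algebra_simps)
    also have "\<dots> = (\<integral>x. \<omega> x * (cmod (p1 x (v x) (v1 x)))\<^sup>2 \<partial>lborel) + (\<integral>x. \<omega> x * (cmod (p2 x (v x) (v2 x)))\<^sup>2 \<partial>lborel)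
        - \<mu> * (\<integral>x. \<omega> x * (cmod (v x))\<^sup>2 \<partial>lborel)"
      using iv iv1 iv2 by simp
    finally have pos: "0 \<le> (\<integral>x. \<omega> x * (cmod (p1 x (v x) (v1 x)))\<^sup>2 \<partial>lborel) + (\<integral>x. \<omega> x * (cmod (p2 x (v x) (v2 x)))\<^sup>2 \<partial>lborel)
        - \<mu> * (\<integral>x. \<omega> x * (cmod (v x))\<^sup>2 \<partial>lborel)" .
    have c0': "\<bar>\<mu> * (\<integral>x. \<omega> x * (cmod (v x))\<^sup>2 \<partial>lborel) - \<mu> * N\<bar> \<le> \<bar>\<mu>\<bar> * ((1 + 1 / \<eta>) * e + \<eta> * N)"
      using mult_left_mono[OF c0, of "\<bar>\<mu>\<bar>"] by (simp add: abs_mult[symmetric] right_diff_distrib)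
    have split: "(1 + 1 / \<eta>) * (4 * B + \<bar>\<mu>\<bar>) * e + \<eta> * (N1 + N2 + \<bar>\<mu>\<bar> * N) =
       ((1 + 1 / \<eta>) * (2 * B * e) + \<eta> * N1) + ((1 + 1 / \<eta>) * (2 * B * e) + \<eta> * N2) + \<bar>\<mu>\<bar> * ((1 + 1 / \<eta>) * e + \<eta> * N)"
      by (simp add: algebra_simps)
    show ?thesis unfolding split using pos c0' c1 c2 by linarith
  qed
  have "0 \<le> N1 + N2 - \<mu> * N"
  proof (rule ccontr)
    assume neg: "\<not> ?thesis"
    define Z where "Z = N1 + N2 - \<mu> * N"
    define C where "C = 2 * (4 * B + \<bar>\<mu>\<bar>) + (N1 + N2 + \<bar>\<mu>\<bar> * N)"
    have C: "0 < C" unfolding C_def using nn B by (intro add_pos_nonneg) auto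
    \<comment> \<open>With e = \<open>\<eta>\<^sup>2\<close> and \<eta> \<le> 1 the factor (1 + 1 /
      \<eta>) e is at most 2 \<eta>, so the total error is at most \<eta> C. The choice makes this
      at most half of the supposed deficit -Z.\<close>
    define \<eta> where "\<eta> = min 1 (- Z / (2 * C))"
    have Z: "Z < 0" using neg by (simp add: Z_def)
    have \<eta>: "0 < \<eta>" "\<eta> \<le> 1" "\<eta> * C < - Z"
    proof -
      show "0 < \<eta>" "\<eta> \<le> 1" unfolding \<eta>_def using Z C by (auto simp: divide_neg_pos)
      have "\<eta> * C \<le> (- Z / (2 * C)) * C" unfolding \<eta>_def using C by (intro mult_right_mono) auto
      also have "\<dots> = - Z / 2" using C by simp
      finally show "\<eta> * C < - Z" using Z by simp
    qed
    have "- ((1 + 1 / \<eta>) * (4 * B + \<bar>\<mu>\<bar>) * \<eta>\<^sup>2 + \<eta> * (N1 + N2 + \<bar>\<mu>\<bar> * N)) \<le> Z"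
      unfolding Z_def using \<eta> by (intro approx) auto
    moreover have "(1 + 1 / \<eta>) * (4 * B + \<bar>\<mu>\<bar>) * \<eta>\<^sup>2 + \<eta> * (N1 + N2 + \<bar>\<mu>\<bar> * N) \<le> \<eta> * C"
    proof -
      have "(1 + 1 / \<eta>) * \<eta>\<^sup>2 = \<eta> * (\<eta> + 1)" using \<eta> by (simp add: field_simps power2_eq_square)
      then have "(1 + 1 / \<eta>) * (4 * B + \<bar>\<mu>\<bar>) * \<eta>\<^sup>2 = (\<eta> * (\<eta> + 1)) * (4 * B + \<bar>\<mu>\<bar>)" by (metis mult.commute mult.left_commute)
      also have "\<dots> \<le> (\<eta> * 2) * (4 * B + \<bar>\<mu>\<bar>)" using \<eta> B by (intro mult_right_mono mult_left_mono) auto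
      finally show ?thesis unfolding C_def by (simp add: algebra_simps)
    qed
    ultimately show False using \<eta> by linarith
  qed
  also have "N1 + N2 - \<mu> * N = (\<integral>x. \<omega> x * (cmod (p1 x (X u x) (X g1 x)))\<^sup>2 + \<omega> x * (cmod (p2 x (X u x) (X g2 x)))\<^sup>2
      - \<mu> * (\<omega> x * (cmod (X u x))\<^sup>2) \<partial>lborel)"
    unfolding N_def N1_def N2_def using iN iN1 iN2 by simp
  also have "\<dots> = (\<integral>x. k ((norm x)\<^sup>2) * (mag_density b u g1 g2 x - \<mu> * (cmod (u x))\<^sup>2) \<partial>lborel)"
  proof (intro Bochner_Integration.integral_cong refl)
    fix x
    show "\<omega> x * (cmod (p1 x (X u x) (X g1 x)))\<^sup>2 + \<omega> x * (cmod (p2 x (X u x) (X g2 x)))\<^sup>2 - \<mu> * (\<omega> x * (cmod (X u x))\<^sup>2)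
      = k ((norm x)\<^sup>2) * (mag_density b u g1 g2 x - \<mu> * (cmod (u x))\<^sup>2)"
      using \<omega>z[of x] r unfolding mag \<omega>_def[symmetric]
      by (cases "x \<in> cball 0 r") (auto simp: X_def U_def \<omega>_def algebra_simps)
  qed
  finally show ?thesis .
qed

section \<open>Lower bound on the disk\<close>

lemma mag_density_nonneg: "0 \<le> mag_density b u g1 g2 x"
  by (simp add: mag_density_def)

lemma set_integrable_mag_density:
  assumes "L2_on (ball 0 \<rho>) u" "L2_on (ball 0 \<rho>) g1" "L2_on (ball 0 \<rho>) g2"
  shows "set_integrable lborel (ball 0 \<rho>) (mag_density b u g1 g2)"
proof -
  define U where "U = ball (0::real\<times>real) \<rho>"
  define X where "X = (\<lambda>f x. indicator U x *\<^sub>R (f x :: complex))"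
  note LX = assms[folded U_def]
  have Xm: "X f \<in> borel_measurable borel" if "L2_on U f" for f
    using that unfolding L2_on_def set_borel_measurable_def X_def by simp
  note [measurable] = Xm[OF LX(1)] Xm[OF LX(2)] Xm[OF LX(3)]
  have coord: "fst \<in> borel_measurable (borel :: (real\<times>real) measure)" "snd \<in> borel_measurable (borel :: (real\<times>real) measure)"
    by (intro borel_measurable_continuous_onI continuous_intros)+
  note [measurable] = coord
  have iX: "integrable lborel (\<lambda>x. indicator U x * (cmod (f x))\<^sup>2)" if "L2_on U f" for f
    using that unfolding L2_on_def set_integrable_def by simp
  have eq: "indicator U x *\<^sub>R mag_density b u g1 g2 x = mag_density b (X u) (X g1) (X g2) x" for x
    by (simp add: mag_density_def X_def indicator_def)
  have "integrable lborel (\<lambda>x. indicator U x *\<^sub>R mag_density b u g1 g2 x)"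
  proof (rule Bochner_Integration.integrable_bound)
    show "integrable lborel (\<lambda>x. 2 * (indicator U x * (cmod (g1 x))\<^sup>2) + 2 * (indicator U x * (cmod (g2 x))\<^sup>2)
        + (b * \<rho>)\<^sup>2 / 2 * (indicator U x * (cmod (u x))\<^sup>2))"
      using iX[OF LX(1)] iX[OF LX(2)] iX[OF LX(3)] by auto
    show "(\<lambda>x. indicator U x *\<^sub>R mag_density b u g1 g2 x) \<in> borel_measurable lborel"
      unfolding eq unfolding mag_density_def by measurable
    have "mag_density b u g1 g2 x \<le> 2 * (cmod (g1 x))\<^sup>2 + 2 * (cmod (g2 x))\<^sup>2 + (b * \<rho>)\<^sup>2 / 2 * (cmod (u x))\<^sup>2"
      if x: "x \<in> U" for x
    proof -
      have gen: "(cmod (- \<i> * g - complex_of_real a * w))\<^sup>2 \<le> 2 * (cmod g)\<^sup>2 + 2 * a\<^sup>2 * (cmod w)\<^sup>2" for a g w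
      proof -
        have "cmod (- \<i> * g - complex_of_real a * w) \<le> cmod g + \<bar>a\<bar> * cmod w"
          using norm_triangle_ineq4[of "- \<i> * g" "complex_of_real a * w"] by (simp add: norm_mult)
        then have "(cmod (- \<i> * g - complex_of_real a * w))\<^sup>2 \<le> (cmod g + \<bar>a\<bar> * cmod w)\<^sup>2"
          by (intro power_mono) auto
        also have "\<dots> \<le> 2 * (cmod g)\<^sup>2 + 2 * a\<^sup>2 * (cmod w)\<^sup>2"
          using sum_squares_bound[of "cmod g" "\<bar>a\<bar> * cmod w"] by (simp add: power2_sum power_mult_distrib)
        finally show ?thesis .
      qed
      have "(norm x)\<^sup>2 \<le> \<rho>\<^sup>2" using x by (intro power_mono) (auto simp: U_def)
      then have n: "(fst x)\<^sup>2 + (snd x)\<^sup>2 \<le> \<rho>\<^sup>2" by (simp add: norm_power2_prod)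
      have "mag_density b u g1 g2 x \<le> (2 * (cmod (g1 x))\<^sup>2 + 2 * (b / 2 * (- snd x))\<^sup>2 * (cmod (u x))\<^sup>2)
         + (2 * (cmod (g2 x))\<^sup>2 + 2 * (b / 2 * fst x)\<^sup>2 * (cmod (u x))\<^sup>2)"
        unfolding mag_density_def by (intro add_mono gen)
      also have "\<dots> = 2 * (cmod (g1 x))\<^sup>2 + 2 * (cmod (g2 x))\<^sup>2 + b\<^sup>2 / 2 * ((fst x)\<^sup>2 + (snd x)\<^sup>2) * (cmod (u x))\<^sup>2"
        by (simp add: power2_eq_square field_simps)
      also have "\<dots> \<le> 2 * (cmod (g1 x))\<^sup>2 + 2 * (cmod (g2 x))\<^sup>2 + b\<^sup>2 / 2 * \<rho>\<^sup>2 * (cmod (u x))\<^sup>2"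
        using n by (intro add_left_mono mult_right_mono mult_left_mono) auto
      finally show ?thesis by (simp add: power_mult_distrib)
    qed
    then show "AE x in lborel. norm (indicator U x *\<^sub>R mag_density b u g1 g2 x) \<le>
       norm (2 * (indicator U x * (cmod (g1 x))\<^sup>2) + 2 * (indicator U x * (cmod (g2 x))\<^sup>2)
        + (b * \<rho>)\<^sup>2 / 2 * (indicator U x * (cmod (u x))\<^sup>2))"
      using mag_density_nonneg[of b u g1 g2]
      by (intro always_eventually allI) (auto simp: indicator_def intro: order_trans[OF _ abs_ge_self])
  qed
  then show ?thesis unfolding set_integrable_def U_def .
qed

text \<open>The properties supplied by \<open>radial_eigenfunction\<close>, fixed here so that the
  bound on the disk and the trial function on the ellipse refer to the same \<open>W\<close> and
  \<mu>.\<close>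

locale radial_ground_state =
  fixes b S \<mu> :: real and W W1 W2 :: "real \<Rightarrow> real"
  assumes b_pos: "0 < b" and S_pos: "0 < S" and bS: "b * S < 1"
    and dW: "\<And>t. \<bar>t\<bar> < 2 * S \<Longrightarrow> (W has_real_derivative W1 t) (at t)"
    and dW1: "\<And>t. \<bar>t\<bar> < 2 * S \<Longrightarrow> (W1 has_real_derivative W2 t) (at t)"
    and W2_cont: "\<And>t. \<bar>t\<bar> < 2 * S \<Longrightarrow> isCont W2 t"
    and ode: "\<And>t. \<bar>t\<bar> < 2 * S \<Longrightarrow> 4 * (t * W2 t + W1 t) = (b\<^sup>2 * t / 4 - \<mu>) * W t"
    and W_pos: "\<And>t. \<bar>t\<bar> \<le> S \<Longrightarrow> W t > 0"
    and neumann: "W1 S = 0" and W1_neg: "\<And>t. 0 < t \<Longrightarrow> t < S \<Longrightarrow> W1 t < 0"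
begin

text \<open>Shifting the Riccati function by \<delta> changes its equation by 2 \<delta> + 4
  \<delta> t W' / W + t \<delta>^2. The middle term is nonpositive because W decreases, and the
  others are at most 2 \<delta> + S \<delta>^2. In return the shifted function is nonnegative near
  the circle, where cutoffs must decrease.\<close>

lemma disk_lower_bound_perturbed:
  assumes H: "H1_grad (ball 0 (sqrt S)) u g1 g2" and \<delta>: "0 < \<delta>"
  shows "(\<mu> - 2 * \<delta> - S * \<delta>\<^sup>2) * (LINT x:ball 0 (sqrt S)|lborel. (cmod (u x))\<^sup>2)
    \<le> (LINT x:ball 0 (sqrt S)|lborel. mag_density b u g1 g2 x)"
proof -
  define \<rho> where "\<rho> = sqrt S"
  define U where "U = ball (0::real\<times>real) \<rho>"
  have \<rho>: "0 < \<rho>" "\<rho>\<^sup>2 = S" using S_pos by (auto simp: \<rho>_def)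
  define m where "m = \<mu> - 2 * \<delta> - S * \<delta>\<^sup>2"
  \<comment> \<open>The factor 2 arises because the gradient of log W(|x|^2) is 2 W' / W times
    x.\<close>
  define q where "q = (\<lambda>t. 2 * (W1 t / W t) + \<delta>)"
  define q1 where "q1 = (\<lambda>t. 2 * ((W2 t * W t - W1 t * W1 t) / (W t * W t)))"
  have Wnz: "W t \<noteq> 0" if "\<bar>t\<bar> \<le> S" for t using W_pos[OF that] by simp
  have dq: "(q has_real_derivative q1 t) (at t)" if t: "\<bar>t\<bar> < S" for t
  proof -
    have t2: "\<bar>t\<bar> < 2 * S" using t S_pos by simp
    show ?thesis unfolding q_def q1_def
      by (rule DERIV_cong[OF DERIV_add[OF DERIV_cmult[OF DERIV_divide[OF dW1[OF t2] dW[OF t2]]] DERIV_const]])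
        (use t Wnz in auto)
  qed
  have cq: "isCont q1 t" if t: "\<bar>t\<bar> < S" for t
  proof -
    have t2: "\<bar>t\<bar> < 2 * S" using t S_pos by simp
    show ?thesis unfolding q1_def
      by (intro continuous_intros W2_cont[OF t2] DERIV_isCont[OF dW[OF t2]] DERIV_isCont[OF dW1[OF t2]])
        (use t Wnz in auto)
  qed
  have ric: "2 * q t + 2 * t * q1 t + t * (q t)\<^sup>2 \<le> b\<^sup>2 * t / 4 - m" if t: "0 \<le> t" "t < S" for t
  proof -
    have t2: "\<bar>t\<bar> < 2 * S" using t by simp
    have W0: "W t > 0" using W_pos[of t] t by simp
    have "2 * q t + 2 * t * q1 t + t * (q t)\<^sup>2 = 4 * (t * W2 t + W1 t) / W t + 2 * \<delta> + 4 * \<delta> * (t * W1 t / W t) + t * \<delta>\<^sup>2"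
      using W0 unfolding q_def q1_def by (simp add: field_simps power2_eq_square)
    also have "4 * (t * W2 t + W1 t) / W t = b\<^sup>2 * t / 4 - \<mu>"
      using ode[OF t2] W0 by (simp add: field_simps)
    also have "4 * \<delta> * (t * W1 t / W t) \<le> 0"
    proof -
      have "t * W1 t \<le> 0" using W1_neg[of t] t by (cases "t = 0") (auto simp: mult_nonneg_nonpos)
      then have "t * W1 t / W t \<le> 0" using W0 by (rule divide_nonpos_pos)
      then show ?thesis using \<delta> by (intro mult_nonneg_nonpos) auto
    qed
    also have "t * \<delta>\<^sup>2 \<le> S * \<delta>\<^sup>2" using t by (intro mult_right_mono) auto
    finally show ?thesis by (simp add: m_def)
  qed
  have "isCont (\<lambda>t. W1 t / W t) S"
    using S_pos Wnz[of S] by (intro continuous_intros DERIV_isCont[OF dW1] DERIV_isCont[OF dW]) auto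
  then have "((\<lambda>t. W1 t / W t) \<longlongrightarrow> 0) (at S)" by (simp add: isCont_def neumann)
  then have "\<forall>\<^sub>F t in at S. - \<delta> / 2 < W1 t / W t" using \<delta> by (intro order_tendstoD) auto
  then obtain d where d: "0 < d" "\<And>t. t \<noteq> S \<Longrightarrow> dist t S < d \<Longrightarrow> - \<delta> / 2 < W1 t / W t"
    unfolding eventually_at by auto
  \<comment> \<open>The Neumann condition and continuity give W' / W > -\<delta>/2 close to S; from
    \<open>t0\<close> on this makes \<open>q\<close> nonnegative.\<close>
  define t0 where "t0 = max 0 (S - d / 2)"
  have t0: "0 \<le> t0" "t0 < S" using d S_pos by (auto simp: t0_def)
  have sgn: "0 \<le> q t" if "t0 \<le> t" "t < S" for t
    using d(2)[of t] that d(1) by (auto simp: t0_def q_def dist_real_def)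
  \<comment> \<open>Plateau ends that start at \<open>t0\<close> and tend to S: the cutoffs converge
    pointwise to the indicator of the disk, yet each decreases only where \<open>q\<close> is
    nonnegative.\<close>
  define t1 where "t1 = (\<lambda>n::nat. S - (S - t0) / (real n + 1))"
  have t1: "t0 \<le> t1 n" "t1 n < S" for n
    using t0 by (auto simp: t1_def field_simps intro!: mult_right_mono)
  have "\<exists>k. continuous_on UNIV k \<and> (\<forall>t. 0 \<le> k t \<and> k t \<le> 1 \<and> (t \<le> t1 n \<longrightarrow> k t = 1) \<and> (S \<le> t \<longrightarrow> k t = (0::real))) \<and>
     0 \<le> (\<integral>x. k ((norm x)\<^sup>2) * (mag_density b u g1 g2 x - m * (cmod (u x))\<^sup>2) \<partial>lborel)" for n
  proof -
    define t2 where "t2 = (t1 n + S) / 2"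
    have t2: "t1 n < t2" "t2 < S" "0 \<le> t2" using t1[of n] t0 by (auto simp: t2_def)
    obtain k k' where k: "\<And>t. (k has_real_derivative k' t) (at t)" "continuous_on UNIV k'"
      "\<And>t. 0 \<le> k t" "\<And>t. k t \<le> 1" "\<And>t. k' t \<le> 0" "\<And>t. t \<le> t1 n \<Longrightarrow> k t = 1" "\<And>t. t \<le> t1 n \<Longrightarrow> k' t = 0"
      "\<And>t. t2 \<le> t \<Longrightarrow> k t = 0" "\<And>t. t2 \<le> t \<Longrightarrow> k' t = 0"
      using smooth_cutoff[OF t2(1)] by blast
    have kc: "continuous_on UNIV k" using DERIV_isCont[OF k(1)] by (intro continuous_at_imp_continuous_on) auto
    have "0 \<le> (\<integral>x. k ((norm x)\<^sup>2) * (mag_density b u g1 g2 x - m * (cmod (u x))\<^sup>2) \<partial>lborel)"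
    proof (rule H1_weighted_lower_bound[where k'=k' and T=t2 and q=q and ?q1.0=q1 and \<rho>=\<rho>])
      show "0 \<le> q t" if "0 \<le> t" "t < \<rho>\<^sup>2" "k' t \<noteq> 0" for t
      proof (rule sgn)
        have "\<not> t \<le> t1 n" using that k(7)[of t] by auto
        then show "t0 \<le> t" using t1(1)[of n] by linarith
      qed (use that \<rho> in auto)
    qed (use H k t2 \<rho> b_pos bS dq cq ric in \<open>auto simp: \<rho>_def[symmetric]\<close>)
    then show ?thesis using k kc t2 by (intro exI[of _ k]) auto
  qed
  then have "\<exists>k. \<forall>n. continuous_on UNIV (k n) \<and> (\<forall>t. 0 \<le> k n t \<and> k n t \<le> 1 \<and> (t \<le> t1 n \<longrightarrow> k n t = 1) \<and> (S \<le> t \<longrightarrow> k n t = (0::real))) \<and>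
     0 \<le> (\<integral>x. k n ((norm x)\<^sup>2) * (mag_density b u g1 g2 x - m * (cmod (u x))\<^sup>2) \<partial>lborel)"
    by (intro choice allI)
  then obtain k where k: "\<And>n. continuous_on UNIV (k n)" "\<And>n t. 0 \<le> k n t" "\<And>n t. k n t \<le> 1" "\<And>n t. t \<le> t1 n \<Longrightarrow> k n t = 1"
     "\<And>n t. S \<le> t \<Longrightarrow> k n t = (0::real)"
    and kpos: "\<And>n. 0 \<le> (\<integral>x. k n ((norm x)\<^sup>2) * (mag_density b u g1 g2 x - m * (cmod (u x))\<^sup>2) \<partial>lborel)"
    by blast
  have LX: "L2_on U u" "L2_on U g1" "L2_on U g2"
    using H unfolding H1_grad_def U_def \<rho>_def by auto
  define h where "h = (\<lambda>x. indicator U x * (mag_density b u g1 g2 x - m * (cmod (u x))\<^sup>2))"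
  have im: "integrable lborel (\<lambda>x. indicator U x * mag_density b u g1 g2 x)"
    using set_integrable_mag_density[OF LX[unfolded U_def]] by (simp add: set_integrable_def U_def)
  have iu: "integrable lborel (\<lambda>x. indicator U x * (cmod (u x))\<^sup>2)"
    using LX(1) unfolding L2_on_def set_integrable_def by simp
  have h_eq: "h = (\<lambda>x. indicator U x * mag_density b u g1 g2 x - m * (indicator U x * (cmod (u x))\<^sup>2))"
    by (auto simp: h_def algebra_simps)
  have ih: "integrable lborel h" unfolding h_eq using im iu by auto
  have Uin: "x \<in> U \<longleftrightarrow> (norm x)\<^sup>2 < S" for x
    using \<rho> power_strict_mono[of "norm x" \<rho> 2] power_less_imp_less_base[of "norm x" 2 \<rho>] by (auto simp: U_def)
  have kh: "(\<integral>x. k n ((norm x)\<^sup>2) * (mag_density b u g1 g2 x - m * (cmod (u x))\<^sup>2) \<partial>lborel) = (\<integral>x. k n ((norm x)\<^sup>2) * h x \<partial>lborel)" for n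
    by (intro Bochner_Integration.integral_cong) (auto simp: h_def indicator_def Uin k not_less)
  have "(\<lambda>n. \<integral>x. k n ((norm x)\<^sup>2) * h x \<partial>lborel) \<longlonglongrightarrow> (\<integral>x. h x \<partial>lborel)"
  proof (rule integral_dominated_convergence[where w="\<lambda>x. \<bar>h x\<bar>"])
    have [measurable]: "h \<in> borel_measurable borel" using ih by simp
    show "(\<lambda>x. k n ((norm x)\<^sup>2) * h x) \<in> borel_measurable lborel" for n
    proof -
      have "(\<lambda>x::real\<times>real. k n ((norm x)\<^sup>2)) \<in> borel_measurable borel"
        by (intro borel_measurable_continuous_onI continuous_on_compose2[OF k(1)] continuous_intros) auto
      then show ?thesis by simp
    qed
    show "AE x in lborel. norm (k n ((norm x)\<^sup>2) * h x) \<le> \<bar>h x\<bar>" for n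
      using k(2,3) by (intro always_eventually allI) (auto simp: abs_mult intro!: mult_left_le_one_le)
    show "AE x in lborel. (\<lambda>n. k n ((norm x)\<^sup>2) * h x) \<longlonglongrightarrow> h x"
    proof (intro always_eventually allI)
      fix x
      show "(\<lambda>n. k n ((norm x)\<^sup>2) * h x) \<longlonglongrightarrow> h x"
      proof (cases "x \<in> U")
        case True
        have "(\<lambda>n. S - (S - t0) / (real n + 1)) \<longlonglongrightarrow> S - 0"
          by (intro tendsto_intros real_tendsto_divide_at_top[OF tendsto_const]
              filterlim_at_top_mono[OF filterlim_real_sequentially]) auto
        then have "\<forall>\<^sub>F n in sequentially. (norm x)\<^sup>2 < t1 n"
          using True unfolding t1_def Uin by (intro order_tendstoD) auto
        then have "\<forall>\<^sub>F n in sequentially. k n ((norm x)\<^sup>2) * h x = h x"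
          by eventually_elim (simp add: k)
        then show ?thesis by (rule tendsto_eventually)
      qed (simp add: h_def)
    qed
  qed (use ih in auto)
  then have "0 \<le> (\<integral>x. h x \<partial>lborel)"
    by (rule tendsto_lowerbound) (use kpos kh in auto)
  also have "(\<integral>x. h x \<partial>lborel) = (LINT x:U|lborel. mag_density b u g1 g2 x) - m * (LINT x:U|lborel. (cmod (u x))\<^sup>2)"
    unfolding h_eq set_lebesgue_integral_def using im iu by simp
  finally show ?thesis by (simp add: m_def U_def \<rho>_def)
qed

lemma disk_lower_bound:
  assumes H: "H1_grad (ball 0 (sqrt S)) u g1 g2"
  shows "\<mu> * (LINT x:ball 0 (sqrt S)|lborel. (cmod (u x))\<^sup>2)
    \<le> (LINT x:ball 0 (sqrt S)|lborel. mag_density b u g1 g2 x)" (is "\<mu> * ?N \<le> ?E")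
proof (rule tendsto_upperbound)
  show "((\<lambda>\<delta>. (\<mu> - 2 * \<delta> - S * \<delta>\<^sup>2) * ?N) \<longlongrightarrow> \<mu> * ?N) (at_right 0)"
    by (auto intro!: tendsto_eq_intros)
  show "\<forall>\<^sub>F \<delta> in at_right 0. (\<mu> - 2 * \<delta> - S * \<delta>\<^sup>2) * ?N \<le> ?E"
    using disk_lower_bound_perturbed[OF H] by (auto simp: eventually_at_right_field intro: exI[of _ 1])
qed auto

end

section \<open>The trial function on the ellipse\<close>

lemma set_integrable_continuous_bounded:
  fixes g :: "real \<times> real \<Rightarrow> 'b::euclidean_space"
  assumes "continuous_on (closure U) g" "bounded U" "U \<in> sets borel"
  shows "set_integrable lborel U g"
proof (rule set_integrable_subset)
  show "set_integrable lborel (closure U) g"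
    unfolding set_integrable_def by (rule borel_integrable_compact) (use assms in auto)
qed (use assms closure_subset in auto)

lemma L2_on_continuous:
  assumes f: "continuous_on UNIV f" and U: "bounded U" "U \<in> sets borel"
  shows "L2_on U f"
  unfolding L2_on_def
proof
  have "set_integrable lborel U f"
    by (intro set_integrable_continuous_bounded continuous_on_subset[OF f] U) auto
  then show "set_borel_measurable lborel U f"
    unfolding set_integrable_def set_borel_measurable_def by auto
  show "set_integrable lborel U (\<lambda>x. (cmod (f x))\<^sup>2)"
    by (intro set_integrable_continuous_bounded continuous_intros continuous_on_subset[OF f] U) auto
qed

lemma C1_grad_of_real:
  assumes f: "C1_grad f f1 f2"
  shows "C1_grad (\<lambda>x. complex_of_real (f x)) (\<lambda>x. complex_of_real (f1 x)) (\<lambda>x. complex_of_real (f2 x))"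
  unfolding C1_grad_def
proof (intro conjI allI)
  fix x
  show "((\<lambda>x. complex_of_real (f x)) has_derivative
     (\<lambda>h. fst h *\<^sub>R complex_of_real (f1 x) + snd h *\<^sub>R complex_of_real (f2 x))) (at x)"
    by (rule has_derivative_eq_rhs[OF has_derivative_of_real[OF C1_gradD(1)[OF f]]])
      (auto simp: scaleR_conv_of_real)
qed (intro continuous_intros C1_gradD[OF f])+

text \<open>The product of u with a test function is C^1 with compact support, so its partial
  derivatives integrate to 0; the product rule turns this into the weak identity. Support inside U
  lets integrals over U and over the plane be exchanged.\<close>

lemma H1_grad_C1:
  assumes u: "C1_grad u u1 u2" and U: "bounded U" "U \<in> sets borel"
  shows "H1_grad U u u1 u2"
  unfolding H1_grad_def
proof (intro conjI allI impI L2_on_continuous C1_gradD[OF u] U)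
  fix phi dphi assume t: "test_fun U phi dphi"
  then obtain K where K: "compact K" "K \<subseteq> U" "\<And>x. x \<notin> K \<Longrightarrow> phi x = 0"
    and d: "\<And>x. (phi has_derivative dphi x) (at x)"
    and c: "continuous_on UNIV (\<lambda>x. dphi x (1,0))" "continuous_on UNIV (\<lambda>x. dphi x (0,1))"
    unfolding test_fun_def by blast
  have lin: "dphi x h = fst h * dphi x (1,0) + snd h * dphi x (0,1)" for x h
  proof -
    have l: "linear (dphi x)" using d by (rule has_derivative_linear)
    have "h = fst h *\<^sub>R (1,0) + snd h *\<^sub>R (0,1)" by (cases h) simp
    then have "dphi x h = dphi x (fst h *\<^sub>R (1,0) + snd h *\<^sub>R (0,1))" by simp
    also have "\<dots> = fst h * dphi x (1,0) + snd h * dphi x (0,1)"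
      by (simp only: linear_add[OF l] linear_scale[OF l] real_scaleR_def)
    finally show ?thesis .
  qed
  have p: "C1_grad phi (\<lambda>x. dphi x (1,0)) (\<lambda>x. dphi x (0,1))"
    unfolding C1_grad_def
  proof (intro conjI allI c)
    fix x
    have "dphi x = (\<lambda>h. fst h *\<^sub>R dphi x (1,0) + snd h *\<^sub>R dphi x (0,1))"
      by (rule ext, subst lin) simp
    then show "(phi has_derivative (\<lambda>h. fst h *\<^sub>R dphi x (1,0) + snd h *\<^sub>R dphi x (0,1))) (at x)"
      using d[of x] by metis
  qed
  obtain M where M: "\<And>x. x \<in> K \<Longrightarrow> norm x \<le> M" using compact_imp_bounded[OF K(1)] by (auto simp: bounded_iff)
  have dz: "dphi x h = 0" if "x \<notin> K" for x h
  proof -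
    have o: "open (- K)" and xin: "x \<in> - K" using K(1) that compact_imp_closed by auto
    have "(phi has_derivative (\<lambda>h. 0)) (at x)"
      by (rule has_derivative_transform_within_open[OF has_derivative_const[of 0] o xin]) (use K in auto)
    from has_derivative_unique[OF this d] show ?thesis by metis
  qed
  note g = C1_grad_mult[OF u C1_grad_of_real[OF p]]
  have z: "u x * complex_of_real (phi x) = 0" if "M < norm x" for x
    using M[of x] that K(3)[of x] by force
  have supp: "integrable lborel (\<lambda>x. f x * complex_of_real (p x))"
    "(LINT x:U|lborel. f x * complex_of_real (p x)) = (\<integral>x. f x * complex_of_real (p x) \<partial>lborel)"
    if "continuous_on UNIV f" "continuous_on UNIV p" "\<And>x. x \<notin> K \<Longrightarrow> p x = 0" for f p
  proof -
    show "integrable lborel (\<lambda>x. f x * complex_of_real (p x))"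
    proof (rule integrable_continuous_compact_support[of _ M])
      fix x :: "real \<times> real" assume "M < norm x"
      then have "p x = 0" using M[of x] that(3)[of x] by force
      then show "f x * complex_of_real (p x) = 0" by simp
    qed (intro continuous_intros that(1,2))
    show "(LINT x:U|lborel. f x * complex_of_real (p x)) = (\<integral>x. f x * complex_of_real (p x) \<partial>lborel)"
      unfolding set_lebesgue_integral_def
    proof (intro Bochner_Integration.integral_cong refl)
      fix x show "indicator U x *\<^sub>R (f x * complex_of_real (p x)) = f x * complex_of_real (p x)"
        using that(3)[of x] K(2) by (cases "x \<in> K") (auto simp: indicator_def)
    qed
  qed
  have s: "integrable lborel (\<lambda>x. u x * complex_of_real (dphi x e))"
    "(LINT x:U|lborel. u x * complex_of_real (dphi x e)) = (\<integral>x. u x * complex_of_real (dphi x e) \<partial>lborel)"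
    if "e = (1,0) \<or> e = (0,1)" for e
    using supp[OF C1_gradD(2)[OF u], of "\<lambda>x. dphi x e"] c that dz by auto
  have s1: "integrable lborel (\<lambda>x. w x * complex_of_real (phi x))"
    "(LINT x:U|lborel. w x * complex_of_real (phi x)) = (\<integral>x. w x * complex_of_real (phi x) \<partial>lborel)"
    if "w = u1 \<or> w = u2" for w
    using supp[OF _ C1_gradD(2)[OF p]] that C1_gradD(3,4)[OF u] K(3) by auto
  have "(\<integral>x. u x * complex_of_real (dphi x (1,0)) + u1 x * complex_of_real (phi x) \<partial>lborel) = 0"
    using integral_partial_derivative_eq_0(3)[OF g z] by simp
  then show "(LINT x:U|lborel. u x * complex_of_real (dphi x (1, 0))) = - (LINT x:U|lborel. u1 x * complex_of_real (phi x))"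
    using s[of "(1,0)"] s1[of u1] by (simp add: eq_neg_iff_add_eq_0)
  have "(\<integral>x. u x * complex_of_real (dphi x (0,1)) + u2 x * complex_of_real (phi x) \<partial>lborel) = 0"
    using integral_partial_derivative_eq_0(4)[OF g z] by simp
  then show "(LINT x:U|lborel. u x * complex_of_real (dphi x (0, 1))) = - (LINT x:U|lborel. u2 x * complex_of_real (phi x))"
    using s[of "(0,1)"] s1[of u2] by (simp add: eq_neg_iff_add_eq_0)
qed

section \<open>Integrals over the unit disk\<close>

lemma lborel_integral_scale2:
  fixes F :: "real \<times> real \<Rightarrow> real"
  assumes [measurable]: "F \<in> borel_measurable borel" and ab: "0 < a" "0 < c"
  shows "(\<integral>z. F z \<partial>lborel) = a * c * (\<integral>z. F (a * fst z, c * snd z) \<partial>lborel)"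
proof -
  define \<gamma> where "\<gamma> = (\<lambda>j::real\<times>real. if j = (1,0) then a else c)"
  have B: "(Basis :: (real\<times>real) set) = {(1,0), (0,1)}" by (auto simp: Basis_prod_def)
  have nz: "\<gamma> j \<noteq> 0" for j using ab by (auto simp: \<gamma>_def)
  have T: "(\<lambda>x. 0 + (\<Sum>j\<in>Basis. (\<gamma> j * (x \<bullet> j)) *\<^sub>R j)) = (\<lambda>z. (a * fst z, c * snd z))"
    by (rule ext) (simp add: B \<gamma>_def inner_prod_def)
  have P: "(\<Prod>j\<in>(Basis::(real\<times>real) set). \<bar>\<gamma> j\<bar>) = a * c" using ab by (simp add: B \<gamma>_def)
  have L: "lborel = density (distr lborel borel (\<lambda>z. (a * fst z, c * snd z))) (\<lambda>_. ennreal (a * c))"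
    using lborel_affine_euclidean[of \<gamma> 0] nz unfolding T P by simp
  have m [measurable]: "(\<lambda>z::real\<times>real. (a * fst z, c * snd z)) \<in> borel_measurable borel"
    by (intro borel_measurable_continuous_onI continuous_intros)
  have "(\<integral>z. F z \<partial>lborel) = (\<integral>z. F z \<partial>density (distr lborel borel (\<lambda>z. (a * fst z, c * snd z))) (\<lambda>_. ennreal (a * c)))"
    using L by simp
  also have "\<dots> = (\<integral>z. (a * c) *\<^sub>R F z \<partial>distr lborel borel (\<lambda>z. (a * fst z, c * snd z)))"
    using ab by (intro integral_density) auto
  also have "\<dots> = (\<integral>z. (a * c) *\<^sub>R F (a * fst z, c * snd z) \<partial>lborel)"
    by (intro integral_distr) auto
  finally show ?thesis by simp
qed

lemma lborel_integral_swap: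
  fixes F :: "real \<times> real \<Rightarrow> real"
  assumes "F \<in> borel_measurable borel"
  shows "(\<integral>z. F (snd z, fst z) \<partial>lborel) = (\<integral>z. F z \<partial>lborel)"
  using integral_distr[of "\<lambda>z::real\<times>real. (snd z, fst z)" lborel borel F] assms borel_measurable_shear(3) distr_lborel_swap
  by simp

text \<open>On a horizontal chord the integrand is the x-derivative of x h(x^2 + y^2). At both ends
  x^2 + y^2 = 1, so the result is h(1) times the length of the chord; \<open>max\<close> covers the
  lines that miss the disk.\<close>

lemma unit_disk_slice_integral:
  fixes h h' :: "real \<Rightarrow> real"
  assumes h: "\<And>s. 0 \<le> s \<Longrightarrow> s \<le> 1 \<Longrightarrow> (h has_real_derivative h' s) (at s)" and c: "continuous_on {0..1} h'"
  shows "(\<integral>x. indicator (ball 0 1) (x, y) * (h (x\<^sup>2 + y\<^sup>2) + 2 * x\<^sup>2 * h' (x\<^sup>2 + y\<^sup>2)) \<partial>lborel)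
    = 2 * sqrt (max 0 (1 - y\<^sup>2)) * h 1"
proof (cases "y\<^sup>2 < 1")
  case False
  have "(x, y) \<notin> ball 0 1" for x :: real
  proof
    assume "(x, y) \<in> ball 0 1"
    then have "x\<^sup>2 + y\<^sup>2 < 1" by (simp add: norm_prod_def)
    then show False using False zero_le_power2[of x] by linarith
  qed
  then have "indicator (ball 0 1) (x, y) = (0::real)" for x :: real by (simp add: indicator_def)
  then show ?thesis using False by (simp add: max_def)
next
  case True
  define a where "a = sqrt (1 - y\<^sup>2)"
  have a: "0 < a" "a\<^sup>2 = 1 - y\<^sup>2" using True by (auto simp: a_def)
  have ina: "\<bar>x\<bar> \<le> a \<longleftrightarrow> x\<^sup>2 + y\<^sup>2 \<le> 1" "\<bar>x\<bar> < a \<longleftrightarrow> x\<^sup>2 + y\<^sup>2 < 1" for x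
    using abs_le_square_iff[of x a] abs_le_square_iff[of a x] a by auto
  let ?f = "\<lambda>x. h (x\<^sup>2 + y\<^sup>2) + 2 * x\<^sup>2 * h' (x\<^sup>2 + y\<^sup>2)"
  have hc: "continuous_on {0..1} h" using h by (meson DERIV_isCont atLeastAtMost_iff continuous_at_imp_continuous_on)
  have r: "x\<^sup>2 + y\<^sup>2 \<in> {0..1}" if "x \<in> {-a..a}" for x
    using ina(1)[of x] that by (auto simp: abs_le_iff)
  \<comment> \<open>The open disk cuts out the open chord, while the fundamental theorem is applied
    on the closed one; they differ in two points.\<close>
  have "(\<integral>x. indicator (ball 0 1) (x, y) * ?f x \<partial>lborel) = (\<integral>x. indicator {-a..a} x *\<^sub>R ?f x \<partial>lborel)"
  proof (rule integral_cong_AE)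
    have fc: "continuous_on {-a..a} ?f"
      by (intro continuous_intros continuous_on_compose2[OF hc] continuous_on_compose2[OF c]) (use r in auto)
    then have m: "(\<lambda>x. indicator {-a..a} x *\<^sub>R ?f x) \<in> borel_measurable borel"
      by (intro borel_measurable_continuous_on_indicator) auto
    show "(\<lambda>x. indicator {-a..a} x *\<^sub>R ?f x) \<in> borel_measurable lborel" using m by simp
    have eq: "(\<lambda>x. indicator (ball 0 1) (x, y) * ?f x) = (\<lambda>x. indicator {-a<..<a} x * (indicator {-a..a} x *\<^sub>R ?f x))"
    proof
      fix x show "indicator (ball 0 1) (x, y) * ?f x = indicator {-a<..<a} x * (indicator {-a..a} x *\<^sub>R ?f x)"
        using ina(2)[of x] by (auto simp: indicator_def norm_prod_def abs_less_iff)
    qed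
    show "(\<lambda>x. indicator (ball 0 1) (x, y) * ?f x) \<in> borel_measurable lborel"
      unfolding eq using m by measurable
    have "AE x in lborel. x \<noteq> a" "AE x in lborel. x \<noteq> - a" by (rule AE_lborel_singleton)+
    then show "AE x in lborel. indicator (ball 0 1) (x, y) * ?f x = indicator {-a..a} x *\<^sub>R ?f x"
    proof eventually_elim
      case (elim x)
      then show ?case using fun_cong[OF eq, of x] by (auto simp: indicator_def)
    qed
  qed
  also have "\<dots> = a * h (a\<^sup>2 + y\<^sup>2) - (- a) * h ((- a)\<^sup>2 + y\<^sup>2)"
  proof (rule integral_FTC_Icc)
    fix x assume x: "- a \<le> x" "x \<le> a"
    have "((\<lambda>x. x * h (x\<^sup>2 + y\<^sup>2)) has_real_derivative ?f x) (at x)"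
    proof (rule DERIV_cong[OF DERIV_mult[OF DERIV_ident DERIV_chain2[OF h]]])
      show "((\<lambda>x. x\<^sup>2 + y\<^sup>2) has_real_derivative 2 * x) (at x)" by (auto intro!: derivative_eq_intros)
    qed (use r[of x] x in \<open>auto simp: power2_eq_square\<close>)
    then show "((\<lambda>x. x * h (x\<^sup>2 + y\<^sup>2)) has_vector_derivative ?f x) (at x within {-a..a})"
      by (simp add: has_real_derivative_iff_has_vector_derivative has_vector_derivative_at_within)
  qed (use a in \<open>auto intro!: continuous_intros continuous_on_compose2[OF hc] continuous_on_compose2[OF c] r\<close>)
  also have "\<dots> = 2 * sqrt (max 0 (1 - y\<^sup>2)) * h 1"
    using True a by (simp add: a_def)
  finally show ?thesis .
qed

lemma integrable_unit_disk:
  fixes g :: "real \<times> real \<Rightarrow> real"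
  assumes "continuous_on (cball 0 1) g"
  shows "integrable lborel (\<lambda>z. indicator (ball 0 1) z * g z)"
  using set_integrable_continuous_bounded[of "ball 0 1" g] assms by (simp add: set_integrable_def)

text \<open>The horizontal half of the divergence theorem for h(|z|^2) z. All chords carry the same
  factor h(1); the remaining constant, the sum of the chord lengths, is identified as the area by
  the case h = 1.\<close>

lemma unit_disk_divergence:
  fixes h h' :: "real \<Rightarrow> real"
  assumes h: "\<And>s. 0 \<le> s \<Longrightarrow> s \<le> 1 \<Longrightarrow> (h has_real_derivative h' s) (at s)" and c: "continuous_on {0..1} h'"
  shows "(\<integral>z. indicator (ball (0::real\<times>real) 1) z * (h ((norm z)\<^sup>2) + 2 * (fst z)\<^sup>2 * h' ((norm z)\<^sup>2)) \<partial>lborel)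
    = h 1 * measure lborel (ball (0::real\<times>real) 1)"
proof -
  have gen: "(\<integral>z. indicator (ball (0::real\<times>real) 1) z * (h ((norm z)\<^sup>2) + 2 * (fst z)\<^sup>2 * h' ((norm z)\<^sup>2)) \<partial>lborel)
     = h 1 * (\<integral>y. 2 * sqrt (max 0 (1 - y\<^sup>2)) \<partial>lborel)"
    if h: "\<And>s. 0 \<le> s \<Longrightarrow> s \<le> 1 \<Longrightarrow> (h has_real_derivative h' s) (at s)" and c: "continuous_on {0..1} h'" for h h'
  proof -
    define F where "F = (\<lambda>z::real\<times>real. indicator (ball 0 1) z * (h ((norm z)\<^sup>2) + 2 * (fst z)\<^sup>2 * h' ((norm z)\<^sup>2)))"
    have hc: "continuous_on {0..1} h" using h by (meson DERIV_isCont atLeastAtMost_iff continuous_at_imp_continuous_on)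
    have "integrable lborel F"
      unfolding F_def by (rule integrable_unit_disk)
        (auto intro!: continuous_intros continuous_on_compose2[OF hc] continuous_on_compose2[OF c] simp: power_le_one)
    then have "integral\<^sup>L lborel F = (\<integral>y. (\<integral>x. F (x, y) \<partial>lborel) \<partial>lborel)"
      using lborel_pair.integral_snd[of "\<lambda>x y. F (x, y)"] by (simp add: lborel_prod)
    also have "\<dots> = (\<integral>y. 2 * sqrt (max 0 (1 - y\<^sup>2)) * h 1 \<partial>lborel)"
      using unit_disk_slice_integral[OF h c] by (simp add: F_def norm_power2_prod)
    finally show ?thesis by (simp add: F_def)
  qed
  have "measure lborel (ball (0::real\<times>real) 1) = (\<integral>y. 2 * sqrt (max 0 (1 - y\<^sup>2)) \<partial>lborel)"
    using gen[of "\<lambda>_. 1" "\<lambda>_. 0"] by simp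
  then show ?thesis using gen[OF h c] by simp
qed

lemma C1_grad_cis_product:
  "C1_grad (\<lambda>x. cis (c * fst x * snd x)) (\<lambda>x. \<i> * complex_of_real (c * snd x) * cis (c * fst x * snd x))
     (\<lambda>x. \<i> * complex_of_real (c * fst x) * cis (c * fst x * snd x))"
  unfolding C1_grad_def
proof (intro conjI allI)
  fix x :: "real \<times> real"
  have dcis: "(cis has_derivative (\<lambda>h. h *\<^sub>R (\<i> * cis \<theta>))) (at \<theta>)" for \<theta>
  proof -
    have "((\<lambda>z. exp (\<i> * z)) has_field_derivative (\<i> * exp (\<i> * of_real \<theta>))) (at (of_real \<theta>))"
      by (auto intro!: derivative_eq_intros)
    from has_vector_derivative_real_field[OF this] show ?thesis
      by (simp add: cis_conv_exp[abs_def] has_vector_derivative_def)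
  qed
  have "((\<lambda>x::real\<times>real. c * fst x * snd x) has_derivative (\<lambda>h. fst h * (c * snd x) + snd h * (c * fst x))) (at x)"
    by (auto intro!: derivative_eq_intros simp: algebra_simps)
  from has_derivative_compose[OF this dcis]
  show "((\<lambda>x. cis (c * fst x * snd x)) has_derivative
     (\<lambda>h. fst h *\<^sub>R (\<i> * complex_of_real (c * snd x) * cis (c * fst x * snd x)) +
          snd h *\<^sub>R (\<i> * complex_of_real (c * fst x) * cis (c * fst x * snd x)))) (at x)"
    by (rule has_derivative_eq_rhs) (auto simp: scaleR_conv_of_real algebra_simps)
qed (intro continuous_intros)+

section \<open>Geometry of the ellipse and the variational upper bound\<close>

lemma ellipse_props:
  assumes "0 < \<alpha>" "0 < \<beta>"
  shows "open (ellipse \<alpha> \<beta>)" "bounded (ellipse \<alpha> \<beta>)"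
    "(\<alpha> * fst z, \<beta> * snd z) \<in> ellipse \<alpha> \<beta> \<longleftrightarrow> z \<in> ball 0 1"
proof -
  have e: "ellipse \<alpha> \<beta> = {z. (fst z)\<^sup>2 / \<alpha>\<^sup>2 + (snd z)\<^sup>2 / \<beta>\<^sup>2 < 1}"
    unfolding ellipse_def by auto
  show "open (ellipse \<alpha> \<beta>)" unfolding e
    by (intro open_Collect_less continuous_intros) (use assms in auto)
  show "(\<alpha> * fst z, \<beta> * snd z) \<in> ellipse \<alpha> \<beta> \<longleftrightarrow> z \<in> ball 0 1"
    using assms by (simp add: e power_mult_distrib norm_prod_def)
  show "bounded (ellipse \<alpha> \<beta>)"
  proof (rule bounded_subset)
    show "bounded ({-\<alpha>..\<alpha>} \<times> {-\<beta>..\<beta>})" by (intro bounded_Times) auto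
    show "ellipse \<alpha> \<beta> \<subseteq> {-\<alpha>..\<alpha>} \<times> {-\<beta>..\<beta>}"
    proof
      fix z assume "z \<in> ellipse \<alpha> \<beta>"
      then have z: "(fst z)\<^sup>2 / \<alpha>\<^sup>2 + (snd z)\<^sup>2 / \<beta>\<^sup>2 < 1" by (simp add: e)
      have "0 \<le> (fst z)\<^sup>2 / \<alpha>\<^sup>2" "0 \<le> (snd z)\<^sup>2 / \<beta>\<^sup>2" by auto
      then have "(fst z)\<^sup>2 / \<alpha>\<^sup>2 \<le> 1" "(snd z)\<^sup>2 / \<beta>\<^sup>2 \<le> 1" using z by linarith+
      then have "(fst z)\<^sup>2 \<le> \<alpha>\<^sup>2" "(snd z)\<^sup>2 \<le> \<beta>\<^sup>2" using assms by (simp_all add: divide_le_eq)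
      then have "\<bar>fst z\<bar> \<le> \<alpha>" "\<bar>snd z\<bar> \<le> \<beta>" using assms by (simp_all add: power2_le_iff_abs_le)
      then show "z \<in> {-\<alpha>..\<alpha>} \<times> {-\<beta>..\<beta>}" by (cases z) auto
    qed
  qed
qed

lemma ellipse_eq_ball:
  assumes "0 < \<rho>" shows "ellipse \<rho> \<rho> = ball 0 \<rho>"
proof -
  have "x\<^sup>2 / \<rho>\<^sup>2 + y\<^sup>2 / \<rho>\<^sup>2 < 1 \<longleftrightarrow> sqrt (x\<^sup>2 + y\<^sup>2) < \<rho>" for x y
  proof -
    have "x\<^sup>2 / \<rho>\<^sup>2 + y\<^sup>2 / \<rho>\<^sup>2 < 1 \<longleftrightarrow> x\<^sup>2 + y\<^sup>2 < \<rho>\<^sup>2"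
      using assms by (simp add: add_divide_distrib[symmetric])
    also have "\<dots> \<longleftrightarrow> sqrt (x\<^sup>2 + y\<^sup>2) < sqrt (\<rho>\<^sup>2)" by (simp only: real_sqrt_less_iff)
    finally show ?thesis using assms by simp
  qed
  then show ?thesis by (auto simp: ellipse_def norm_prod_def)
qed

lemma mu1_le_rayleigh:
  assumes "H1_grad U u g1 g2" "0 < (LINT x:U|lborel. (cmod (u x))\<^sup>2)"
  shows "mu1 b U \<le> (LINT x:U|lborel. mag_density b u g1 g2 x) / (LINT x:U|lborel. (cmod (u x))\<^sup>2)"
  unfolding mu1_def
proof (rule cInf_lower)
  have "0 \<le> (LINT x:U|lborel. mag_density b u g1 g2 x) / (LINT x:U|lborel. (cmod (u x))\<^sup>2)" for u g1 g2
    unfolding set_lebesgue_integral_def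
    by (intro divide_nonneg_nonneg Bochner_Integration.integral_nonneg) (auto simp: mag_density_nonneg)
  then show "bdd_below {(LINT x:U|lborel. mag_density b u g1 g2 x) / (LINT x:U|lborel. (cmod (u x))\<^sup>2) | u g1 g2.
      H1_grad U u g1 g2 \<and> (LINT x:U|lborel. (cmod (u x))\<^sup>2) \<noteq> 0}"
    by (intro bdd_belowI[of _ 0]) auto
  show "(LINT x:U|lborel. mag_density b u g1 g2 x) / (LINT x:U|lborel. (cmod (u x))\<^sup>2)
    \<in> {(LINT x:U|lborel. mag_density b u g1 g2 x) / (LINT x:U|lborel. (cmod (u x))\<^sup>2) | u g1 g2.
      H1_grad U u g1 g2 \<and> (LINT x:U|lborel. (cmod (u x))\<^sup>2) \<noteq> 0}"
    using assms by (intro CollectI exI[of _ u] exI[of _ g1] exI[of _ g2]) auto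
qed

context radial_ground_state
begin

text \<open>The phase of the trial function replaces the symmetric gauge by
  \<open>b / (\<alpha>\<^sup>2 + \<beta>\<^sup>2) (-\<alpha>\<^sup>2 y, \<beta>\<^sup>2 x)\<close>, which is adapted to the ellipse: after rescaling to the unit
  disk and averaging over the two axes, the Rayleigh quotient becomes that of a radial function on
  the disk of radius \<open>sqrt R\<close>.\<close>

lemma ellipse_trial_function:
  assumes ab: "0 < \<alpha>" "0 < \<beta>"
  defines "R \<equiv> 2 * \<alpha>\<^sup>2 * \<beta>\<^sup>2 / (\<alpha>\<^sup>2 + \<beta>\<^sup>2)"
  assumes RS: "R \<le> S"
  obtains u g1 g2 where "H1_grad (ellipse \<alpha> \<beta>) u g1 g2"
    "0 < (LINT x:ellipse \<alpha> \<beta>|lborel. (cmod (u x))\<^sup>2)"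
    "(LINT x:ellipse \<alpha> \<beta>|lborel. mag_density b u g1 g2 x) =
      \<mu> * (LINT x:ellipse \<alpha> \<beta>|lborel. (cmod (u x))\<^sup>2) + 4 * \<alpha> * \<beta> * (W R * W1 R) * measure lborel (ball (0::real\<times>real) 1)"
proof -
  define U where "U = ellipse \<alpha> \<beta>"
  define D where "D = ball (0::real\<times>real) 1"
  have s0: "0 < \<alpha>\<^sup>2 + \<beta>\<^sup>2" using ab by (intro add_pos_pos) auto
  then have nz: "\<alpha>\<^sup>2 + \<beta>\<^sup>2 \<noteq> 0" by linarith
  have R0: "0 < R" unfolding R_def using ab s0 by auto
  have "\<bar>t\<bar> < 2 * S \<Longrightarrow> isCont W1 t" for t using dW1 by (intro DERIV_isCont)
  note W1c = this
  have Wc: "\<bar>t\<bar> < 2 * S \<Longrightarrow> isCont W t" for t using dW by (intro DERIV_isCont)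
  \<comment> \<open>The trial function has to be C^1 on the whole plane, but \<open>W\<close> is
    controlled only up to 2 S. The cutoff equals 1 up to S, hence on the ellipse, where the argument
    of \<open>W\<close> stays below R \<le> S.\<close>
  have "S < 3 * S / 2" using S_pos by simp
  then obtain k k' where k: "\<And>t. (k has_real_derivative k' t) (at t)" "continuous_on UNIV k'"
      "\<And>t. 0 \<le> k t" "\<And>t. k t \<le> 1" "\<And>t. k' t \<le> 0"
      "\<And>t. t \<le> S \<Longrightarrow> k t = 1" "\<And>t. t \<le> S \<Longrightarrow> k' t = 0"
      "\<And>t. 3 * S / 2 \<le> t \<Longrightarrow> k t = 0" "\<And>t. 3 * S / 2 \<le> t \<Longrightarrow> k' t = 0"
    using smooth_cutoff by blast
  define F where "F = (\<lambda>t. if t < 2 * S then k t * W t else 0)"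
  define F1 where "F1 = (\<lambda>t. if t < 2 * S then k' t * W t + k t * W1 t else 0)"
  have FF: "(F has_real_derivative F1 t) (at t) \<and> isCont F1 t" if "0 \<le> t" for t
    unfolding F_def F1_def
    using cutoff_extension[where k=k and k'=k' and T="3 * S / 2" and S="2 * S" and q=W and ?q1.0=W1, OF k(1,2,8,9) _ _ dW W1c that] S_pos
    by auto
  have F_eq: "F t = W t" "F1 t = W1 t" if "t \<le> S" for t
    using that S_pos k(6,7)[of t] by (auto simp: F_def F1_def)
  \<comment> \<open>The quadratic form \<open>Q\<close> with these coefficients has level sets
    homothetic to the ellipse and equals R on its boundary.\<close>
  define A where "A = R / \<alpha>\<^sup>2"
  define B where "B = R / \<beta>\<^sup>2"
  have AB: "0 \<le> A" "0 \<le> B" using R0 by (auto simp: A_def B_def)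
  define Q where "Q = (\<lambda>x::real\<times>real. A * (fst x)\<^sup>2 + B * (snd x)\<^sup>2)"
  \<comment> \<open>The phase exp(i c x y) adds its gradient c (y, x) to the negated potential. This
    c solves c + b/2 = m1 and c - b/2 = -m2, which are compatible because m1 + m2 = b.\<close>
  define c where "c = b / 2 * (\<alpha>\<^sup>2 - \<beta>\<^sup>2) / (\<alpha>\<^sup>2 + \<beta>\<^sup>2)"
  define m1 where "m1 = b * \<alpha>\<^sup>2 / (\<alpha>\<^sup>2 + \<beta>\<^sup>2)"
  define m2 where "m2 = b * \<beta>\<^sup>2 / (\<alpha>\<^sup>2 + \<beta>\<^sup>2)"
  have "b / 2 * (X - Y) / (X + Y) + b / 2 = b * X / (X + Y)" "b / 2 * (X - Y) / (X + Y) - b / 2 = - (b * Y / (X + Y))"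
    if "X + Y \<noteq> 0" for X Y :: real
    using that by (auto simp: field_simps)
  from this[OF nz] have c1: "c + b / 2 = m1" and c2: "c - b / 2 = - m2"
    by (auto simp only: c_def m1_def m2_def)
  have Cf: "C1_grad (\<lambda>x. F (Q x)) (\<lambda>x. 2 * A * fst x * F1 (Q x)) (\<lambda>x. 2 * B * snd x * F1 (Q x))"
    unfolding Q_def using FF AB by (intro C1_grad_quadratic) auto
  define e where "e = (\<lambda>x::real\<times>real. cis (c * fst x * snd x))"
  define u where "u = (\<lambda>x. e x * complex_of_real (F (Q x)))"
  define g1 where "g1 = (\<lambda>x. e x * complex_of_real (2 * A * fst x * F1 (Q x)) + \<i> * complex_of_real (c * snd x) * e x * complex_of_real (F (Q x)))"
  define g2 where "g2 = (\<lambda>x. e x * complex_of_real (2 * B * snd x * F1 (Q x)) + \<i> * complex_of_real (c * fst x) * e x * complex_of_real (F (Q x)))"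
  have Cu: "C1_grad u g1 g2"
    using C1_grad_mult[OF C1_grad_cis_product[of c] C1_grad_of_real[OF Cf]]
    unfolding u_def g1_def g2_def e_def .
  have H: "H1_grad U u g1 g2"
    unfolding U_def using ellipse_props(1,2)[OF ab] by (intro H1_grad_C1[OF Cu]) auto
  have ne: "cmod (e x) = 1" for x by (simp add: e_def)
  have cu: "(cmod (u x))\<^sup>2 = (F (Q x))\<^sup>2" for x
    by (simp add: u_def norm_mult ne)
  \<comment> \<open>Once the unimodular phase is factored out, the potential term is real and the
    derivative of the real amplitude is imaginary, so their squares add without a cross
    term.\<close>
  have mag: "mag_density b u g1 g2 x = (2 * A * fst x * F1 (Q x))\<^sup>2 + ((c + b / 2) * snd x * F (Q x))\<^sup>2
     + ((2 * B * snd x * F1 (Q x))\<^sup>2 + ((c - b / 2) * fst x * F (Q x))\<^sup>2)" for x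
  proof -
    have "- \<i> * g1 x - complex_of_real (b / 2 * (- snd x)) * u x
       = e x * Complex ((c + b / 2) * snd x * F (Q x)) (- (2 * A * fst x * F1 (Q x)))"
      unfolding g1_def u_def by (simp add: complex_eq_iff algebra_simps)
    moreover have "- \<i> * g2 x - complex_of_real (b / 2 * fst x) * u x
       = e x * Complex ((c - b / 2) * fst x * F (Q x)) (- (2 * B * snd x * F1 (Q x)))"
      unfolding g2_def u_def by (simp add: complex_eq_iff algebra_simps)
    ultimately show ?thesis unfolding mag_density_def
      by (simp add: norm_mult ne cmod_power2 power_mult_distrib)
  qed
  define w where "w = (\<lambda>z::real\<times>real. W (R * (norm z)\<^sup>2))"
  define w1 where "w1 = (\<lambda>z::real\<times>real. W1 (R * (norm z)\<^sup>2))"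
  define w2 where "w2 = (\<lambda>z::real\<times>real. W2 (R * (norm z)\<^sup>2))"
  have Rle: "R * s \<le> S" if "0 \<le> s" "s \<le> 1" for s
  proof -
    have "R * s \<le> R * 1" using that R0 by (intro mult_left_mono) auto
    then show ?thesis using RS by simp
  qed
  have R2: "\<bar>R * s\<bar> < 2 * S" if "0 \<le> s" "s \<le> 1" for s
    using Rle[OF that] R0 S_pos that by (simp add: abs_mult)
  have contR: "continuous_on (cball 0 1) (\<lambda>z::real\<times>real. G (R * (norm z)\<^sup>2))" if "\<And>t. \<bar>t\<bar> < 2 * S \<Longrightarrow> isCont G t" for G :: "real \<Rightarrow> real"
  proof (rule continuous_on_compose2[of "{-2*S<..<2*S}" G])
    show "continuous_on {-2*S<..<2*S} G" using that by (intro continuous_at_imp_continuous_on) auto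
    show "continuous_on (cball 0 1) (\<lambda>z::real\<times>real. R * (norm z)\<^sup>2)" by (intro continuous_intros)
    show "(\<lambda>z::real\<times>real. R * (norm z)\<^sup>2) ` cball 0 1 \<subseteq> {-2*S<..<2*S}"
    proof
      fix y assume "y \<in> (\<lambda>z::real\<times>real. R * (norm z)\<^sup>2) ` cball 0 1"
      then obtain z :: "real\<times>real" where z: "norm z \<le> 1" "y = R * (norm z)\<^sup>2" by auto
      have "\<bar>y\<bar> < 2 * S" unfolding z using z(1) by (intro R2) (auto simp: power_le_one)
      then show "y \<in> {-2*S<..<2*S}" by auto
    qed
  qed
  have wc: "continuous_on (cball 0 1) w" "continuous_on (cball 0 1) w1" "continuous_on (cball 0 1) w2"
    unfolding w_def w1_def w2_def using Wc W1c W2_cont by (auto intro!: contR)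
  define I where "I = (\<lambda>g::real\<times>real \<Rightarrow> real. \<integral>z. indicator D z * g z \<partial>lborel)"
  have int: "integrable lborel (\<lambda>z. indicator D z * g z)" if "continuous_on (cball 0 1) g" for g :: "real\<times>real \<Rightarrow> real"
    unfolding D_def using that by (rule integrable_unit_disk)
  have I_add: "I (\<lambda>z. g z + h z) = I g + I h" if "continuous_on (cball 0 1) g" "continuous_on (cball 0 1) h" for g h
    unfolding I_def using Bochner_Integration.integral_add[OF int[OF that(1)] int[OF that(2)]]
    by (simp add: algebra_simps)
  have I_cmult: "I (\<lambda>z. a * g z) = a * I g" for a g
    unfolding I_def by (simp add: mult.left_commute)
  have I_cong: "I g = I h" if "\<And>z. z \<in> D \<Longrightarrow> g z = h z" for g h
    unfolding I_def using that by (intro Bochner_Integration.integral_cong) (auto simp: indicator_def)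
  have swap: "I (\<lambda>z. (snd z)\<^sup>2 * g z) = I (\<lambda>z. (fst z)\<^sup>2 * g z)"
    if g: "continuous_on (cball 0 1) g" and rad: "\<And>z. g (snd z, fst z) = g z" for g
  proof -
    have "continuous_on (cball 0 1) (\<lambda>z. (fst z)\<^sup>2 * g z)" by (intro continuous_intros g)
    from borel_measurable_integrable[OF int[OF this]]
    have m: "(\<lambda>z. indicator D z * ((fst z)\<^sup>2 * g z)) \<in> borel_measurable borel" by simp
    have D: "indicator D (snd z, fst z) = (indicator D z :: real)" for z
      by (auto simp: D_def indicator_def norm_prod_def add.commute)
    show ?thesis using lborel_integral_swap[OF m] unfolding I_def by (simp add: D rad)
  qed
  have scale: "(LINT x:U|lborel. g x) = \<alpha> * \<beta> * I (\<lambda>z. g (\<alpha> * fst z, \<beta> * snd z))" if "continuous_on UNIV g" for g :: "real\<times>real \<Rightarrow> real"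
  proof -
    have "(\<lambda>x. indicator U x *\<^sub>R g x) \<in> borel_measurable borel"
      using ellipse_props(1)[OF ab] that
      by (intro borel_measurable_continuous_on_indicator continuous_on_subset[OF that]) (auto simp: U_def)
    from lborel_integral_scale2[OF this ab]
    have "(LINT x:U|lborel. g x) = \<alpha> * \<beta> * (\<integral>z. indicator U (\<alpha> * fst z, \<beta> * snd z) *\<^sub>R g (\<alpha> * fst z, \<beta> * snd z) \<partial>lborel)"
      unfolding set_lebesgue_integral_def .
    moreover have "indicator U (\<alpha> * fst z, \<beta> * snd z) = (indicator D z :: real)" for z
      using ellipse_props(3)[OF ab, of z] by (auto simp: indicator_def U_def D_def)
    ultimately show ?thesis unfolding I_def by simp
  qed
  have QD: "Q (\<alpha> * fst z, \<beta> * snd z) = R * (norm z)\<^sup>2" for z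
    using ab by (simp add: Q_def A_def B_def norm_power2_prod power_mult_distrib field_simps)
  have inD: "F (R * (norm z)\<^sup>2) = w z" "F1 (R * (norm z)\<^sup>2) = w1 z" if "z \<in> D" for z
  proof -
    have "R * (norm z)\<^sup>2 \<le> S" using that by (intro Rle) (auto simp: D_def power_le_one)
    then show "F (R * (norm z)\<^sup>2) = w z" "F1 (R * (norm z)\<^sup>2) = w1 z" by (auto simp: F_eq w_def w1_def)
  qed
  have norm_u: "(LINT x:U|lborel. (cmod (u x))\<^sup>2) = \<alpha> * \<beta> * I (\<lambda>z. (w z)\<^sup>2)"
  proof -
    have "(LINT x:U|lborel. (cmod (u x))\<^sup>2) = \<alpha> * \<beta> * I (\<lambda>z. (cmod (u (\<alpha> * fst z, \<beta> * snd z)))\<^sup>2)"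
      by (intro scale continuous_intros C1_gradD[OF Cu])
    also have "I (\<lambda>z. (cmod (u (\<alpha> * fst z, \<beta> * snd z)))\<^sup>2) = I (\<lambda>z. (w z)\<^sup>2)"
      by (intro I_cong) (simp add: cu QD inD)
    finally show ?thesis .
  qed
  \<comment> \<open>After rescaling to the unit disk, p and r are the coefficients of x^2 and y^2 in
    the energy density. The function l is the coefficient of |z|^2 when \<mu> w^2 is rewritten by
    the differential equation.\<close>
  define p where "p = (\<lambda>z. 4 * R\<^sup>2 / \<alpha>\<^sup>2 * (w1 z)\<^sup>2 + m2\<^sup>2 * \<alpha>\<^sup>2 * (w z)\<^sup>2)"
  define r where "r = (\<lambda>z. 4 * R\<^sup>2 / \<beta>\<^sup>2 * (w1 z)\<^sup>2 + m1\<^sup>2 * \<beta>\<^sup>2 * (w z)\<^sup>2)"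
  define l where "l = (\<lambda>z. b\<^sup>2 * R / 4 * (w z)\<^sup>2 - 4 * R * (w2 z * w z))"
  have pc: "continuous_on (cball 0 1) p" "continuous_on (cball 0 1) r" "continuous_on (cball 0 1) l"
    unfolding p_def r_def l_def by (intro continuous_intros wc)+
  have sym: "w (snd z, fst z) = w z" "w1 (snd z, fst z) = w1 z" "w2 (snd z, fst z) = w2 z" for z
    by (auto simp: w_def w1_def w2_def norm_power2_prod add.commute)
  have energy: "(LINT x:U|lborel. mag_density b u g1 g2 x) = \<alpha> * \<beta> * I (\<lambda>z. (fst z)\<^sup>2 * (p z + r z))"
  proof -
    have "(LINT x:U|lborel. mag_density b u g1 g2 x) = \<alpha> * \<beta> * I (\<lambda>z. mag_density b u g1 g2 (\<alpha> * fst z, \<beta> * snd z))"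
      unfolding mag_density_def by (intro scale continuous_intros C1_gradD[OF Cu])
    also have "I (\<lambda>z. mag_density b u g1 g2 (\<alpha> * fst z, \<beta> * snd z)) = I (\<lambda>z. (fst z)\<^sup>2 * p z + (snd z)\<^sup>2 * r z)"
    proof (rule I_cong)
      fix z assume z: "z \<in> D"
      show "mag_density b u g1 g2 (\<alpha> * fst z, \<beta> * snd z) = (fst z)\<^sup>2 * p z + (snd z)\<^sup>2 * r z"
        unfolding mag QD inD[OF z] c1 c2 p_def r_def A_def B_def
        using ab by (simp add: power_mult_distrib power_divide field_simps)
    qed
    also have "\<dots> = I (\<lambda>z. (fst z)\<^sup>2 * p z) + I (\<lambda>z. (snd z)\<^sup>2 * r z)"
      by (intro I_add continuous_intros pc)
    also have "I (\<lambda>z. (snd z)\<^sup>2 * r z) = I (\<lambda>z. (fst z)\<^sup>2 * r z)"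
      by (rule swap[OF pc(2)]) (simp add: r_def sym)
    also have "I (\<lambda>z. (fst z)\<^sup>2 * p z) + I (\<lambda>z. (fst z)\<^sup>2 * r z) = I (\<lambda>z. (fst z)\<^sup>2 * p z + (fst z)\<^sup>2 * r z)"
      by (intro I_add[symmetric] continuous_intros pc)
    finally show ?thesis by (simp add: algebra_simps)
  qed
  have Rs: "R * (\<alpha>\<^sup>2 + \<beta>\<^sup>2) = 2 * \<alpha>\<^sup>2 * \<beta>\<^sup>2" using s0 by (simp add: R_def)
  \<comment> \<open>This is where R is forced: for the harmonic mean R of
    \<open>\<alpha>\<^sup>2\<close> and \<open>\<beta>\<^sup>2\<close> the averaged gradient and
    potential coefficients are those of a disk of radius sqrt R.\<close>
  have pr: "p z + r z = 8 * R * (w1 z)\<^sup>2 + b\<^sup>2 * R / 2 * (w z)\<^sup>2" for z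
  proof -
    have "4 * R\<^sup>2 / \<alpha>\<^sup>2 + 4 * R\<^sup>2 / \<beta>\<^sup>2 = 4 * R * (R * (\<alpha>\<^sup>2 + \<beta>\<^sup>2)) / (\<alpha>\<^sup>2 * \<beta>\<^sup>2)"
      using ab by (simp add: field_simps power2_eq_square)
    also have "\<dots> = 8 * R" unfolding Rs using ab by simp
    finally have 1: "4 * R\<^sup>2 / \<alpha>\<^sup>2 + 4 * R\<^sup>2 / \<beta>\<^sup>2 = 8 * R" .
    have "m2\<^sup>2 * \<alpha>\<^sup>2 + m1\<^sup>2 * \<beta>\<^sup>2
       = b\<^sup>2 * (\<alpha>\<^sup>2 * \<beta>\<^sup>2) * (\<alpha>\<^sup>2 + \<beta>\<^sup>2) / (\<alpha>\<^sup>2 + \<beta>\<^sup>2)\<^sup>2"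
      unfolding m1_def m2_def power_divide power_mult_distrib by (simp add: add_divide_distrib[symmetric] algebra_simps power2_eq_square)
    also have "\<dots> = b\<^sup>2 * (\<alpha>\<^sup>2 * \<beta>\<^sup>2) / (\<alpha>\<^sup>2 + \<beta>\<^sup>2)" using s0 by (simp add: power2_eq_square)
    also have "\<dots> = b\<^sup>2 * R / 2"
    proof -
      have "\<alpha>\<^sup>2 * \<beta>\<^sup>2 = R / 2 * (\<alpha>\<^sup>2 + \<beta>\<^sup>2)" using Rs by simp
      then have "b\<^sup>2 * (\<alpha>\<^sup>2 * \<beta>\<^sup>2) = (b\<^sup>2 * R / 2) * (\<alpha>\<^sup>2 + \<beta>\<^sup>2)" by simp
      then show ?thesis by (rule nonzero_divide_eq_eq[OF nz, THEN iffD2])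
    qed
    finally have 2: "m2\<^sup>2 * \<alpha>\<^sup>2 + m1\<^sup>2 * \<beta>\<^sup>2 = b\<^sup>2 * R / 2" .
    show ?thesis unfolding p_def r_def 1[symmetric] 2[symmetric] by (simp only: algebra_simps)
  qed
  have mu: "\<mu> * I (\<lambda>z. (w z)\<^sup>2) = I (\<lambda>z. (fst z)\<^sup>2 * (2 * l z)) + I (\<lambda>z. (-4) * (w1 z * w z))"
  proof -
    have "\<mu> * I (\<lambda>z. (w z)\<^sup>2) = I (\<lambda>z. \<mu> * (w z)\<^sup>2)" by (simp add: I_cmult)
    also have "\<dots> = I (\<lambda>z. ((fst z)\<^sup>2 * l z + (snd z)\<^sup>2 * l z) + (-4) * (w1 z * w z))"
    proof (rule I_cong)
      fix z assume "z \<in> D"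
      then have "\<bar>R * (norm z)\<^sup>2\<bar> < 2 * S" by (intro R2) (auto simp: D_def power_le_one)
      from ode[OF this] have "\<mu> * w z = b\<^sup>2 * (R * (norm z)\<^sup>2) / 4 * w z - 4 * (R * (norm z)\<^sup>2 * w2 z + w1 z)"
        unfolding w_def w1_def w2_def by (simp add: algebra_simps)
      then have "\<mu> * (w z)\<^sup>2 = (b\<^sup>2 * (R * (norm z)\<^sup>2) / 4 * w z - 4 * (R * (norm z)\<^sup>2 * w2 z + w1 z)) * w z"
        by (simp add: power2_eq_square)
      then show "\<mu> * (w z)\<^sup>2 = ((fst z)\<^sup>2 * l z + (snd z)\<^sup>2 * l z) + (-4) * (w1 z * w z)"
        unfolding l_def norm_power2_prod by (simp add: power2_eq_square algebra_simps)
    qed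
    also have "\<dots> = I (\<lambda>z. (fst z)\<^sup>2 * l z + (snd z)\<^sup>2 * l z) + I (\<lambda>z. (-4) * (w1 z * w z))"
      by (intro I_add continuous_intros pc wc)
    also have "I (\<lambda>z. (fst z)\<^sup>2 * l z + (snd z)\<^sup>2 * l z) = I (\<lambda>z. (fst z)\<^sup>2 * l z) + I (\<lambda>z. (snd z)\<^sup>2 * l z)"
      by (intro I_add continuous_intros pc)
    also have "I (\<lambda>z. (snd z)\<^sup>2 * l z) = I (\<lambda>z. (fst z)\<^sup>2 * l z)"
      by (rule swap[OF pc(3)]) (simp add: l_def sym)
    also have "I (\<lambda>z. (fst z)\<^sup>2 * l z) + I (\<lambda>z. (fst z)\<^sup>2 * l z) = I (\<lambda>z. (fst z)\<^sup>2 * (2 * l z))"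
      using I_cmult[of 2 "\<lambda>z. (fst z)\<^sup>2 * l z"] by (simp add: mult.left_commute)
    finally show ?thesis .
  qed
  \<comment> \<open>The flux W W' along the rescaled radius. The term 8 x^2 h' accounts for the gap
    between the gradient energy 8 R x^2 w1^2 and the term -8 R x^2 w w2 from the equation, and 4 h
    cancels -4 w w1; so the energy exceeds its \<mu>-multiple of the mass by a divergence, that is,
    by a boundary value.\<close>
  define h where "h = (\<lambda>s. W (R * s) * W1 (R * s))"
  define h' where "h' = (\<lambda>s. R * (W1 (R * s) * W1 (R * s) + W (R * s) * W2 (R * s)))"
  have div: "I (\<lambda>z. h ((norm z)\<^sup>2) + 2 * (fst z)\<^sup>2 * h' ((norm z)\<^sup>2)) = h 1 * measure lborel D"
    unfolding I_def D_def
  proof (rule unit_disk_divergence)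
    fix s :: real assume s: "0 \<le> s" "s \<le> 1"
    have dR: "((\<lambda>s. R * s) has_real_derivative R) (at s)" by (auto intro!: derivative_eq_intros)
    show "(h has_real_derivative h' s) (at s)" unfolding h_def h'_def
      by (rule DERIV_cong[OF DERIV_mult[OF DERIV_chain2[OF dW[OF R2[OF s]] dR] DERIV_chain2[OF dW1[OF R2[OF s]] dR]]])
        (simp add: algebra_simps)
  next
    have "continuous_on {0..1} (\<lambda>s. G (R * s))" if "\<And>t. \<bar>t\<bar> < 2 * S \<Longrightarrow> isCont G t" for G :: "real \<Rightarrow> real"
      using that R2 by (intro continuous_at_imp_continuous_on ballI isCont_o2[where f="\<lambda>s. R * s" and g=G]) auto
    then show "continuous_on {0..1} h'" unfolding h'_def
      using Wc W1c W2_cont by (intro continuous_intros) auto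
  qed
  have "I (\<lambda>z. (fst z)\<^sup>2 * (p z + r z)) = I (\<lambda>z. ((fst z)\<^sup>2 * (2 * l z) + (-4) * (w1 z * w z)) + 4 * (h ((norm z)\<^sup>2) + 2 * (fst z)\<^sup>2 * h' ((norm z)\<^sup>2)))"
    unfolding pr l_def h_def h'_def w_def w1_def w2_def
    by (intro I_cong) (simp add: power2_eq_square algebra_simps)
  also have "\<dots> = I (\<lambda>z. (fst z)\<^sup>2 * (2 * l z) + (-4) * (w1 z * w z)) + I (\<lambda>z. 4 * (h ((norm z)\<^sup>2) + 2 * (fst z)\<^sup>2 * h' ((norm z)\<^sup>2)))"
  proof (rule I_add)
    show "continuous_on (cball 0 1) (\<lambda>z. (fst z)\<^sup>2 * (2 * l z) + (-4) * (w1 z * w z))"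
      by (intro continuous_intros pc wc)
    show "continuous_on (cball 0 1) (\<lambda>z::real\<times>real. 4 * (h ((norm z)\<^sup>2) + 2 * (fst z)\<^sup>2 * h' ((norm z)\<^sup>2)))"
      unfolding h_def h'_def by (intro continuous_intros wc[unfolded w_def w1_def w2_def])
  qed
  also have "I (\<lambda>z. (fst z)\<^sup>2 * (2 * l z) + (-4) * (w1 z * w z)) = \<mu> * I (\<lambda>z. (w z)\<^sup>2)"
    unfolding mu by (intro I_add continuous_intros pc wc)
  also have "I (\<lambda>z. 4 * (h ((norm z)\<^sup>2) + 2 * (fst z)\<^sup>2 * h' ((norm z)\<^sup>2))) = 4 * (h 1 * measure lborel D)"
    unfolding I_cmult div ..
  finally have E: "(LINT x:U|lborel. mag_density b u g1 g2 x) = \<alpha> * \<beta> * (\<mu> * I (\<lambda>z. (w z)\<^sup>2) + 4 * (h 1 * measure lborel D))"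
    unfolding energy by simp
  have Ipos: "0 < I (\<lambda>z. (w z)\<^sup>2)"
  proof -
    have "I (\<lambda>z. (w z)\<^sup>2) \<noteq> 0"
    proof
      assume "I (\<lambda>z. (w z)\<^sup>2) = 0"
      then have "AE z in lborel. indicator D z * (w z)\<^sup>2 = 0"
        unfolding I_def by (subst (asm) integral_nonneg_eq_0_iff_AE) (auto intro!: int continuous_intros wc)
      then have "AE z in lborel. z \<notin> D"
      proof eventually_elim
        case (elim z)
        have "w z > 0" if "z \<in> D"
        proof -
          have "0 \<le> R * (norm z)\<^sup>2" using R0 by simp
          moreover have "R * (norm z)\<^sup>2 \<le> S" using that by (intro Rle) (auto simp: D_def power_le_one)
          ultimately show ?thesis unfolding w_def by (intro W_pos) simp
        qed
        then show ?case using elim by (auto simp: indicator_def)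
      qed
      then have "D \<in> null_sets lborel"
        by (subst (asm) AE_iff_null_sets[symmetric]) (auto simp: D_def)
      then show False using open_not_negligible[of D]
        by (auto simp: D_def negligible_iff_null_sets dest: null_sets_completionI)
    qed
    moreover have "0 \<le> I (\<lambda>z. (w z)\<^sup>2)" unfolding I_def by (intro Bochner_Integration.integral_nonneg) auto
    ultimately show ?thesis by simp
  qed
  show thesis
  proof (rule that[OF H[unfolded U_def]])
    show "0 < (LINT x:ellipse \<alpha> \<beta>|lborel. (cmod (u x))\<^sup>2)"
      using norm_u Ipos ab unfolding U_def by simp
    show "(LINT x:ellipse \<alpha> \<beta>|lborel. mag_density b u g1 g2 x) =
      \<mu> * (LINT x:ellipse \<alpha> \<beta>|lborel. (cmod (u x))\<^sup>2) + 4 * \<alpha> * \<beta> * (W R * W1 R) * measure lborel (ball (0::real\<times>real) 1)"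
      using E norm_u unfolding U_def D_def by (simp add: h_def algebra_simps)
  qed
qed

section \<open>Comparison of ellipse and disk\<close>

lemma mu1_disk_ge: "\<mu> \<le> mu1 b (ball 0 (sqrt S))"
  unfolding mu1_def
proof (rule cInf_greatest)
  have s: "0 < sqrt S" using S_pos by simp
  \<comment> \<open>The infimum is meaningful only over a nonempty set of quotients; the trial
    function for the circular case \<alpha> = \<beta> = sqrt S, where R = S, is a member.\<close>
  have "2 * (sqrt S)\<^sup>2 * (sqrt S)\<^sup>2 / ((sqrt S)\<^sup>2 + (sqrt S)\<^sup>2) \<le> S" using S_pos by simp
  then obtain u g1 g2
    where "H1_grad (ellipse (sqrt S) (sqrt S)) u g1 g2"
      "0 < (LINT x:ellipse (sqrt S) (sqrt S)|lborel. (cmod (u x))\<^sup>2)"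
    by (rule ellipse_trial_function[OF s s])
  then have "H1_grad (ball 0 (sqrt S)) u g1 g2 \<and> (LINT x:ball 0 (sqrt S)|lborel. (cmod (u x))\<^sup>2) \<noteq> 0"
    unfolding ellipse_eq_ball[OF s] by simp
  then show "{(LINT x:ball 0 (sqrt S)|lborel. mag_density b u g1 g2 x) / (LINT x:ball 0 (sqrt S)|lborel. (cmod (u x))\<^sup>2) | u g1 g2.
      H1_grad (ball 0 (sqrt S)) u g1 g2 \<and> (LINT x:ball 0 (sqrt S)|lborel. (cmod (u x))\<^sup>2) \<noteq> 0} \<noteq> {}"
    by blast
next
  fix y
  assume "y \<in> {(LINT x:ball 0 (sqrt S)|lborel. mag_density b u g1 g2 x) / (LINT x:ball 0 (sqrt S)|lborel. (cmod (u x))\<^sup>2) | u g1 g2.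
      H1_grad (ball 0 (sqrt S)) u g1 g2 \<and> (LINT x:ball 0 (sqrt S)|lborel. (cmod (u x))\<^sup>2) \<noteq> 0}"
  then obtain u g1 g2 where y: "y = (LINT x:ball 0 (sqrt S)|lborel. mag_density b u g1 g2 x) / (LINT x:ball 0 (sqrt S)|lborel. (cmod (u x))\<^sup>2)"
    and H: "H1_grad (ball 0 (sqrt S)) u g1 g2" and nz: "(LINT x:ball 0 (sqrt S)|lborel. (cmod (u x))\<^sup>2) \<noteq> 0" by blast
  have "0 \<le> (LINT x:ball 0 (sqrt S)|lborel. (cmod (u x))\<^sup>2)"
    unfolding set_lebesgue_integral_def by (intro Bochner_Integration.integral_nonneg) auto
  then have "0 < (LINT x:ball 0 (sqrt S)|lborel. (cmod (u x))\<^sup>2)" using nz by simp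
  then show "\<mu> \<le> y" unfolding y using disk_lower_bound[OF H] by (simp add: pos_le_divide_eq)
qed

text \<open>The trial quotient is \<mu> plus a positive multiple of \<open>W1 R\<close>, while \<mu>
  bounds the disk eigenvalue from below. The two cases are the Neumann point R = S and an interior
  point R < S.\<close>

lemma mu1_ellipse_le_disk:
  assumes ab: "0 < \<alpha>" "0 < \<beta>"
  defines "R \<equiv> 2 * \<alpha>\<^sup>2 * \<beta>\<^sup>2 / (\<alpha>\<^sup>2 + \<beta>\<^sup>2)"
  assumes RS: "R \<le> S"
  shows "mu1 b (ellipse \<alpha> \<beta>) \<le> mu1 b (ball 0 (sqrt S))"
    and "R < S \<Longrightarrow> mu1 b (ellipse \<alpha> \<beta>) < mu1 b (ball 0 (sqrt S))"
proof -
  obtain u g1 g2 where H: "H1_grad (ellipse \<alpha> \<beta>) u g1 g2"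
    and N': "0 < (LINT x:ellipse \<alpha> \<beta>|lborel. (cmod (u x))\<^sup>2)"
    and E: "(LINT x:ellipse \<alpha> \<beta>|lborel. mag_density b u g1 g2 x) =
      \<mu> * (LINT x:ellipse \<alpha> \<beta>|lborel. (cmod (u x))\<^sup>2) + 4 * \<alpha> * \<beta> * (W R * W1 R) * measure lborel (ball (0::real\<times>real) 1)"
    using RS unfolding R_def by (rule ellipse_trial_function[OF ab])
  define N where "N = (LINT x:ellipse \<alpha> \<beta>|lborel. (cmod (u x))\<^sup>2)"
  have N: "0 < N" using N' by (simp add: N_def)
  have s0: "0 < \<alpha>\<^sup>2 + \<beta>\<^sup>2" using ab by (intro add_pos_pos) auto
  have R0: "0 < R" unfolding R_def using ab s0 by auto
  have D: "0 < measure lborel (ball (0::real\<times>real) 1)"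
    using content_ball_pos[of 1 "0::real\<times>real"] by simp
  have WR: "0 < W R" using W_pos[of R] R0 RS by simp
  define C where "C = 4 * \<alpha> * \<beta> * W R * measure lborel (ball (0::real\<times>real) 1)"
  have C: "0 < C" unfolding C_def using ab WR D by simp
  have le: "mu1 b (ellipse \<alpha> \<beta>) \<le> \<mu> + C * W1 R / N"
    using mu1_le_rayleigh[OF H N', of b] N unfolding E N_def[symmetric] C_def by (simp add: add_divide_distrib algebra_simps)
  show "mu1 b (ellipse \<alpha> \<beta>) < mu1 b (ball 0 (sqrt S))" if "R < S"
  proof -
    have "C * W1 R / N < 0" using W1_neg[OF R0 that] C N by (intro divide_neg_pos mult_pos_neg) auto
    then show ?thesis using le mu1_disk_ge by linarith
  qed
  moreover have "mu1 b (ellipse \<alpha> \<beta>) \<le> mu1 b (ball 0 (sqrt S))" if "R = S"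
    using le mu1_disk_ge neumann that by simp
  ultimately show "mu1 b (ellipse \<alpha> \<beta>) \<le> mu1 b (ball 0 (sqrt S))"
    using RS by fastforce
qed

end

lemma mu1_ellipse_disk_comparison:
  assumes ab: "0 < \<alpha>" "0 < \<beta>" and b: "0 < b" "b * S < 1"
    and RS: "2 * \<alpha>\<^sup>2 * \<beta>\<^sup>2 / (\<alpha>\<^sup>2 + \<beta>\<^sup>2) \<le> S"
  shows "mu1 b (ellipse \<alpha> \<beta>) \<le> mu1 b (ball 0 (sqrt S))"
    and "2 * \<alpha>\<^sup>2 * \<beta>\<^sup>2 / (\<alpha>\<^sup>2 + \<beta>\<^sup>2) < S \<Longrightarrow> mu1 b (ellipse \<alpha> \<beta>) < mu1 b (ball 0 (sqrt S))"
proof -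
  have "0 < 2 * \<alpha>\<^sup>2 * \<beta>\<^sup>2 / (\<alpha>\<^sup>2 + \<beta>\<^sup>2)" using ab by (intro divide_pos_pos add_pos_pos mult_pos_pos) auto
  then have S: "0 < S" using RS by linarith
  have "mu1 b (ellipse \<alpha> \<beta>) \<le> mu1 b (ball 0 (sqrt S)) \<and>
    (2 * \<alpha>\<^sup>2 * \<beta>\<^sup>2 / (\<alpha>\<^sup>2 + \<beta>\<^sup>2) < S \<longrightarrow> mu1 b (ellipse \<alpha> \<beta>) < mu1 b (ball 0 (sqrt S)))"
  proof (rule radial_eigenfunction[OF b(1) S b(2)])
    fix \<mu> W W1 W2
    assume "\<And>t. \<bar>t\<bar> < 2 * S \<Longrightarrow> (W has_real_derivative W1 t) (at t)"
      "\<And>t. \<bar>t\<bar> < 2 * S \<Longrightarrow> (W1 has_real_derivative W2 t) (at t)"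
      "\<And>t. \<bar>t\<bar> < 2 * S \<Longrightarrow> isCont W2 t"
      "\<And>t. \<bar>t\<bar> < 2 * S \<Longrightarrow> 4 * (t * W2 t + W1 t) = (b\<^sup>2 * t / 4 - \<mu>) * W t"
      "\<And>t. \<bar>t\<bar> \<le> S \<Longrightarrow> W t > 0"
      "W1 S = 0" "\<And>t. 0 < t \<Longrightarrow> t < S \<Longrightarrow> W1 t < 0"
    then interpret radial_ground_state b S \<mu> W W1 W2
      by (intro radial_ground_state.intro b S)
    show ?thesis using mu1_ellipse_le_disk[OF ab RS] by blast
  qed
  then show "mu1 b (ellipse \<alpha> \<beta>) \<le> mu1 b (ball 0 (sqrt S))"
    "2 * \<alpha>\<^sup>2 * \<beta>\<^sup>2 / (\<alpha>\<^sup>2 + \<beta>\<^sup>2) < S \<Longrightarrow> mu1 b (ellipse \<alpha> \<beta>) < mu1 b (ball 0 (sqrt S))"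
    by auto
qed

theorem theorem5p1:
  fixes \<alpha> \<beta> b :: real
  assumes "\<alpha> > 0" and "\<beta> > 0" and "b > 0" and "b * \<alpha> * \<beta> < 1"
  shows "mu1 b (ellipse \<alpha> \<beta>)
           \<le> mu1 b (ball 0 (sqrt 2 * \<alpha> * \<beta> / sqrt (\<alpha>\<^sup>2 + \<beta>\<^sup>2)))
         \<and> (\<alpha> \<noteq> \<beta> \<longrightarrow> mu1 b (ellipse \<alpha> \<beta>) < mu1 b (ball 0 (sqrt (\<alpha> * \<beta>))))"
proof -
  define R where "R = 2 * \<alpha>\<^sup>2 * \<beta>\<^sup>2 / (\<alpha>\<^sup>2 + \<beta>\<^sup>2)"
  have s0: "0 < \<alpha>\<^sup>2 + \<beta>\<^sup>2" using assms by (intro add_pos_pos) auto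
  \<comment> \<open>A positive multiple of a square: it gives R \<le> \<alpha> \<beta> always and
    strict inequality as soon as \<alpha> and \<beta> differ.\<close>
  have gap: "\<alpha> * \<beta> - R = \<alpha> * \<beta> * (\<alpha> - \<beta>)\<^sup>2 / (\<alpha>\<^sup>2 + \<beta>\<^sup>2)"
  proof -
    have "\<alpha> * \<beta> * (\<alpha> - \<beta>)\<^sup>2 = \<alpha> * \<beta> * (\<alpha>\<^sup>2 + \<beta>\<^sup>2) - 2 * \<alpha>\<^sup>2 * \<beta>\<^sup>2"
      by (simp add: power2_eq_square algebra_simps)
    then show ?thesis using s0 by (simp add: R_def diff_divide_distrib)
  qed
  have "0 \<le> \<alpha> * \<beta> * (\<alpha> - \<beta>)\<^sup>2 / (\<alpha>\<^sup>2 + \<beta>\<^sup>2)" using assms s0 by simp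
  then have le: "R \<le> \<alpha> * \<beta>" using gap by linarith
  have "b * R \<le> b * (\<alpha> * \<beta>)" using le assms by (intro mult_left_mono) auto
  then have bR: "b * R < 1" using assms(4) by (simp only: mult.assoc)
  have "sqrt R = sqrt 2 * \<alpha> * \<beta> / sqrt (\<alpha>\<^sup>2 + \<beta>\<^sup>2)"
    using assms by (simp add: R_def real_sqrt_divide real_sqrt_mult)
  then have 1: "mu1 b (ellipse \<alpha> \<beta>) \<le> mu1 b (ball 0 (sqrt 2 * \<alpha> * \<beta> / sqrt (\<alpha>\<^sup>2 + \<beta>\<^sup>2)))"
    using mu1_ellipse_disk_comparison(1)[OF assms(1-3) bR] unfolding R_def by simp
  have 2: "mu1 b (ellipse \<alpha> \<beta>) < mu1 b (ball 0 (sqrt (\<alpha> * \<beta>)))" if "\<alpha> \<noteq> \<beta>"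
  proof -
    have "0 < \<alpha> * \<beta> * (\<alpha> - \<beta>)\<^sup>2 / (\<alpha>\<^sup>2 + \<beta>\<^sup>2)" using assms s0 that by simp
    then have "R < \<alpha> * \<beta>" using gap by linarith
    then show ?thesis
      using mu1_ellipse_disk_comparison(2)[OF assms(1-3), of "\<alpha> * \<beta>"] assms(4) unfolding R_def
      by (simp add: mult.assoc)
  qed
  show ?thesis using 1 2 by blast
qed

end
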